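(* Let $x_0\ge 0$ and let $X_1$ be the value at time $t=1$ of the strong solution of $dX_t = 1\,dt + 2\sqrt{X_t}\,dW_t$, $X_0=x_0$. For all $p\in[1,\infty)$ the $n$-th minimal error for equidistant methods satisfies $$e_p^{\mathrm{eq}}(n)\succcurlyeq n^{-1/2}.$$
   Context: $W=(W_t)_{t\ge0}$ is a standard one-dimensional Brownian motion with respect to a filtration satisfying the usual conditions on a complete probability space. The SDE $dX_t = 1\,dt + 2\sqrt{X_t}\,dW_t$, $X_0=x_0\ge0$, driven by $W$, has a unique non-negative strong solution $X$. For a random variable $\widehat X_1$ and $p\in[1,\infty)$ put $e_p(\widehat X_1)=\left(\mathrm{E}\,|X_1-\widehat X_1|^p\right)^{1/p}$. For $n\in\mathbb N=\{1,2,\dots\}$ define $$e_p^{\mathrm{eq}}(n)=\inf\left\{e_p(\widehat X_1):\ \widehat X_1=\Phi(W_{1/n},W_{2/n},\dots,W_1),\ \Phi:\mathbb R^n\to\mathbb R\text{ Borel-measurable}\right\}.$$ For sequences of non-negative reals, $a_n\succcurlyeq b_n$ means there is a constant $c>0$ with $b_n\le c\,a_n$ for all $n\in\mathbb N$ (the constant may depend on $p$ and $x_0$, but not on $n$). *)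

theory Defs
  imports "HOL-Probability.Probability"
begin

text \<open>
  Time is \<^typ>\<open>real\<close>, but only times \<open>t \<ge> 0\<close> matter: nothing is assumed of processes at
  negative times, and any filtration on \<open>[0,\<infinity>)\<close> extends to \<^typ>\<open>real\<close> by
  \<open>F t = F 0\<close> for \<open>t < 0\<close>.
\<close>

locale usual_filtered_prob_space = prob_space M + complete_measure M + filtration "space M" F
  for M :: "'a measure" and F :: "real \<Rightarrow> 'a measure" +
  assumes subalgebra_F: "\<And>t. subalgebra M (F t)"
    and null_sets_F: "null_sets M \<subseteq> sets (F 0)"
    and right_continuous_F: "\<And>t. 0 \<le> t \<Longrightarrow> sets (F t) = (\<Inter>u\<in>{t<..}. sets (F u))"

locale brownian_motion = usual_filtered_prob_space M F
  for M :: "'a measure" and F :: "real \<Rightarrow> 'a measure" +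
  fixes W :: "real \<Rightarrow> 'a \<Rightarrow> real"
  assumes adapted: "\<And>t. 0 \<le> t \<Longrightarrow> W t \<in> borel_measurable (F t)"
    and start_zero: "AE \<omega> in M. W 0 \<omega> = 0"
    and continuous_paths: "AE \<omega> in M. continuous_on {0..} (\<lambda>t. W t \<omega>)"
    and normal_increments: "\<And>s t. 0 \<le> s \<Longrightarrow> s < t \<Longrightarrow>
      distributed M lborel (\<lambda>\<omega>. W t \<omega> - W s \<omega>) (normal_density 0 (sqrt (t - s)))"
    and indep_increments: "\<And>s t. 0 \<le> s \<Longrightarrow> s < t \<Longrightarrow>
      indep_set (sets (F s)) (sets (vimage_algebra (space M) (\<lambda>\<omega>. W t \<omega> - W s \<omega>) borel))"


subsection \<open>The Ito integral\<close>

definition progressively_measurable ::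
  "(real \<Rightarrow> 'a measure) \<Rightarrow> (real \<Rightarrow> 'a \<Rightarrow> real) \<Rightarrow> bool" where
  "progressively_measurable F H \<longleftrightarrow>
    (\<forall>t\<ge>0. (\<lambda>(s, \<omega>). H s \<omega>) \<in> borel_measurable (restrict_space borel {0..t} \<Otimes>\<^sub>M F t))"

definition ito_integrand ::
  "'a measure \<Rightarrow> (real \<Rightarrow> 'a measure) \<Rightarrow> (real \<Rightarrow> 'a \<Rightarrow> real) \<Rightarrow> bool" where
  "ito_integrand M F H \<longleftrightarrow> progressively_measurable F H \<and>
    (\<forall>t\<ge>0. AE \<omega> in M. (\<integral>\<^sup>+ s\<in>{0..t}. ennreal ((H s \<omega>)\<^sup>2) \<partial>lborel) < \<infinity>)"

text \<open>
  \<open>Simple m \<tau> \<xi>\<close> stands for the process \<open>\<Sum>i<m. \<xi> i \<cdot> 1_{(\<tau> i, \<tau> (i+1)]}\<close>; the values of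
  \<open>\<tau>\<close> beyond \<open>m\<close> and of \<open>\<xi>\<close> from \<open>m\<close> on are irrelevant.
\<close>

datatype 'a simple_process =
  Simple (pieces: nat) (knot: "nat \<Rightarrow> real") (coef: "nat \<Rightarrow> 'a \<Rightarrow> real")

definition simple_adapted :: "(real \<Rightarrow> 'a measure) \<Rightarrow> 'a simple_process \<Rightarrow> bool" where
  "simple_adapted F K \<longleftrightarrow> 0 \<le> knot K 0 \<and>
    (\<forall>i<pieces K. knot K i < knot K (Suc i) \<and>
      coef K i \<in> borel_measurable (F (knot K i)) \<and>
      (\<exists>C. \<forall>\<omega>\<in>space (F (knot K i)). \<bar>coef K i \<omega>\<bar> \<le> C))"

definition simple_value :: "'a simple_process \<Rightarrow> real \<Rightarrow> 'a \<Rightarrow> real" where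
  "simple_value K s \<omega> =
    (\<Sum>i<pieces K. coef K i \<omega> * indicator {knot K i<..knot K (Suc i)} s)"

definition simple_integral ::
  "(real \<Rightarrow> 'a \<Rightarrow> real) \<Rightarrow> 'a simple_process \<Rightarrow> real \<Rightarrow> 'a \<Rightarrow> real" where
  "simple_integral W K t \<omega> =
    (\<Sum>i<pieces K. coef K i \<omega> * (W (min (knot K (Suc i)) t) \<omega> - W (min (knot K i) t) \<omega>))"

text \<open>
  \<open>has_ito_integral M F W H t J\<close>: the random variable \<open>J\<close> is a version of \<open>\<integral>\<^sub>0\<^sup>t H dW\<close>, i.e.
  there are simple processes \<open>K k\<close> with \<open>\<integral>\<^sub>0\<^sup>t (K k - H)\<^sup>2 ds \<longlongrightarrow> 0\<close> and
  \<open>\<integral>\<^sub>0\<^sup>t (K k) dW \<longlongrightarrow> J\<close>, both in probability. This determines \<open>J\<close> up to null sets.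
\<close>

definition has_ito_integral ::
  "'a measure \<Rightarrow> (real \<Rightarrow> 'a measure) \<Rightarrow> (real \<Rightarrow> 'a \<Rightarrow> real) \<Rightarrow> (real \<Rightarrow> 'a \<Rightarrow> real) \<Rightarrow>
    real \<Rightarrow> ('a \<Rightarrow> real) \<Rightarrow> bool" where
  "has_ito_integral M F W H t J \<longleftrightarrow>
    ito_integrand M F H \<and> J \<in> borel_measurable M \<and>
    (\<exists>K :: nat \<Rightarrow> 'a simple_process.
      (\<forall>k. simple_adapted F (K k)) \<and>
      (\<forall>\<epsilon>>0. (\<lambda>k. measure M {\<omega>\<in>space M.
          (\<integral>\<^sup>+ s\<in>{0..t}. ennreal ((simple_value (K k) s \<omega> - H s \<omega>)\<^sup>2) \<partial>lborel) > ennreal \<epsilon>})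
        \<longlonglongrightarrow> 0) \<and>
      (\<forall>\<epsilon>>0. (\<lambda>k. measure M {\<omega>\<in>space M. \<bar>simple_integral W (K k) t \<omega> - J \<omega>\<bar> > \<epsilon>})
        \<longlonglongrightarrow> 0))"


subsection \<open>Stochastic differential equations\<close>

text \<open>
  \<open>X\<close> solves \<open>dX\<^sub>t = a(X\<^sub>t) dt + b(X\<^sub>t) dW\<^sub>t\<close>, \<open>X\<^sub>0 = x\<^sub>0\<close>, on the given filtered probability space
  and with the given driving Brownian motion. Adaptedness of \<open>X\<close> is part of progressive
  measurability.
\<close>

definition strong_solution ::
  "'a measure \<Rightarrow> (real \<Rightarrow> 'a measure) \<Rightarrow> (real \<Rightarrow> 'a \<Rightarrow> real) \<Rightarrow>
    (real \<Rightarrow> real) \<Rightarrow> (real \<Rightarrow> real) \<Rightarrow> real \<Rightarrow> (real \<Rightarrow> 'a \<Rightarrow> real) \<Rightarrow> bool" where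
  "strong_solution M F W a b x0 X \<longleftrightarrow>
    progressively_measurable F X \<and>
    (AE \<omega> in M. continuous_on {0..} (\<lambda>t. X t \<omega>)) \<and>
    (AE \<omega> in M. X 0 \<omega> = x0) \<and>
    (\<forall>t\<ge>0. AE \<omega> in M. set_integrable lborel {0..t} (\<lambda>s. a (X s \<omega>))) \<and>
    (\<forall>t\<ge>0. \<exists>J. has_ito_integral M F W (\<lambda>s \<omega>. b (X s \<omega>)) t J \<and>
      (AE \<omega> in M. X t \<omega> = x0 + (LINT s:{0..t}|lborel. a (X s \<omega>)) + J \<omega>))"


subsection \<open>Minimal errors of equidistant methods\<close>

text \<open>Only used for \<open>r > 0\<close>.\<close>

definition ennreal_powr :: "ennreal \<Rightarrow> real \<Rightarrow> ennreal" where
  "ennreal_powr x r = (if x = \<infinity> then \<infinity> else ennreal (enn2real x powr r))"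

text \<open>
  Extended valued, so that an approximation with infinite \<open>p\<close>-th moment has error \<open>\<infinity>\<close>
  (a Bochner integral would give it error \<open>0\<close>).
\<close>

definition Lp_error :: "'a measure \<Rightarrow> real \<Rightarrow> ('a \<Rightarrow> real) \<Rightarrow> ('a \<Rightarrow> real) \<Rightarrow> ennreal" where
  "Lp_error M p Y Z = ennreal_powr (\<integral>\<^sup>+ \<omega>. ennreal (\<bar>Y \<omega> - Z \<omega>\<bar> powr p) \<partial>M) (1 / p)"

text \<open>Here \<open>\<real>\<^sup>n\<close> is the product space over the index set \<open>{1..n}\<close>.\<close>

definition eq_min_error ::
  "'a measure \<Rightarrow> (real \<Rightarrow> 'a \<Rightarrow> real) \<Rightarrow> ('a \<Rightarrow> real) \<Rightarrow> real \<Rightarrow> nat \<Rightarrow> ennreal" where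
  "eq_min_error M W Y p n =
    (INF \<Phi> \<in> borel_measurable (\<Pi>\<^sub>M k\<in>{1..n}. (borel :: real measure)).
      Lp_error M p Y (\<lambda>\<omega>. \<Phi> (\<lambda>k\<in>{1..n}. W (real k / real n) \<omega>)))"

definition asymp_dominates :: "(nat \<Rightarrow> ennreal) \<Rightarrow> (nat \<Rightarrow> ennreal) \<Rightarrow> bool"
    (infix \<open>\<succcurlyeq>\<close> 50) where
  "a \<succcurlyeq> b \<longleftrightarrow> (\<exists>c::real. c > 0 \<and> (\<forall>n\<ge>1. b n \<le> ennreal c * a n))"

end

theory Submission
  imports Defs
begin

text \<open>The solution is the square of a reflected Brownian motion:
  \<open>\<surd>X\<^sub>1 = W\<^sub>1 + max (\<surd>x\<^sub>0) (- min\<^sub>t\<^sub>\<le>\<^sub>1 W\<^sub>t)\<close>. To see this without Ito calculus, compare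
  the Riemann sums of \<open>\<integral> 2 \<surd>X dW\<close> with the exact recursion for the square of the reflected walk
  \<open>R\<^sub>i\<^sub>+\<^sub>1 = max 0 (R\<^sub>i + \<Delta>W\<^sub>i)\<close>; the Yamada-Watanabe argument, run on the grid, makes the difference
  vanish as the grid is refined. So it suffices to bound below the error of approximating the minimum of
  \<open>W\<close> from its values at \<open>3 n\<close> points, at least when the minimum is below \<open>- \<surd>x\<^sub>0\<close>. At the minimum over
  the coarse grid, insert an independent excursion of duration \<open>1 / (3 n)\<close>. Exchanging its two halves
  preserves the law and the values on the coarse grid, hence also the approximation, but moves the
  overall minimum by order \<open>n\<^sup>-\<^sup>1\<^sup>/\<^sup>2\<close>, provided that the rest of the path does not fall much below the
  coarse minimum. Spitzer's identity shows that this happens with probability bounded away from zero.\<close>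

subsection \<open>Spitzer's identity for Gaussian walks\<close>

text \<open>Two obstacles shape the proof. The coefficient \<open>2 * sqrt x\<close> is not
  Lipschitz at 0, so a Gronwall estimate cannot compare the solution with the reflected walk. What
  helps is that the squared difference of two square roots is at most the difference of the
  arguments, which a potential with second derivative close to \<open>1 / \<bar>z\<bar>\<close>
  absorbs.

  The second obstacle is that the place of insertion depends on the path. For a fixed place,
  insertion is a permutation of independent steps, and the grafted path still reveals the place as
  its first minimum over the coarse grid. The events for different places are therefore disjoint,
  and their probabilities add up without a factor of order \<open>n\<close>.

  The constants of the discrete bound do not depend on the fineness of the grid, which can thus be
  refined for fixed \<open>n\<close>. The factor \<open>3\<close> leaves a third of the time for
  falling below \<open>- a\<close>, room for a rise by \<open>1\<close>, and one block for the
  excursion. The rise keeps the solution at time 1 away from 0, where squaring would destroy the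
  gap. Values at more points than the given ones can only help an approximation.\<close>

definition gauss_steps :: "nat \<Rightarrow> real \<Rightarrow> (nat \<Rightarrow> real) measure" where
  "gauss_steps N \<sigma> = (\<Pi>\<^sub>M i\<in>{..<N}. density lborel (normal_density 0 \<sigma>))"

lemma sets_gauss_steps [measurable_cong]:
  "sets (gauss_steps N \<sigma>) = sets (\<Pi>\<^sub>M i\<in>{..<N}. (borel :: real measure))"
  unfolding gauss_steps_def by (intro sets_PiM_cong) auto

lemma space_gauss_steps: "space (gauss_steps N \<sigma>) = {..<N} \<rightarrow>\<^sub>E UNIV"
  by (simp add: gauss_steps_def space_PiM)

lemma prob_space_gauss_steps: "\<sigma> > 0 \<Longrightarrow> prob_space (gauss_steps N \<sigma>)"
  unfolding gauss_steps_def by (intro prob_space_PiM prob_space_normal_density)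

text \<open>Projections, transpositions, cyclic shifts and grafts all select distinct coordinates of
  an i.i.d. vector, so this one fact provides every such invariance of the law.\<close>

lemma gauss_steps_reindex:
  assumes "\<sigma> > 0" "inj_on f {..<r}" "f \<in> {..<r} \<rightarrow> {..<N}"
  shows "distr (gauss_steps N \<sigma>) (gauss_steps r \<sigma>) (\<lambda>x. \<lambda>i\<in>{..<r}. x (f i)) = gauss_steps r \<sigma>"
  unfolding gauss_steps_def
  using distr_PiM_reindex[of "{..<N}" "\<lambda>_. density lborel (normal_density 0 \<sigma>)" f "{..<r}"] assms
  by (auto intro: prob_space_normal_density)

lemma measurable_gauss_steps_component:
  "i < N \<Longrightarrow> (\<lambda>x. x i) \<in> borel_measurable (gauss_steps N \<sigma>)"
  by (auto simp: measurable_cong_sets[OF sets_gauss_steps refl])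

lemma measurable_gauss_steps_reindex:
  assumes "f \<in> {..<r} \<rightarrow> {..<N}"
  shows "(\<lambda>x. \<lambda>i\<in>{..<r}. x (f i)) \<in> measurable (gauss_steps N \<sigma>) (gauss_steps r \<sigma>)"
proof -
  have "(\<lambda>x. x (f i)) \<in> borel_measurable (gauss_steps N \<sigma>)" if "i < r" for i
    using assms that by (intro measurable_gauss_steps_component) auto
  then show ?thesis
    by (simp add: measurable_cong_sets[OF refl sets_gauss_steps] measurable_restrict)
qed

lemma gauss_steps_coordinates:
  assumes "\<sigma> > 0" "i < N"
  shows "distributed (gauss_steps N \<sigma>) lborel (\<lambda>x. x i) (normal_density 0 \<sigma>)"
proof -
  have "distr (gauss_steps N \<sigma>) (density lborel (normal_density 0 \<sigma>)) (\<lambda>x. x i) = density lborel (normal_density 0 \<sigma>)"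
    unfolding gauss_steps_def
    using assms by (intro distr_PiM_component) (auto intro: prob_space_normal_density)
  also have "distr (gauss_steps N \<sigma>) (density lborel (normal_density 0 \<sigma>)) (\<lambda>x. x i) = distr (gauss_steps N \<sigma>) lborel (\<lambda>x. x i)"
    by (intro distr_cong) auto
  finally show ?thesis
    using assms by (auto simp: distributed_def measurable_cong_sets[OF sets_gauss_steps refl])
qed

lemma gauss_steps_indep:
  assumes "\<sigma> > 0"
  shows "prob_space.indep_vars (gauss_steps N \<sigma>) (\<lambda>_. borel) (\<lambda>i x. x i) {..<N}"
proof (cases "N = 0")
  case True
  interpret prob_space "gauss_steps 0 \<sigma>" using assms by (rule prob_space_gauss_steps)
  show ?thesis using True by (simp add: indep_vars_def indep_sets_def)
next
  case False
  interpret prob_space "gauss_steps N \<sigma>" using assms by (rule prob_space_gauss_steps)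
  have "distr (gauss_steps N \<sigma>) (\<Pi>\<^sub>M i\<in>{..<N}. borel) (\<lambda>x. \<lambda>i\<in>{..<N}. x i) = distr (gauss_steps N \<sigma>) (gauss_steps N \<sigma>) (\<lambda>x. x)"
    by (intro distr_cong) (auto simp: sets_gauss_steps space_gauss_steps PiE_def extensional_restrict)
  also have "\<dots> = gauss_steps N \<sigma>" by simp
  also have "\<dots> = (\<Pi>\<^sub>M i\<in>{..<N}. distr (gauss_steps N \<sigma>) borel (\<lambda>x. x i))"
  proof -
    have "distr (gauss_steps N \<sigma>) borel (\<lambda>x. x i) = density lborel (normal_density 0 \<sigma>)" if "i < N" for i
      using gauss_steps_coordinates[OF assms that]
        distr_cong[OF refl, of borel lborel "gauss_steps N \<sigma>" "\<lambda>x. x i" "\<lambda>x. x i"]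
      by (simp add: distributed_def)
    then show ?thesis by (subst gauss_steps_def) (auto intro!: PiM_cong)
  qed
  finally show ?thesis
    using False by (subst indep_vars_iff_distr_eq_PiM') (auto simp: measurable_cong_sets[OF sets_gauss_steps refl])
qed

lemma gauss_steps_block_sum:
  assumes "\<sigma> > 0" "J \<subseteq> {..<N}" "J \<noteq> {}"
  shows "distributed (gauss_steps N \<sigma>) lborel (\<lambda>x. \<Sum>i\<in>J. x i) (normal_density 0 (\<sigma> * sqrt (card J)))"
proof -
  interpret prob_space "gauss_steps N \<sigma>" using assms by (simp add: prob_space_gauss_steps)
  have "finite J" using assms finite_subset by blast
  then have "distributed (gauss_steps N \<sigma>) lborel (\<lambda>x. \<Sum>i\<in>J. x i) (normal_density (\<Sum>i\<in>J. 0) (sqrt (\<Sum>i\<in>J. \<sigma>\<^sup>2)))"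
    using assms by (intro sum_indep_normal indep_vars_subset[OF gauss_steps_indep] gauss_steps_coordinates) auto
  then show ?thesis using assms by (simp add: real_sqrt_mult mult.commute)
qed

text \<open>Since \<open>max 0 (- x) = (\<bar>x\<bar> - x) / 2\<close> and the mean is zero, only
  the absolute first moment enters; the constant is \<open>s / sqrt (2 * pi)\<close>.\<close>

lemma sum_normal_neg_part:
  assumes "distributed M lborel X (normal_density 0 s)" "s > 0"
  shows "integrable M X" "(\<integral>\<omega>. max 0 (- X \<omega>) \<partial>M) = s * (sqrt (2 / pi) / 2)"
proof -
  have i: "integrable M (\<lambda>\<omega>. X \<omega>)" 
    using distributed_integrable[OF assms(1), of "\<lambda>x. x"] integrable_normal_moment_nz_1[OF assms(2), of 0]
    by simp
  then show "integrable M X" .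
  have 1: "(\<integral>\<omega>. \<bar>X \<omega>\<bar> \<partial>M) = s * sqrt (2 / pi)"
    using distributed_integral[OF assms(1), of "\<lambda>x. \<bar>x\<bar>"] integral_normal_moment_abs_odd[OF assms(2), of 0 0]
    by simp
  have 2: "(\<integral>\<omega>. X \<omega> \<partial>M) = 0"
    using distributed_integral[OF assms(1), of "\<lambda>x. x"] integral_normal_moment_nz_1[OF assms(2), of 0]
    by simp
  have "(\<lambda>\<omega>. max 0 (- X \<omega>)) = (\<lambda>\<omega>. (\<bar>X \<omega>\<bar> - X \<omega>) / 2)" by (auto simp: max_def)
  then show "(\<integral>\<omega>. max 0 (- X \<omega>) \<partial>M) = s * (sqrt (2 / pi) / 2)"
    using i 1 2 by simp
qed

section \<open>The running minimum of a walk\<close>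

primrec walk_min :: "(nat \<Rightarrow> real) \<Rightarrow> nat \<Rightarrow> real" where
  "walk_min x 0 = 0"
| "walk_min x (Suc j) = min (walk_min x j) (\<Sum>i<Suc j. x i)"

lemma walk_min_cong: "(\<And>i. i < r \<Longrightarrow> x i = y i) \<Longrightarrow> walk_min x r = walk_min y r"
  by (induction r) auto

lemma walk_min_le: "j \<le> r \<Longrightarrow> walk_min x r \<le> (\<Sum>i<j. x i)"
  by (induction r) (auto simp: le_Suc_eq min_le_iff_disj)

lemma walk_min_attained: "\<exists>j\<le>r. walk_min x r = (\<Sum>i<j. x i)"
proof (induction r)
  case (Suc r)
  then obtain j where "j \<le> r" "walk_min x r = (\<Sum>i<j. x i)" by auto
  then show ?case
    by (cases "walk_min x r \<le> (\<Sum>i<Suc r. x i)") (auto simp: min_def intro: exI[of _ j] exI[of _ "Suc r"])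
qed simp

lemma walk_min_nonpos: "walk_min x r \<le> 0"
  using walk_min_le[of 0 r x] by simp

text \<open>The recursion read from the other end of the path: it splits off the first step instead
  of the last, which is what makes a cyclic shift of the steps useful.\<close>

lemma walk_min_shift: "walk_min x (Suc r) = min 0 (x 0 + walk_min (\<lambda>i. x (Suc i)) r)"
proof (induction r)
  case (Suc r)
  have "walk_min x (Suc (Suc r)) = min (walk_min x (Suc r)) (\<Sum>i<Suc (Suc r). x i)"
    by (rule walk_min.simps)
  also have "\<dots> = min (min 0 (x 0 + walk_min (\<lambda>i. x (Suc i)) r)) (x 0 + (\<Sum>i<Suc r. x (Suc i)))"
    by (subst Suc, subst sum.lessThan_Suc_shift) simp
  finally show ?case by (simp add: min_def)
qed simp

lemma abs_walk_min_le: "\<bar>walk_min x r\<bar> \<le> (\<Sum>i<r. \<bar>x i\<bar>)"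
proof -
  obtain j where "j \<le> r" "walk_min x r = (\<Sum>i<j. x i)" using walk_min_attained by blast
  moreover have "\<bar>\<Sum>i<j. x i\<bar> \<le> (\<Sum>i<j. \<bar>x i\<bar>)" by (rule sum_abs)
  moreover have "(\<Sum>i<j. \<bar>x i\<bar>) \<le> (\<Sum>i<r. \<bar>x i\<bar>)" using \<open>j \<le> r\<close> by (intro sum_mono2) auto
  ultimately show ?thesis by linarith
qed

lemma measurable_walk_min:
  assumes "\<And>i. i < r \<Longrightarrow> (\<lambda>\<omega>. x \<omega> i) \<in> borel_measurable M"
  shows "(\<lambda>\<omega>. walk_min (x \<omega>) r) \<in> borel_measurable M"
  using assms
proof (induction r)
  case (Suc r)
  have "(\<lambda>\<omega>. \<Sum>i<Suc r. x \<omega> i) \<in> borel_measurable M" using Suc(2) by (intro borel_measurable_sum) auto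
  moreover have "(\<lambda>\<omega>. walk_min (x \<omega>) r) \<in> borel_measurable M" using Suc by auto
  ultimately show ?case unfolding walk_min.simps by measurable
qed simp

text \<open>Spitzer's identity, by the cyclic shift argument of Kac and Hunt: on \<open>S\<^sub>r\<^sub>+\<^sub>1 < 0\<close> the first step
  can be split off from the minimum, elsewhere the last step is irrelevant.\<close>

lemma expectation_walk_min_Suc:
  assumes "\<sigma> > 0" "r < N"
  shows "integrable (gauss_steps N \<sigma>) (\<lambda>x. walk_min x r)"
    and "(\<integral>x. walk_min x (Suc r) \<partial>gauss_steps N \<sigma>) =
      (\<integral>x. walk_min x r \<partial>gauss_steps N \<sigma>) - \<sigma> * (sqrt (2 / pi) / 2) / sqrt (Suc r)"
proof -
  let ?P = "gauss_steps N \<sigma>"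
  note [measurable] = measurable_gauss_steps_component[of _ N \<sigma>] measurable_walk_min[of _ _ ?P]
  interpret prob_space ?P using assms by (simp add: prob_space_gauss_steps)
  have ic: "integrable ?P (\<lambda>x. x i)" if "i < N" for i
    using sum_normal_neg_part(1)[OF gauss_steps_coordinates] that assms by auto
  have iw: "integrable ?P (\<lambda>x. walk_min x k)" if "k \<le> N" for k
  proof (rule Bochner_Integration.integrable_bound)
    show "integrable ?P (\<lambda>x. \<Sum>i<k. \<bar>x i\<bar>)"
      by (intro Bochner_Integration.integrable_sum integrable_abs ic) (use that in auto)
    show "(\<lambda>x. walk_min x k) \<in> borel_measurable ?P"
      by (rule measurable_walk_min) (use that measurable_gauss_steps_component in auto)
    show "AE x in ?P. norm (walk_min x k) \<le> norm (\<Sum>i<k. \<bar>x i\<bar>)"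
      using abs_walk_min_le by (auto simp: sum_nonneg)
  qed
  show "integrable ?P (\<lambda>x. walk_min x r)" using iw assms by simp
  define S where "S x = (\<Sum>i<Suc r. x i)" for x :: "nat \<Rightarrow> real"
  have S_meas [measurable]: "S \<in> borel_measurable ?P" unfolding S_def
    by (intro borel_measurable_sum measurable_gauss_steps_component) (use assms in auto)
  define I where "I x = (if S x < 0 then 1 else 0 :: real)" for x
  have I_meas [measurable]: "I \<in> borel_measurable ?P" unfolding I_def by measurable
  have int_I: "integrable ?P (\<lambda>x. f x * I x)" if "integrable ?P f" for f
    by (rule Bochner_Integration.integrable_bound[OF that]) (use that in \<open>auto simp: I_def\<close>)
  have perm: "(\<integral>x. g x \<partial>?P) = (\<integral>x. g (\<lambda>i\<in>{..<N}. x (f i)) \<partial>?P)"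
    if "bij_betw f {..<N} {..<N}" "g \<in> borel_measurable ?P" for f and g :: "(nat \<Rightarrow> real) \<Rightarrow> real"
  proof -
    have f: "inj_on f {..<N}" "f \<in> {..<N} \<rightarrow> {..<N}"
      using that by (auto simp: bij_betw_def)
    have "(\<integral>x. g x \<partial>?P) = (\<integral>x. g x \<partial>distr ?P ?P (\<lambda>x. \<lambda>i\<in>{..<N}. x (f i)))"
      by (simp add: gauss_steps_reindex[OF assms(1) f])
    also have "\<dots> = (\<integral>x. g (\<lambda>i\<in>{..<N}. x (f i)) \<partial>?P)"
      using that f by (intro integral_distr measurable_gauss_steps_reindex)
    finally show ?thesis .
  qed
  have S_perm: "S (\<lambda>i\<in>{..<N}. x (f i)) = S x" if "bij_betw f {..<Suc r} {..<Suc r}" for f x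
  proof -
    have "S (\<lambda>i\<in>{..<N}. x (f i)) = (\<Sum>i<Suc r. x (f i))"
      unfolding S_def using assms by (intro sum.cong) auto
    also have "\<dots> = S x" unfolding S_def
      using sum.reindex_bij_betw[OF that, of x] by simp
    finally show ?thesis .
  qed
  \<comment> \<open>\<open>I\<close> depends on the first \<open>Suc r\<close> steps only through
    their sum, so exchanging steps \<open>0\<close> and \<open>j\<close> leaves it
    unchanged.\<close>
  have step1: "(\<integral>x. x j * I x \<partial>?P) = (\<integral>x. x 0 * I x \<partial>?P)" if "j \<le> r" for j
  proof -
    let ?f = "Transposition.transpose 0 j"
    have b: "bij_betw ?f {..<N} {..<N}" "bij_betw ?f {..<Suc r} {..<Suc r}"
      using that assms by (auto intro!: bij_betw_byWitness[of _ ?f] simp: Transposition.transpose_def)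
    have "(\<integral>x. x j * I x \<partial>?P) = (\<integral>x. (\<lambda>i\<in>{..<N}. x (?f i)) j * I (\<lambda>i\<in>{..<N}. x (?f i)) \<partial>?P)"
      using that assms by (intro perm b) measurable
    also have "\<dots> = (\<integral>x. x 0 * I x \<partial>?P)"
      using that assms by (simp add: I_def S_perm[OF b(2)])
    finally show ?thesis .
  qed
  \<comment> \<open>Averaging the \<open>Suc r\<close> equal integrals turns the first step into
    \<open>S x / Suc r\<close>, and \<open>S x * I x = - max 0 (- S x)\<close>.\<close>
  have x0: "(\<integral>x. x 0 * I x \<partial>?P) = - \<sigma> * (sqrt (2 / pi) / 2) / sqrt (Suc r)"
  proof -
    have "(\<Sum>j<Suc r. \<integral>x. x j * I x \<partial>?P) = (\<Sum>j<Suc r. \<integral>x. x 0 * I x \<partial>?P)"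
      by (intro sum.cong refl step1) auto
    then have "real (Suc r) * (\<integral>x. x 0 * I x \<partial>?P) = (\<Sum>j<Suc r. \<integral>x. x j * I x \<partial>?P)"
      by simp
    also have "\<dots> = (\<integral>x. (\<Sum>j<Suc r. x j * I x) \<partial>?P)"
      using assms by (intro Bochner_Integration.integral_sum[symmetric] int_I ic) auto
    also have "(\<lambda>x. \<Sum>j<Suc r. x j * I x) = (\<lambda>x. - max 0 (- S x))"
    proof
      show "(\<Sum>j<Suc r. x j * I x) = - max 0 (- S x)" for x
        unfolding sum_distrib_right[symmetric] S_def[symmetric] by (simp add: I_def max_def)
    qed
    also have "(\<integral>x. - max 0 (- S x) \<partial>?P) = - (\<integral>x. max 0 (- S x) \<partial>?P)" by simp
    also have "(\<integral>x. max 0 (- S x) \<partial>?P) = \<sigma> * sqrt (Suc r) * (sqrt (2 / pi) / 2)"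
    proof (rule sum_normal_neg_part(2))
      have "distributed ?P lborel (\<lambda>x. \<Sum>i\<in>{..<Suc r}. x i) (normal_density 0 (\<sigma> * sqrt (card {..<Suc r})))"
        using assms by (intro gauss_steps_block_sum) auto
      then show "distributed ?P lborel S (normal_density 0 (\<sigma> * sqrt (Suc r)))"
        unfolding S_def by (simp only: card_lessThan)
    qed (use assms in auto)
    finally have "real (Suc r) * (\<integral>x. x 0 * I x \<partial>?P) = - (\<sigma> * sqrt (Suc r) * (sqrt (2 / pi) / 2))" .
    then have "sqrt (Suc r) * sqrt (Suc r) * (\<integral>x. x 0 * I x \<partial>?P) = - (\<sigma> * sqrt (Suc r) * (sqrt (2 / pi) / 2))"
      by simp
    then have "sqrt (Suc r) * (sqrt (Suc r) * (\<integral>x. x 0 * I x \<partial>?P)) = sqrt (Suc r) * (- (\<sigma> * (sqrt (2 / pi) / 2)))"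
      by (simp only: mult_ac mult_minus_right)
    then have "sqrt (Suc r) * (\<integral>x. x 0 * I x \<partial>?P) = - (\<sigma> * (sqrt (2 / pi) / 2))"
      by (subst (asm) mult_cancel_left) auto
    then show ?thesis by (simp add: field_simps)
  qed
  \<comment> \<open>A cyclic shift of the first \<open>Suc r\<close> coordinates that fixes the
    others; after it, the first \<open>r\<close> steps are the old steps \<open>1\<close> to
    \<open>r\<close>.\<close>
  define h where "h i = (if i < r then Suc i else if i = r then 0 else i)" for i
  have h_bij: "bij_betw h {..<N} {..<N}" "bij_betw h {..<Suc r} {..<Suc r}"
    using assms by (auto intro!: bij_betw_byWitness[of _ "\<lambda>i. if i = 0 then r else if i \<le> r then i - 1 else i"] simp: h_def)
  have cyc: "(\<integral>x. walk_min (\<lambda>i. x (Suc i)) r * I x \<partial>?P) = (\<integral>x. walk_min x r * I x \<partial>?P)"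
  proof -
    have "(\<integral>x. walk_min x r * I x \<partial>?P) = (\<integral>x. walk_min (\<lambda>i\<in>{..<N}. x (h i)) r * I (\<lambda>i\<in>{..<N}. x (h i)) \<partial>?P)"
      using assms by (intro perm h_bij) measurable
    also have "(\<lambda>x. walk_min (\<lambda>i\<in>{..<N}. x (h i)) r) = (\<lambda>x. walk_min (\<lambda>i. x (Suc i)) r)"
      using assms by (intro ext walk_min_cong) (auto simp: h_def)
    also have "(\<lambda>x. I (\<lambda>i\<in>{..<N}. x (h i))) = I"
      unfolding I_def S_perm[OF h_bij(2)] ..
    finally show ?thesis ..
  qed
  have iw2: "integrable ?P (\<lambda>x. walk_min (\<lambda>i. x (Suc i)) r)"
  proof (rule Bochner_Integration.integrable_bound)
    show "integrable ?P (\<lambda>x. \<Sum>i<r. \<bar>x (Suc i)\<bar>)"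
      by (intro Bochner_Integration.integrable_sum integrable_abs ic) (use assms in auto)
    show "(\<lambda>x. walk_min (\<lambda>i. x (Suc i)) r) \<in> borel_measurable ?P"
      by (rule measurable_walk_min) (use assms measurable_gauss_steps_component in auto)
    show "AE x in ?P. norm (walk_min (\<lambda>i. x (Suc i)) r) \<le> norm (\<Sum>i<r. \<bar>x (Suc i)\<bar>)"
      using abs_walk_min_le by (auto simp: sum_nonneg)
  qed
  \<comment> \<open>If \<open>S x < 0\<close>, the path after the first step has already reached a
    negative value, so the outer minimum with 0 in \<open>walk_min_shift\<close> has no effect.
    Otherwise the endpoint lies above the nonpositive running minimum.\<close>
  have split: "walk_min x (Suc r) = walk_min x r - walk_min x r * I x + (x 0 * I x + walk_min (\<lambda>i. x (Suc i)) r * I x)" for x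
  proof (cases "S x < 0")
    case True
    have "x 0 + walk_min (\<lambda>i. x (Suc i)) r \<le> x 0 + (\<Sum>i<r. x (Suc i))"
      using walk_min_le[of r r "\<lambda>i. x (Suc i)"] by simp
    also have "\<dots> = S x" unfolding S_def by (subst sum.lessThan_Suc_shift) simp
    finally show ?thesis using True unfolding walk_min_shift[of x r] I_def by simp
  next
    case False
    then show ?thesis using walk_min_nonpos[of x r] by (simp add: I_def S_def)
  qed
  have "(\<integral>x. walk_min x (Suc r) \<partial>?P) = (\<integral>x. walk_min x r \<partial>?P) + (\<integral>x. x 0 * I x \<partial>?P)"
  proof -
    have i: "integrable ?P (\<lambda>x. walk_min x r)" "integrable ?P (\<lambda>x. walk_min x r * I x)"
      "integrable ?P (\<lambda>x. x 0 * I x)" "integrable ?P (\<lambda>x. walk_min (\<lambda>i. x (Suc i)) r * I x)"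
      by (intro iw int_I iw2 ic; use assms in simp)+
    have "(\<integral>x. walk_min x (Suc r) \<partial>?P) =
      (\<integral>x. walk_min x r - walk_min x r * I x + (x 0 * I x + walk_min (\<lambda>i. x (Suc i)) r * I x) \<partial>?P)"
      by (intro Bochner_Integration.integral_cong refl split)
    also have "\<dots> = (\<integral>x. walk_min x r \<partial>?P) - (\<integral>x. walk_min x r * I x \<partial>?P) +
        ((\<integral>x. x 0 * I x \<partial>?P) + (\<integral>x. walk_min (\<lambda>i. x (Suc i)) r * I x \<partial>?P))"
      by (simp only: Bochner_Integration.integral_add[OF Bochner_Integration.integrable_diff[OF i(1,2)]
          Bochner_Integration.integrable_add[OF i(3,4)]] Bochner_Integration.integral_diff[OF i(1,2)]
          Bochner_Integration.integral_add[OF i(3,4)])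
    finally show ?thesis unfolding cyc by simp
  qed
  then show "(\<integral>x. walk_min x (Suc r) \<partial>?P) = (\<integral>x. walk_min x r \<partial>?P) - \<sigma> * (sqrt (2 / pi) / 2) / sqrt (Suc r)"
    using x0 by simp
qed

lemma expectation_walk_min:
  assumes "\<sigma> > 0" "r \<le> N"
  shows "integrable (gauss_steps N \<sigma>) (\<lambda>x. walk_min x r)"
    and "(\<integral>x. walk_min x r \<partial>gauss_steps N \<sigma>) = - \<sigma> * (sqrt (2 / pi) / 2) * (\<Sum>k<r. 1 / sqrt (Suc k))"
proof -
  \<comment> \<open>The preceding lemma yields integrability for \<open>r < N\<close>; a walk with
    one more step covers \<open>r = N\<close>.\<close>
  have "distr (gauss_steps (Suc N) \<sigma>) (gauss_steps N \<sigma>) (\<lambda>x. \<lambda>i\<in>{..<N}. x i) = gauss_steps N \<sigma>"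
    using gauss_steps_reindex[OF assms(1), of id N "Suc N"] by auto
  moreover have m: "(\<lambda>x. \<lambda>i\<in>{..<N}. x i) \<in> measurable (gauss_steps (Suc N) \<sigma>) (gauss_steps N \<sigma>)"
    using measurable_gauss_steps_reindex[of id N "Suc N"] by auto
  moreover have "(\<lambda>x. walk_min x r) \<in> borel_measurable (gauss_steps N \<sigma>)"
    by (rule measurable_walk_min) (use assms measurable_gauss_steps_component in auto)
  moreover have "integrable (gauss_steps (Suc N) \<sigma>) (\<lambda>x. walk_min (\<lambda>i\<in>{..<N}. x i) r)"
  proof -
    have "walk_min (\<lambda>i\<in>{..<N}. x i) r = walk_min x r" for x
      using assms by (intro walk_min_cong) auto
    moreover have "integrable (gauss_steps (Suc N) \<sigma>) (\<lambda>x. walk_min x r)"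
      using assms by (intro expectation_walk_min_Suc(1)) auto
    ultimately show ?thesis by (simp only:)
  qed
  ultimately show "integrable (gauss_steps N \<sigma>) (\<lambda>x. walk_min x r)"
    using integrable_distr_eq[OF m, of "\<lambda>x. walk_min x r"] by (simp only:)
  show "(\<integral>x. walk_min x r \<partial>gauss_steps N \<sigma>) = - \<sigma> * (sqrt (2 / pi) / 2) * (\<Sum>k<r. 1 / sqrt (Suc k))"
    using assms(2)
  proof (induction r)
    case (Suc r)
    then show ?case
      using expectation_walk_min_Suc(2)[of \<sigma> r N] assms(1) by (simp add: algebra_simps)
  qed simp
qed

text \<open>Both bounds telescope \<open>2 * (sqrt (y + 1) - sqrt y)\<close>, which lies between
  \<open>1 / sqrt (y + 1)\<close> and \<open>1 / sqrt y\<close>. Their leading terms agree, so a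
  comparison of two grids leaves only the constant \<open>2\<close>.\<close>

lemma sum_inverse_sqrt_bounds:
  "(\<Sum>k<r. 1 / sqrt (Suc k)) \<le> 2 * sqrt r"
  "2 * sqrt (Suc r) - 2 \<le> (\<Sum>k<r. 1 / sqrt (Suc k))"
proof -
  have ineq: "1 / sqrt (y + 1) \<le> 2 * (sqrt (y + 1) - sqrt y)" "2 * (sqrt (y + 1) - sqrt y) \<le> 1 / sqrt y \<or> y = 0" if "y \<ge> 0" for y :: real
  proof -
    let ?a = "sqrt (y + 1)" and ?b = "sqrt y"
    have ab: "?a > 0" "?b \<ge> 0" "?b \<le> ?a" and e: "(?a - ?b) * (?a + ?b) = 1"
      using that by (auto simp: algebra_simps)
    have "1 = (?a - ?b) * (?a + ?b)" using e by simp
    also have "\<dots> \<le> (?a - ?b) * (2 * ?a)" using ab by (intro mult_left_mono) auto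
    finally show "1 / ?a \<le> 2 * (?a - ?b)" using ab by (simp add: field_simps)
    have "(?a - ?b) * (2 * ?b) \<le> (?a - ?b) * (?a + ?b)" using ab by (intro mult_left_mono) auto
    then have "(?a - ?b) * (2 * ?b) \<le> 1" using e by simp
    then show "2 * (?a - ?b) \<le> 1 / ?b \<or> y = 0" using ab that by (cases "y = 0") (simp_all add: field_simps)
  qed
  show "(\<Sum>k<r. 1 / sqrt (Suc k)) \<le> 2 * sqrt r"
  proof (induction r)
    case (Suc r)
    then show ?case using ineq(1)[of "real r"] by (simp add: add.commute)
  qed simp
  show "2 * sqrt (Suc r) - 2 \<le> (\<Sum>k<r. 1 / sqrt (Suc k))"
  proof (induction r)
    case (Suc r)
    then show ?case using ineq(2)[of "real (Suc r)"] by (simp add: add.commute)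
  qed simp
qed

subsection \<open>Brownian increments and discrete stochastic integrals\<close>

context brownian_motion begin

lemma measurable_F_mono: "f \<in> measurable (F s) N \<Longrightarrow> s \<le> t \<Longrightarrow> f \<in> measurable (F t) N"
  using sets_F_mono[of s t] by (auto simp: measurable_def space_F)

lemma measurable_F_M: "f \<in> measurable (F s) N \<Longrightarrow> f \<in> measurable M N"
  using measurable_from_subalg[OF subalgebra_F] by blast

lemma W_measurable: "0 \<le> s \<Longrightarrow> s \<le> t \<Longrightarrow> W s \<in> borel_measurable (F t)"
  using adapted measurable_F_mono by blast

lemma W_measurable_M [measurable]: "0 \<le> s \<Longrightarrow> W s \<in> borel_measurable M"
  using adapted measurable_F_M by blast

lemma indep_var_increment:
  assumes "0 \<le> s" "s < t" "U \<in> measurable (F s) N"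
  shows "indep_var N U borel (\<lambda>\<omega>. W t \<omega> - W s \<omega>)"
proof -
  have m: "(\<lambda>\<omega>. W t \<omega> - W s \<omega>) \<in> borel_measurable M"
    using assms by (intro borel_measurable_diff W_measurable_M) auto
  have 1: "sigma_sets (space M) {U -` A \<inter> space M | A. A \<in> sets N} \<subseteq> sets (F s)"
    using sets.sigma_sets_subset[of "{U -` A \<inter> space M | A. A \<in> sets N}" "F s"]
      measurable_sets[OF assms(3)] by (auto simp: space_F)
  have 2: "sigma_sets (space M) {(\<lambda>\<omega>. W t \<omega> - W s \<omega>) -` A \<inter> space M | A. A \<in> sets borel} =
      sets (vimage_algebra (space M) (\<lambda>\<omega>. W t \<omega> - W s \<omega>) borel)"
    by (simp add: sets_vimage_algebra)
  have "indep_set (sets (F s)) (sets (vimage_algebra (space M) (\<lambda>\<omega>. W t \<omega> - W s \<omega>) borel))"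
    using indep_increments assms by blast
  then show ?thesis
    unfolding indep_var_eq 2 using 1 m measurable_F_M[OF assms(3)]
    by (auto simp: indep_sets2_eq)
qed

lemma increment_moments:
  assumes "0 \<le> s" "s < t"
  shows "integrable M (\<lambda>\<omega>. (W t \<omega> - W s \<omega>) ^ k)"
    and "integrable M (\<lambda>\<omega>. \<bar>W t \<omega> - W s \<omega>\<bar> ^ k)"
    and "expectation (\<lambda>\<omega>. W t \<omega> - W s \<omega>) = 0"
    and "expectation (\<lambda>\<omega>. (W t \<omega> - W s \<omega>)\<^sup>2) = t - s"
    and "expectation (\<lambda>\<omega>. \<bar>W t \<omega> - W s \<omega>\<bar> ^ 3) \<le> 2 * sqrt (t - s) ^ 3"
    and "expectation (\<lambda>\<omega>. (W t \<omega> - W s \<omega>) ^ 4) = 3 * (t - s)\<^sup>2"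
proof -
  have D: "distributed M lborel (\<lambda>\<omega>. W t \<omega> - W s \<omega>) (normal_density 0 (sqrt (t - s)))"
    using normal_increments assms by blast
  have pos: "sqrt (t - s) > 0" using assms by simp
  show "integrable M (\<lambda>\<omega>. (W t \<omega> - W s \<omega>) ^ k)"
    using distributed_integrable[OF D, of "\<lambda>x. x ^ k"] integrable_normal_moment[OF pos, of 0 k] by simp
  show "integrable M (\<lambda>\<omega>. \<bar>W t \<omega> - W s \<omega>\<bar> ^ k)"
    using distributed_integrable[OF D, of "\<lambda>x. \<bar>x\<bar> ^ k"] integrable_normal_moment_abs[OF pos, of 0 k] by simp
  show "expectation (\<lambda>\<omega>. W t \<omega> - W s \<omega>) = 0"
    using distributed_integral[OF D, of "\<lambda>x. x"] integral_normal_moment_nz_1[OF pos, of 0] by simp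
  show "expectation (\<lambda>\<omega>. (W t \<omega> - W s \<omega>)\<^sup>2) = t - s"
    using distributed_integral[OF D, of "\<lambda>x. x\<^sup>2"] integral_normal_moment_even[OF pos, of 0 1] assms by simp
  show "expectation (\<lambda>\<omega>. (W t \<omega> - W s \<omega>) ^ 4) = 3 * (t - s)\<^sup>2"
    using distributed_integral[OF D, of "\<lambda>x. x ^ 4"] integral_normal_moment_even[OF pos, of 0 2] assms
    by (simp add: fact_numeral field_simps)
  have "expectation (\<lambda>\<omega>. \<bar>W t \<omega> - W s \<omega>\<bar> ^ 3) = 2 * sqrt (t - s) ^ 3 * sqrt (2 / pi)"
    using distributed_integral[OF D, of "\<lambda>x. \<bar>x\<bar> ^ 3"] integral_normal_moment_abs_odd[OF pos, of 0 1]
    by (simp add: fact_numeral eval_nat_numeral)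
  also have "\<dots> \<le> 2 * sqrt (t - s) ^ 3 * 1"
    using pi_gt3 assms by (intro mult_left_mono) auto
  finally show "expectation (\<lambda>\<omega>. \<bar>W t \<omega> - W s \<omega>\<bar> ^ 3) \<le> 2 * sqrt (t - s) ^ 3" by simp
qed

text \<open>This takes the place of conditional expectations: a factor known at time
  \<open>s\<close> is independent of the increment, and for centred \<open>g\<close> the product has
  mean zero.\<close>

lemma increment_mult:
  fixes V :: "'a \<Rightarrow> real" and g :: "real \<Rightarrow> real"
  assumes "0 \<le> s" "s < t" "V \<in> borel_measurable (F s)" "integrable M V"
    and g: "g \<in> borel_measurable borel" "integrable M (\<lambda>\<omega>. g (W t \<omega> - W s \<omega>))"
  shows "integrable M (\<lambda>\<omega>. V \<omega> * g (W t \<omega> - W s \<omega>))"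
    and "expectation (\<lambda>\<omega>. V \<omega> * g (W t \<omega> - W s \<omega>)) = expectation V * expectation (\<lambda>\<omega>. g (W t \<omega> - W s \<omega>))"
proof -
  have "indep_var borel ((\<lambda>x. x) \<circ> V) borel (g \<circ> (\<lambda>\<omega>. W t \<omega> - W s \<omega>))"
    by (rule indep_var_compose[OF indep_var_increment[OF assms(1-3)]]) (use g in auto)
  then have i: "indep_var borel V borel (\<lambda>\<omega>. g (W t \<omega> - W s \<omega>))" by (simp add: o_def)
  show "integrable M (\<lambda>\<omega>. V \<omega> * g (W t \<omega> - W s \<omega>))"
    by (rule indep_var_integrable[OF i assms(4) g(2)])
  show "expectation (\<lambda>\<omega>. V \<omega> * g (W t \<omega> - W s \<omega>)) = expectation V * expectation (\<lambda>\<omega>. g (W t \<omega> - W s \<omega>))"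
    by (rule indep_var_lebesgue_integral[OF i assms(4) g(2)])
qed

section \<open>Increments over the uniform grid\<close>

definition step :: "nat \<Rightarrow> nat \<Rightarrow> 'a \<Rightarrow> real" where
  "step N i \<omega> = W (real (Suc i) / real N) \<omega> - W (real i / real N) \<omega>"

lemma step_measurable [measurable]: "step N i \<in> borel_measurable M"
  unfolding step_def[abs_def] by measurable

lemma sum_step: "(\<Sum>i<j. step N i \<omega>) = W (real j / real N) \<omega> - W 0 \<omega>"
  by (induction j) (auto simp: step_def)

lemma law_steps:
  assumes "N > 0"
  shows "distr M (gauss_steps N (1 / sqrt N)) (\<lambda>\<omega>. \<lambda>i\<in>{..<N}. step N i \<omega>) = gauss_steps N (1 / sqrt N)"
proof -
  let ?\<nu> = "density lborel (normal_density 0 (1 / sqrt N))"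
  have "(1 / sqrt N) > 0" using assms by simp
  then interpret \<nu>: prob_space ?\<nu> by (rule prob_space_normal_density)
  interpret product_sigma_finite "\<lambda>_. ?\<nu>" by unfold_locales
  have m: "(\<lambda>\<omega>. \<lambda>i\<in>{..<N}. step N i \<omega>) \<in> measurable M (gauss_steps N (1 / sqrt N))"
    by (simp add: measurable_cong_sets[OF refl sets_gauss_steps] measurable_restrict)
  have law: "measure M (step N i -` A \<inter> space M) = measure ?\<nu> A" if "A \<in> sets borel" for A i
  proof -
    have "distributed M lborel (step N i) (normal_density 0 (1 / sqrt N))"
      unfolding step_def[abs_def]
      using normal_increments[of "i / N" "Suc i / N"] assms
      by (simp add: divide_strict_right_mono real_sqrt_divide diff_divide_distrib[symmetric])
    then have "distr M lborel (step N i) = ?\<nu>" by (simp add: distributed_def)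
    then have "measure ?\<nu> A = measure (distr M lborel (step N i)) A" by simp
    also have "\<dots> = measure M (step N i -` A \<inter> space M)"
      using that by (intro measure_distr) auto
    finally show ?thesis ..
  qed
  have "distr M (gauss_steps N (1 / sqrt N)) (\<lambda>\<omega>. \<lambda>i\<in>{..<N}. step N i \<omega>) = (\<Pi>\<^sub>M i\<in>{..<N}. ?\<nu>)"
  proof (rule PiM_eqI)
    show "sets (distr M (gauss_steps N (1 / sqrt N)) (\<lambda>\<omega>. \<lambda>i\<in>{..<N}. step N i \<omega>)) = sets (\<Pi>\<^sub>M i\<in>{..<N}. ?\<nu>)"
      by (simp add: gauss_steps_def)
    fix A :: "nat \<Rightarrow> real set" assume A: "\<And>i. i \<in> {..<N} \<Longrightarrow> A i \<in> sets ?\<nu>"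
    \<comment> \<open>The event is carried along as an element of \<open>F (j / N)\<close>, so that
      independence of the next increment from the past yields one further factor.\<close>
    have ev: "{\<omega>\<in>space M. \<forall>i<j. step N i \<omega> \<in> A i} \<in> sets (F (j / N)) \<and>
      measure M {\<omega>\<in>space M. \<forall>i<j. step N i \<omega> \<in> A i} = (\<Prod>i<j. measure ?\<nu> (A i))" if "j \<le> N" for j
      using that
    proof (induction j)
      case 0
      then show ?case using sets.top[of "F 0"] by (simp add: prob_space space_F)
    next
      case (Suc j)
      let ?E = "{\<omega>\<in>space M. \<forall>i<j. step N i \<omega> \<in> A i}"
      have Aj: "A j \<in> sets borel" using A[of j] Suc.prems by simp
      have split: "{\<omega>\<in>space M. \<forall>i<Suc j. step N i \<omega> \<in> A i} = ?E \<inter> (step N j -` A j \<inter> space M)"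
        by (auto simp: less_Suc_eq)
      have le: "real j / N \<le> real (Suc j) / N" by (simp add: divide_right_mono)
      have "step N j \<in> borel_measurable (F (Suc j / N))"
        unfolding step_def[abs_def] using le by (intro borel_measurable_diff W_measurable) auto
      then have "step N j -` A j \<inter> space M \<in> sets (F (Suc j / N))"
        using measurable_sets[of "step N j" "F (Suc j / N)" borel "A j"] Aj by (simp only: space_F)
      moreover have "?E \<in> sets (F (Suc j / N))"
        using Suc.IH Suc.prems sets_F_mono[OF le] by (meson Suc_leD subsetD)
      ultimately have 1: "{\<omega>\<in>space M. \<forall>i<Suc j. step N i \<omega> \<in> A i} \<in> sets (F (Suc j / N))"
        unfolding split by (rule sets.Int[rotated])
      have ind: "indep_set (sets (F (j / N))) (sets (vimage_algebra (space M) (step N j) borel))"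
        using indep_increments[of "j / N" "Suc j / N"] assms unfolding step_def[abs_def]
        by (simp add: divide_strict_right_mono)
      have "measure M (?E \<inter> (step N j -` A j \<inter> space M)) = measure M ?E * measure M (step N j -` A j \<inter> space M)"
      proof (rule indep_setD[OF ind])
        show "?E \<in> sets (F (j / N))" using Suc.IH Suc.prems by linarith
        show "step N j -` A j \<inter> space M \<in> sets (vimage_algebra (space M) (step N j) borel)"
          using Aj by (rule in_vimage_algebra)
      qed
      moreover have "measure M ?E = (\<Prod>i<j. measure ?\<nu> (A i))" using Suc.IH Suc.prems by linarith
      ultimately have "measure M (?E \<inter> (step N j -` A j \<inter> space M)) = (\<Prod>i<Suc j. measure ?\<nu> (A i))"
        using law[OF Aj, of j] by (simp only: prod.lessThan_Suc)
      then show ?case using 1 unfolding split by (rule conjI[rotated])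
    qed
    have "emeasure (distr M (gauss_steps N (1 / sqrt N)) (\<lambda>\<omega>. \<lambda>i\<in>{..<N}. step N i \<omega>)) (Pi\<^sub>E {..<N} A) =
       emeasure M ((\<lambda>\<omega>. \<lambda>i\<in>{..<N}. step N i \<omega>) -` (Pi\<^sub>E {..<N} A) \<inter> space M)"
    proof (rule emeasure_distr[OF m])
      show "Pi\<^sub>E {..<N} A \<in> sets (gauss_steps N (1 / sqrt N))"
        unfolding gauss_steps_def by (rule sets_PiM_I_finite[OF finite_lessThan A])
    qed
    also have "(\<lambda>\<omega>. \<lambda>i\<in>{..<N}. step N i \<omega>) -` (Pi\<^sub>E {..<N} A) \<inter> space M = {\<omega>\<in>space M. \<forall>i<N. step N i \<omega> \<in> A i}"
      unfolding vimage_def restrict_PiE_iff by (simp add: Ball_def Int_def conj_commute)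
    also have "emeasure M \<dots> = ennreal (\<Prod>i<N. measure ?\<nu> (A i))"
      using ev[OF order_refl] by (simp only: emeasure_eq_measure)
    also have "\<dots> = (\<Prod>i<N. emeasure ?\<nu> (A i))"
      by (simp add: \<nu>.emeasure_eq_measure prod_ennreal)
    finally show "emeasure (distr M (gauss_steps N (1 / sqrt N)) (\<lambda>\<omega>. \<lambda>i\<in>{..<N}. step N i \<omega>)) (Pi\<^sub>E {..<N} A) =
      (\<Prod>i<N. emeasure ?\<nu> (A i))" .
  qed simp
  then show ?thesis by (simp add: gauss_steps_def)
qed

text \<open>The Ito isometry for finite sums. When the square is expanded, the mixed term has mean
  zero because the next increment is independent of the past; bounded coefficients make every
  product integrable.\<close>

lemma discrete_integral_L2:
  assumes "0 \<le> s 0" and s: "\<And>i. i < m \<Longrightarrow> s i < s (Suc i)"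
    and c: "\<And>i. i < m \<Longrightarrow> c i \<in> borel_measurable (F (s i))"
    and bd: "\<And>i \<omega>. i < m \<Longrightarrow> \<bar>c i \<omega>\<bar> \<le> C"
  shows "(\<lambda>\<omega>. \<Sum>i<m. c i \<omega> * (W (s (Suc i)) \<omega> - W (s i) \<omega>)) \<in> borel_measurable (F (s m))" (is ?A)
    and "integrable M (\<lambda>\<omega>. (\<Sum>i<m. c i \<omega> * (W (s (Suc i)) \<omega> - W (s i) \<omega>))\<^sup>2)" (is ?B)
    and "expectation (\<lambda>\<omega>. (\<Sum>i<m. c i \<omega> * (W (s (Suc i)) \<omega> - W (s i) \<omega>))\<^sup>2) =
      (\<Sum>i<m. expectation (\<lambda>\<omega>. (c i \<omega>)\<^sup>2) * (s (Suc i) - s i))" (is ?C)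
proof -
  have mono: "s 0 \<le> s i \<and> (\<forall>j\<le>i. s j \<le> s i)" if "i \<le> m" for i
    using that
  proof (induction i)
    case (Suc i)
    then show ?case using s[of i] by (auto simp: le_Suc_eq intro: order_trans less_imp_le)
  qed simp
  let ?Z = "\<lambda>j \<omega>. \<Sum>i<j. c i \<omega> * (W (s (Suc i)) \<omega> - W (s i) \<omega>)"
  have "?Z j \<in> borel_measurable (F (s j)) \<and> integrable M (\<lambda>\<omega>. (?Z j \<omega>)\<^sup>2) \<and>
    expectation (\<lambda>\<omega>. (?Z j \<omega>)\<^sup>2) = (\<Sum>i<j. expectation (\<lambda>\<omega>. (c i \<omega>)\<^sup>2) * (s (Suc i) - s i))" if "j \<le> m" for j
    using that
  proof (induction j)
    case (Suc j)
    have j: "j < m" "0 \<le> s j" "s j < s (Suc j)" using Suc(2) s[of j] mono[of j] assms(1) by auto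
    let ?D = "\<lambda>\<omega>. W (s (Suc j)) \<omega> - W (s j) \<omega>"
    have Zm: "?Z j \<in> borel_measurable (F (s j))" and Zi: "integrable M (\<lambda>\<omega>. (?Z j \<omega>)\<^sup>2)"
      using Suc by auto
    have cm: "c j \<in> borel_measurable (F (s j))" using c j by auto
    note [measurable] = measurable_F_M[OF cm] measurable_F_M[OF Zm]
    have Zi1: "integrable M (?Z j)"
      using square_integrable_imp_integrable[OF measurable_F_M[OF Zm] Zi] .
    have cZ: "integrable M (\<lambda>\<omega>. 2 * ?Z j \<omega> * c j \<omega>)"
    proof (rule Bochner_Integration.integrable_bound)
      show "integrable M (\<lambda>\<omega>. 2 * C * ?Z j \<omega>)" using Zi1 by simp
      have "\<bar>c j \<omega>\<bar> * \<bar>?Z j \<omega>\<bar> \<le> \<bar>C\<bar> * \<bar>?Z j \<omega>\<bar>" for \<omega>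
        using bd[OF j(1), of \<omega>] by (intro mult_right_mono) auto
      then show "AE \<omega> in M. norm (2 * ?Z j \<omega> * c j \<omega>) \<le> norm (2 * C * ?Z j \<omega>)"
        by (simp add: abs_mult mult_ac)
    qed measurable
    have cc: "integrable M (\<lambda>\<omega>. (c j \<omega>)\<^sup>2)"
    proof (rule integrable_const_bound[where B = "C\<^sup>2"])
      show "AE \<omega> in M. norm ((c j \<omega>)\<^sup>2) \<le> C\<^sup>2"
        using bd[OF j(1)] by (auto simp: abs_le_square_iff[symmetric] intro!: AE_I2 order_trans[OF _ abs_ge_self])
    qed measurable
    have D: "integrable M ?D" "integrable M (\<lambda>\<omega>. (?D \<omega>)\<^sup>2)"
      using increment_moments(1)[OF j(2,3), of 1] increment_moments(1)[OF j(2,3), of 2] by auto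
    have ZcF: "(\<lambda>\<omega>. 2 * ?Z j \<omega> * c j \<omega>) \<in> borel_measurable (F (s j))"
      by (intro borel_measurable_times Zm cm borel_measurable_const)
    have ccF: "(\<lambda>\<omega>. (c j \<omega>)\<^sup>2) \<in> borel_measurable (F (s j))"
      by (intro borel_measurable_power cm)
    have t1: "integrable M (\<lambda>\<omega>. (2 * ?Z j \<omega> * c j \<omega>) * ?D \<omega>)"
       "expectation (\<lambda>\<omega>. (2 * ?Z j \<omega> * c j \<omega>) * ?D \<omega>) = 0"
      using increment_mult[OF j(2,3) ZcF cZ measurable_ident_sets[OF refl] D(1)]
      unfolding increment_moments(3)[OF j(2,3)] by simp_all
    have t2: "integrable M (\<lambda>\<omega>. (c j \<omega>)\<^sup>2 * (?D \<omega>)\<^sup>2)"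
       "expectation (\<lambda>\<omega>. (c j \<omega>)\<^sup>2 * (?D \<omega>)\<^sup>2) = expectation (\<lambda>\<omega>. (c j \<omega>)\<^sup>2) * (s (Suc j) - s j)"
      using increment_mult[OF j(2,3) ccF cc _ D(2)] unfolding increment_moments(4)[OF j(2,3)]
      by simp_all
    have eq: "(\<lambda>\<omega>. (?Z (Suc j) \<omega>)\<^sup>2) = (\<lambda>\<omega>. (?Z j \<omega>)\<^sup>2 + (2 * ?Z j \<omega> * c j \<omega>) * ?D \<omega> + (c j \<omega>)\<^sup>2 * (?D \<omega>)\<^sup>2)"
      by (simp add: power2_eq_square algebra_simps)
    have "?Z (Suc j) \<in> borel_measurable (F (s (Suc j)))"
      unfolding sum.lessThan_Suc
      using measurable_F_mono[OF Zm, of "s (Suc j)"] measurable_F_mono[OF cm, of "s (Suc j)"] j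
      by (intro borel_measurable_add borel_measurable_times borel_measurable_diff W_measurable) auto
    then show ?case
      unfolding eq using Zi t1 t2 Suc by simp
  qed (use assms in auto)
  then show ?A ?B ?C by auto
qed

text \<open>Truncating the coefficients as soon as \<open>\<Sum> c\<^sub>i\<^sup>2 (s\<^sub>i\<^sub>+\<^sub>1 - s\<^sub>i)\<close> exceeds \<open>b\<close> keeps them adapted.\<close>

lemma discrete_integral_tail:
  assumes "0 \<le> s 0" and s: "\<And>i. i < m \<Longrightarrow> s i < s (Suc i)"
    and c: "\<And>i. i < m \<Longrightarrow> c i \<in> borel_measurable (F (s i))"
    and "\<alpha> > 0" "b \<ge> 0"
  shows "measure M {\<omega>\<in>space M. \<bar>\<Sum>i<m. c i \<omega> * (W (s (Suc i)) \<omega> - W (s i) \<omega>)\<bar> > \<alpha>} \<le>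
    measure M {\<omega>\<in>space M. (\<Sum>i<m. (c i \<omega>)\<^sup>2 * (s (Suc i) - s i)) > b} + b / \<alpha>\<^sup>2"
proof -
  have mono: "s 0 \<le> s i \<and> (\<forall>j\<le>i. s j \<le> s i)" if "i \<le> m" for i
    using that
  proof (induction i)
    case (Suc i)
    then show ?case using s[of i] by (auto simp: le_Suc_eq intro: order_trans less_imp_le)
  qed simp
  \<comment> \<open>The sum includes the term \<open>i\<close> itself: \<open>c i\<close> is known
    at time \<open>s i\<close>, so the cutoff remains adapted, and the truncated quadratic sum never
    exceeds \<open>b\<close>, not even by its last term.\<close>
  define q where "q i \<omega> = (\<Sum>l<Suc i. (c l \<omega>)\<^sup>2 * (s (Suc l) - s l))" for i \<omega>
  define c' where "c' i \<omega> = (if q i \<omega> \<le> b then c i \<omega> else 0)" for i \<omega>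
  define Z where "Z \<omega> = (\<Sum>i<m. c i \<omega> * (W (s (Suc i)) \<omega> - W (s i) \<omega>))" for \<omega>
  define Z' where "Z' \<omega> = (\<Sum>i<m. c' i \<omega> * (W (s (Suc i)) \<omega> - W (s i) \<omega>))" for \<omega>
  have s0: "0 \<le> s i" if "i \<le> m" for i using mono[OF that] assms(1) by simp
  have cF: "c l \<in> borel_measurable (F (s i))" if "l \<le> i" "i < m" for l i
  proof -
    have "s l \<le> s i" using mono[of i] that by simp
    then show ?thesis using c[of l] that by (auto intro: measurable_F_mono[of "c l" "s l" borel "s i"])
  qed
  have qF: "q i \<in> borel_measurable (F (s i))" if "i < m" for i
    unfolding q_def[abs_def]
    by (intro borel_measurable_sum borel_measurable_times borel_measurable_power cF borel_measurable_const)
      (use that in auto)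
  have c'F: "c' i \<in> borel_measurable (F (s i))" if "i < m" for i
    unfolding c'_def[abs_def]
    by (intro measurable_If c[OF that] borel_measurable_const borel_measurable_le qF[OF that] measurable_const)
      auto
  have nonneg: "0 \<le> (c i \<omega>)\<^sup>2 * (s (Suc i) - s i)" if "i < m" for i \<omega>
    using s[OF that] by simp
  have q_ge: "(c i \<omega>)\<^sup>2 * (s (Suc i) - s i) \<le> q i \<omega>" if "i < m" for i \<omega>
    unfolding q_def by (rule member_le_sum) (use that nonneg in auto)
  \<comment> \<open>A coefficient that survives truncation satisfies
    \<open>(c i \<omega>)\<^sup>2 * (s (Suc i) - s i) \<le> b\<close>; adding up the resulting
    bounds gives one constant for all \<open>i\<close>.\<close>
  define C where "C = (\<Sum>i<m. sqrt (b / (s (Suc i) - s i)))"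
  have bd: "\<bar>c' i \<omega>\<bar> \<le> C" if "i < m" for i \<omega>
  proof -
    have "\<bar>c' i \<omega>\<bar> \<le> sqrt (b / (s (Suc i) - s i))"
    proof (cases "q i \<omega> \<le> b")
      case True
      then have "(c i \<omega>)\<^sup>2 * (s (Suc i) - s i) \<le> b" using q_ge[OF that, of \<omega>] by simp
      then have "(c i \<omega>)\<^sup>2 \<le> b / (s (Suc i) - s i)" using s[OF that] by (simp add: field_simps)
      then show ?thesis using True by (simp add: c'_def real_le_rsqrt)
    next
      case False
      then show ?thesis using s[OF that] assms by (simp add: c'_def)
    qed
    also have "\<dots> \<le> C" unfolding C_def
      using that s assms by (intro member_le_sum) (auto simp: less_imp_le)
    finally show ?thesis .
  qed
  note L2 = discrete_integral_L2[of s m c', OF assms(1) s c'F bd, folded Z'_def]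
  have Z'm [measurable]: "Z' \<in> borel_measurable M" using measurable_F_M[OF L2(1)] .
  have [measurable]: "c i \<in> borel_measurable M" "c' i \<in> borel_measurable M" "W (s i) \<in> borel_measurable M" if "i < m" for i
    using that measurable_F_M[OF c[OF that]] measurable_F_M[OF c'F[OF that]] s0[of i] by auto
  have Zm [measurable]: "Z \<in> borel_measurable M"
    unfolding Z_def[abs_def] using s0
    by (intro borel_measurable_sum borel_measurable_times borel_measurable_diff W_measurable_M) auto
  have Qm [measurable]: "(\<lambda>\<omega>. \<Sum>i<m. (c i \<omega>)\<^sup>2 * (s (Suc i) - s i)) \<in> borel_measurable M"
    by (intro borel_measurable_sum borel_measurable_times borel_measurable_power) auto
  have c'_le: "(\<Sum>i<j. (c' i \<omega>)\<^sup>2 * (s (Suc i) - s i)) \<le> b" if "j \<le> m" for j \<omega>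
    using that
  proof (induction j)
    case 0 then show ?case using assms by simp
  next
    case (Suc j)
    show ?case
    proof (cases "q j \<omega> \<le> b")
      case True
      have "(\<Sum>i<Suc j. (c' i \<omega>)\<^sup>2 * (s (Suc i) - s i)) \<le> q j \<omega>"
        unfolding q_def using Suc nonneg by (intro sum_mono) (auto simp: c'_def)
      then show ?thesis using True by simp
    next
      case False
      then show ?thesis using Suc by (simp add: c'_def)
    qed
  qed
  have c'2: "integrable M (\<lambda>\<omega>. (c' i \<omega>)\<^sup>2)" if "i < m" for i
  proof (rule integrable_const_bound[where B = "C\<^sup>2"])
    show "AE \<omega> in M. norm ((c' i \<omega>)\<^sup>2) \<le> C\<^sup>2"
      using bd[OF that] by (auto simp: abs_le_square_iff[symmetric] intro!: AE_I2 order_trans[OF _ abs_ge_self])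
  qed (use that in measurable)
  have "expectation (\<lambda>\<omega>. (Z' \<omega>)\<^sup>2) = expectation (\<lambda>\<omega>. \<Sum>i<m. (c' i \<omega>)\<^sup>2 * (s (Suc i) - s i))"
  proof -
    have "expectation (\<lambda>\<omega>. \<Sum>i<m. (c' i \<omega>)\<^sup>2 * (s (Suc i) - s i)) =
        (\<Sum>i<m. expectation (\<lambda>\<omega>. (c' i \<omega>)\<^sup>2 * (s (Suc i) - s i)))"
      by (rule Bochner_Integration.integral_sum) (use c'2 in auto)
    then show ?thesis using L2(3) unfolding Z'_def by simp
  qed
  also have "\<dots> \<le> expectation (\<lambda>\<omega>. b)"
    by (rule integral_mono) (use c'2 c'_le[of m] in auto)
  finally have E: "expectation (\<lambda>\<omega>. (Z' \<omega>)\<^sup>2) \<le> b" by (simp add: prob_space)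
  have "measure M {\<omega>\<in>space M. \<bar>Z \<omega>\<bar> > \<alpha>} \<le>
    measure M ({\<omega>\<in>space M. (\<Sum>i<m. (c i \<omega>)\<^sup>2 * (s (Suc i) - s i)) > b} \<union> {\<omega>\<in>space M. (Z' \<omega>)\<^sup>2 \<ge> \<alpha>\<^sup>2})"
  proof (rule finite_measure_mono)
    show "{\<omega>\<in>space M. \<bar>Z \<omega>\<bar> > \<alpha>} \<subseteq>
      {\<omega>\<in>space M. (\<Sum>i<m. (c i \<omega>)\<^sup>2 * (s (Suc i) - s i)) > b} \<union> {\<omega>\<in>space M. (Z' \<omega>)\<^sup>2 \<ge> \<alpha>\<^sup>2}"
    proof clarsimp
      fix \<omega> assume w: "\<omega> \<in> space M" "\<bar>Z \<omega>\<bar> > \<alpha>" "\<not> (Z' \<omega>)\<^sup>2 \<ge> \<alpha>\<^sup>2"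
      \<comment> \<open>If the two sums differ, some coefficient was cut, and a partial quadratic
        sum above \<open>b\<close> forces the full one above \<open>b\<close>.\<close>
      have "Z' \<omega> \<noteq> Z \<omega>"
        using w assms(4) power_mono[of \<alpha> "\<bar>Z \<omega>\<bar>" 2] by auto
      then have "\<exists>i<m. c' i \<omega> \<noteq> c i \<omega>"
        unfolding Z_def Z'_def by (auto intro: sum.cong)
      then obtain i where i: "i < m" "q i \<omega> > b" by (auto simp: c'_def split: if_splits)
      have "q i \<omega> \<le> (\<Sum>i<m. (c i \<omega>)\<^sup>2 * (s (Suc i) - s i))"
        unfolding q_def using i nonneg by (intro sum_mono2) auto
      then show "b < (\<Sum>i<m. (c i \<omega>)\<^sup>2 * (s (Suc i) - s i))" using i by simp
    qed
  qed measurable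
  also have "\<dots> \<le> measure M {\<omega>\<in>space M. (\<Sum>i<m. (c i \<omega>)\<^sup>2 * (s (Suc i) - s i)) > b} + measure M {\<omega>\<in>space M. (Z' \<omega>)\<^sup>2 \<ge> \<alpha>\<^sup>2}"
    by (rule measure_Un_le) measurable
  also have "measure M {\<omega>\<in>space M. (Z' \<omega>)\<^sup>2 \<ge> \<alpha>\<^sup>2} \<le> expectation (\<lambda>\<omega>. (Z' \<omega>)\<^sup>2) / \<alpha>\<^sup>2"
    using L2(2) assms by (intro integral_Markov_inequality_measure[where A = "{}"]) auto
  also have "expectation (\<lambda>\<omega>. (Z' \<omega>)\<^sup>2) / \<alpha>\<^sup>2 \<le> b / \<alpha>\<^sup>2"
    using E by (intro divide_right_mono) auto
  finally show ?thesis unfolding Z_def by simp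
qed

end

subsection \<open>Swapping the halves of an excursion inserted at the minimum\<close>

text \<open>Skorokhod's formula for the walk started at \<open>a\<close> and reflected at 0. The
  explicit form is used because swapping the halves of an excursion changes only the minimum; the
  recursion follows later.\<close>

definition reflected :: "real \<Rightarrow> (nat \<Rightarrow> real) \<Rightarrow> nat \<Rightarrow> real" where
  "reflected a x j = (\<Sum>i<j. x i) + max a (- walk_min x j)"

definition graft :: "nat \<Rightarrow> nat \<Rightarrow> (nat \<Rightarrow> real) \<Rightarrow> (nat \<Rightarrow> real) \<Rightarrow> nat \<Rightarrow> real" where
  "graft k L e y i = (if i < k then y i else if i < k + L then e (i - k) else y (i - L))"

lemma sum_graft:
  "(\<Sum>i<j. graft k L e y i) =
    (if j \<le> k then \<Sum>i<j. y i else if j \<le> k + L then (\<Sum>i<k. y i) + (\<Sum>i<j - k. e i)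
     else (\<Sum>i<j - L. y i) + (\<Sum>i<L. e i))"
proof (induction j)
  case (Suc j)
  consider "j < k" | "k \<le> j" "j < k + L" | "k + L \<le> j" by linarith
  then show ?case
  proof cases
    case 1
    then show ?thesis using Suc by (simp add: graft_def)
  next
    case 2
    then have "Suc j - k = Suc (j - k)" by simp
    then show ?thesis using 2 Suc by (cases "j = k") (simp_all add: graft_def)
  next
    case 3
    then have d: "Suc j - L = Suc (j - L)" by simp
    consider "L = 0" "j = k" | "L > 0" "j = k + L" | "k + L < j" using 3 by linarith
    then show ?thesis
    proof cases
      case 1 then show ?thesis using Suc by (simp add: graft_def)
    next
      case 2 then show ?thesis using Suc d by (simp add: graft_def)
    next
      case 3 then show ?thesis using Suc d by (simp add: graft_def)
    qed
  qed
qed simp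

text \<open>A graft with nonnegative total lifts the later path, so new minima can arise only inside
  the graft.\<close>

lemma walk_min_graft_ge:
  assumes "k \<le> m" "0 \<le> (\<Sum>i<L. e i)"
  shows "min (walk_min y m) ((\<Sum>i<k. y i) + walk_min e L) \<le> walk_min (graft k L e y) (m + L)"
proof -
  obtain j where j: "j \<le> m + L" "walk_min (graft k L e y) (m + L) = (\<Sum>i<j. graft k L e y i)"
    using walk_min_attained by blast
  consider "j \<le> k" | "k < j" "j \<le> k + L" | "k + L < j" by linarith
  then show ?thesis
  proof cases
    case 1
    then show ?thesis using j walk_min_le[of j m y] assms by (simp add: sum_graft)
  next
    case 2
    then show ?thesis using j walk_min_le[of "j - k" L e] by (simp add: sum_graft min_le_iff_disj)
  next
    case 3
    then have "walk_min y m \<le> (\<Sum>i<j - L. y i)" using j by (intro walk_min_le) auto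
    then show ?thesis using 3 j assms by (simp add: sum_graft min_le_iff_disj)
  qed
qed

lemma walk_min_graft_le:
  assumes "k \<le> m"
  shows "walk_min (graft k L e y) (m + L) \<le> (\<Sum>i<k. y i) + walk_min e L"
proof -
  obtain r where r: "r \<le> L" "walk_min e L = (\<Sum>i<r. e i)" using walk_min_attained by blast
  have "walk_min (graft k L e y) (m + L) \<le> (\<Sum>i<k + r. graft k L e y i)"
    using assms r by (intro walk_min_le) auto
  also have "\<dots> = (\<Sum>i<k. y i) + walk_min e L" using r by (cases "r = 0") (simp_all add: sum_graft)
  finally show ?thesis .
qed

definition swap_halves :: "nat \<Rightarrow> (nat \<Rightarrow> real) \<Rightarrow> nat \<Rightarrow> real" where
  "swap_halves l e i = (if i < l then e (l + i) else e (i - l))"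

lemma sum_swap_halves:
  "r \<le> l \<Longrightarrow> (\<Sum>i<r. swap_halves l e i) = (\<Sum>i<l + r. e i) - (\<Sum>i<l. e i)"
  "(\<Sum>i<l + r. swap_halves l e i) = (\<Sum>i<l + l. e i) - (\<Sum>i<l. e i) + (\<Sum>i<r. e i)"
proof -
  show 1: "(\<Sum>i<r. swap_halves l e i) = (\<Sum>i<l + r. e i) - (\<Sum>i<l. e i)" if "r \<le> l" for r
    using that by (induction r) (auto simp: swap_halves_def)
  show "(\<Sum>i<l + r. swap_halves l e i) = (\<Sum>i<l + l. e i) - (\<Sum>i<l. e i) + (\<Sum>i<r. e i)"
  proof (induction r)
    case 0 then show ?case using 1[of l] by simp
  next
    case (Suc r) then show ?case by (simp add: swap_halves_def)
  qed
qed

text \<open>An excursion that goes up and then down is turned into one that goes down and then up.\<close>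

lemma walk_min_swap_halves:
  assumes "2 * c \<le> (\<Sum>i<l. e i)" "(\<Sum>i<l + l. e i) - (\<Sum>i<l. e i) \<le> - c" "c \<ge> 0"
  shows "walk_min (swap_halves l e) (l + l) + c \<le> walk_min e (l + l)"
    and "walk_min (swap_halves l e) (l + l) \<le> - c"
proof -
  let ?e = "swap_halves l e"
  obtain r where r: "r \<le> l + l" "walk_min e (l + l) = (\<Sum>i<r. e i)" using walk_min_attained by blast
  \<comment> \<open>The point where \<open>e\<close> attains its minimum reappears after the swap at
    a lower level: lower by the drop of the second half if \<open>r \<le> l\<close>, by the height
    of the first half otherwise.\<close>
  show "walk_min ?e (l + l) + c \<le> walk_min e (l + l)"
  proof (cases "r \<le> l")
    case True
    then have "walk_min ?e (l + l) \<le> (\<Sum>i<l + r. ?e i)" by (intro walk_min_le) auto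
    then show ?thesis using assms r unfolding sum_swap_halves by simp
  next
    case False
    then have "walk_min ?e (l + l) \<le> (\<Sum>i<r - l. ?e i)" using r by (intro walk_min_le) auto
    moreover have "(\<Sum>i<r - l. ?e i) = (\<Sum>i<r. e i) - (\<Sum>i<l. e i)"
      using sum_swap_halves(1)[of "r - l" l e] False r by simp
    ultimately show ?thesis using assms r by simp
  qed
  have "walk_min ?e (l + l) \<le> (\<Sum>i<l. ?e i)" by (intro walk_min_le) auto
  then show "walk_min ?e (l + l) \<le> - c" using assms unfolding sum_swap_halves(1)[OF order_refl] by simp
qed

text \<open>Both walks end at the same point, below which only the minimum matters, so the reflected
  walks differ by the difference of the minima. A drop of at least \<open>2 * \<kappa>\<close>
  leaves a gap of \<open>\<kappa>\<close>, although the rest of the path may fall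
  \<open>\<kappa>\<close> below the insertion level. A first half of height
  \<open>4 * \<kappa>\<close> is twice that drop, as the swap demands, and outweighs a drop of at
  most \<open>4 * \<kappa>\<close>, so the graft has nonnegative total.\<close>

lemma reflected_graft_gap:
  fixes y e :: "nat \<Rightarrow> real" and k l m :: nat and a \<kappa> :: real
  defines "x \<equiv> graft k (l + l) e y" and "x' \<equiv> graft k (l + l) (swap_halves l e) y"
  assumes "k \<le> m" "\<kappa> > 0"
    and y: "(\<Sum>i<k. y i) \<le> - a" "1 \<le> (\<Sum>i<m. y i) - (\<Sum>i<k. y i)" "(\<Sum>i<k. y i) - \<kappa> \<le> walk_min y m"
    and e: "4 * \<kappa> \<le> (\<Sum>i<l. e i)" "- 4 * \<kappa> \<le> (\<Sum>i<l + l. e i) - (\<Sum>i<l. e i)"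
      "(\<Sum>i<l + l. e i) - (\<Sum>i<l. e i) \<le> - 2 * \<kappa>"
  shows "1 \<le> reflected a x (m + (l + l))" "1 \<le> reflected a x' (m + (l + l))"
    and "\<kappa> \<le> reflected a x' (m + (l + l)) - reflected a x (m + (l + l))"
proof -
  let ?L = "l + l" and ?e = "swap_halves l e" and ?g = "\<Sum>i<k. y i"
  have d: "0 \<le> (\<Sum>i<?L. e i)" using e by linarith
  have d': "(\<Sum>i<?L. ?e i) = (\<Sum>i<?L. e i)" by (simp add: sum_swap_halves)
  have end_x: "(\<Sum>i<m + ?L. graft k ?L f y i) = (\<Sum>i<m. y i) + (\<Sum>i<?L. f i)" for f
    using assms by (cases "m = k") (auto simp: sum_graft)
  have refl: "reflected a (graft k ?L f y) (m + ?L) = (\<Sum>i<m. y i) + (\<Sum>i<?L. f i) - walk_min (graft k ?L f y) (m + ?L)"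
    and ge: "walk_min (graft k ?L f y) (m + ?L) \<le> ?g" for f
  proof -
    show "walk_min (graft k ?L f y) (m + ?L) \<le> ?g"
      using walk_min_graft_le[OF assms(3), of ?L f y] walk_min_nonpos[of f ?L] by simp
    then show "reflected a (graft k ?L f y) (m + ?L) = (\<Sum>i<m. y i) + (\<Sum>i<?L. f i) - walk_min (graft k ?L f y) (m + ?L)"
      unfolding reflected_def end_x using y(1) by simp
  qed
  show "1 \<le> reflected a x (m + ?L)" "1 \<le> reflected a x' (m + ?L)"
    unfolding x_def x'_def refl d' using y(2) d ge[of e] ge[of ?e] by linarith+
  have A: "walk_min ?e ?L + 2 * \<kappa> \<le> walk_min e ?L" "walk_min ?e ?L \<le> - (2 * \<kappa>)"
    using walk_min_swap_halves[of "2 * \<kappa>" e l] e assms(4) by simp_all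
  show "\<kappa> \<le> reflected a x' (m + ?L) - reflected a x (m + ?L)"
    unfolding x_def x'_def refl d'
    using walk_min_graft_ge[OF assms(3) d, of y] walk_min_graft_le[OF assms(3), of ?L ?e y] A y(3) assms(4)
    by (simp add: min_def split: if_splits)
qed

section \<open>Probabilities and independence for Gaussian walks\<close>

lemma normal_measure_pos:
  assumes "\<alpha> < \<beta>"
  shows "0 < measure (density lborel std_normal_density) {\<alpha>..\<beta>}"
proof -
  interpret prob_space "density lborel (\<lambda>x. ennreal (std_normal_density x))"
    using prob_space_normal_density[of 1 0] by simp
  have "emeasure (density lborel std_normal_density) {\<alpha>..\<beta>} \<noteq> 0"
  proof
    have [simp]: "std_normal_density x \<noteq> 0" for x
      using normal_density_pos[of 1 0 x] by simp
    assume "emeasure (density lborel std_normal_density) {\<alpha>..\<beta>} = 0"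
    then have "AE x in lborel. ennreal (std_normal_density x) * indicator {\<alpha>..\<beta>} x = 0"
      by (simp add: emeasure_density nn_integral_0_iff_AE)
    then have "AE x in lborel. x \<notin> {\<alpha>..\<beta>}"
      by eventually_elim (auto simp: indicator_def normal_density_pos split: if_splits)
    then have "emeasure lborel {\<alpha>..\<beta>} = 0"
      by (subst (asm) AE_iff_measurable[of "{\<alpha>..\<beta>}"]) (auto simp: set_eq_iff)
    then show False using assms by simp
  qed
  then show ?thesis by (simp add: emeasure_eq_measure zero_less_measure_iff)
qed

lemma (in prob_space) normal_scaled_prob:
  assumes "distributed M lborel X (normal_density 0 s)" "s > 0" "A \<in> sets borel"
  shows "prob {\<omega>\<in>space M. X \<omega> / s \<in> A} = measure (density lborel std_normal_density) A"
proof -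
  have D: "distributed M lborel (\<lambda>\<omega>. X \<omega> / s) std_normal_density"
    using normal_standard_normal_convert[OF assms(2), of X 0] assms(1) by simp
  then have "measure (density lborel std_normal_density) A = measure (distr M lborel (\<lambda>\<omega>. X \<omega> / s)) A"
    by (simp add: distributed_def)
  also have "\<dots> = prob ((\<lambda>\<omega>. X \<omega> / s) -` A \<inter> space M)"
    using D assms(3) by (intro measure_distr) (auto simp: distributed_def)
  finally show ?thesis by (simp add: vimage_def Int_def conj_commute)
qed

text \<open>Locality is expressed by invariance under \<open>restrict\<close>, so that the same
  predicate can be used on the full product and on the product over its own coordinates.\<close>

lemma gauss_steps_indep_events:
  assumes "\<sigma> > 0" "A \<inter> B = {}" "A \<subseteq> {..<N}" "B \<subseteq> {..<N}"
    and p: "Measurable.pred (PiM A (\<lambda>_. borel)) p" "\<And>x. p (restrict x A) = p x"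
    and q: "Measurable.pred (PiM B (\<lambda>_. borel)) q" "\<And>x. q (restrict x B) = q x"
  shows "{x\<in>space (gauss_steps N \<sigma>). p x} \<in> sets (gauss_steps N \<sigma>)"
    and "measure (gauss_steps N \<sigma>) {x\<in>space (gauss_steps N \<sigma>). p x \<and> q x} =
      measure (gauss_steps N \<sigma>) {x\<in>space (gauss_steps N \<sigma>). p x} *
      measure (gauss_steps N \<sigma>) {x\<in>space (gauss_steps N \<sigma>). q x}"
proof -
  let ?P = "gauss_steps N \<sigma>"
  interpret prob_space ?P using assms by (simp add: prob_space_gauss_steps)
  have ind: "indep_var (PiM A (\<lambda>_. borel)) (\<lambda>x. restrict (\<lambda>i. x i) A) (PiM B (\<lambda>_. borel)) (\<lambda>x. restrict (\<lambda>i. x i) B)"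
    by (rule indep_var_restrict[OF gauss_steps_indep[OF assms(1)] assms(2-4)])
  let ?p = "{z \<in> space (PiM A (\<lambda>_. borel)). p z}" and ?q = "{z \<in> space (PiM B (\<lambda>_. borel)). q z}"
  have s: "?p \<in> sets (PiM A (\<lambda>_. borel))" "?q \<in> sets (PiM B (\<lambda>_. borel))" using p(1) q(1) by simp_all
  have eq: "(\<lambda>x. restrict (\<lambda>i. x i) A) -` ?p \<inter> space ?P = {x\<in>space ?P. p x}"
    "(\<lambda>x. restrict (\<lambda>i. x i) B) -` ?q \<inter> space ?P = {x\<in>space ?P. q x}"
    "(\<lambda>x. (restrict (\<lambda>i. x i) A, restrict (\<lambda>i. x i) B)) -` (?p \<times> ?q) \<inter> space ?P = {x\<in>space ?P. p x \<and> q x}"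
    by (auto simp: space_PiM p(2) q(2))
  show "{x\<in>space ?P. p x} \<in> sets ?P"
    using measurable_sets[OF indep_var_rv1[OF ind] s(1)] unfolding eq .
  show "prob {x\<in>space ?P. p x \<and> q x} = prob {x\<in>space ?P. p x} * prob {x\<in>space ?P. q x}"
    using indep_varD[OF ind s] unfolding eq .
qed

lemma gauss_steps_blocks:
  assumes "\<sigma> > 0" "L > 0" "n > 0"
  shows "distr (gauss_steps (n * L) \<sigma>) (gauss_steps n (\<sigma> * sqrt L)) (\<lambda>x. \<lambda>j\<in>{..<n}. \<Sum>i\<in>{j * L..<Suc j * L}. x i) =
    gauss_steps n (\<sigma> * sqrt L)"
proof -
  let ?P = "gauss_steps (n * L) \<sigma>"
  interpret prob_space ?P using assms by (simp add: prob_space_gauss_steps)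
  let ?X = "\<lambda>j x. \<Sum>i\<in>{j * L..<Suc j * L}. x i :: real"
  have sub: "{j * L..<Suc j * L} \<subseteq> {..<n * L}" if "j < n" for j
    using mult_le_mono1[of "Suc j" n L] that by auto
  have disj: "disjoint_family_on (\<lambda>j. {j * L..<Suc j * L}) {..<n}"
    unfolding disjoint_family_on_def
  proof (intro ballI impI)
    fix i j :: nat assume "i \<noteq> j"
    then consider "Suc i \<le> j" | "Suc j \<le> i" by linarith
    then show "{i * L..<Suc i * L} \<inter> {j * L..<Suc j * L} = {}"
      by cases (use mult_le_mono1[of "Suc i" j L] mult_le_mono1[of "Suc j" i L] in auto)
  qed
  have "indep_vars (\<lambda>j. PiM {j * L..<Suc j * L} (\<lambda>_. borel)) (\<lambda>j x. restrict (\<lambda>i. x i) {j * L..<Suc j * L}) {..<n}"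
    using sub by (intro indep_vars_restrict[OF gauss_steps_indep[OF assms(1)] _ disj]) auto
  then have "indep_vars (\<lambda>_. borel) (\<lambda>j x. ?X j (restrict (\<lambda>i. x i) {j * L..<Suc j * L})) {..<n}"
    by (rule indep_vars_compose2) simp
  then have ind: "indep_vars (\<lambda>_. borel) ?X {..<n}" by simp
  have Xm: "?X j \<in> borel_measurable ?P" if "j < n" for j
    using sub[OF that] by (intro borel_measurable_sum measurable_gauss_steps_component) auto
  have "distr ?P (\<Pi>\<^sub>M j\<in>{..<n}. borel) (\<lambda>x. \<lambda>j\<in>{..<n}. ?X j x) = (\<Pi>\<^sub>M j\<in>{..<n}. distr ?P borel (?X j))"
    using ind assms(3) Xm by (subst (asm) indep_vars_iff_distr_eq_PiM') auto
  also have "\<dots> = gauss_steps n (\<sigma> * sqrt L)"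
    unfolding gauss_steps_def
  proof (intro PiM_cong refl)
    fix j assume "j \<in> {..<n}"
    then have "distributed ?P lborel (?X j) (normal_density 0 (\<sigma> * sqrt (card {j * L..<Suc j * L})))"
      using sub[of j] assms by (intro gauss_steps_block_sum) auto
    then have "distr ?P lborel (?X j) = density lborel (normal_density 0 (\<sigma> * sqrt L))"
      by (simp add: distributed_def)
    moreover have "distr ?P lborel (?X j) = distr ?P borel (?X j)" by (intro distr_cong) auto
    ultimately show "distr (\<Pi>\<^sub>M i\<in>{..<n * L}. density lborel (normal_density 0 \<sigma>)) borel (?X j) = density lborel (normal_density 0 (\<sigma> * sqrt L))"
      by (simp add: gauss_steps_def)
  qed
  also have "distr ?P (\<Pi>\<^sub>M j\<in>{..<n}. borel) (\<lambda>x. \<lambda>j\<in>{..<n}. ?X j x) = distr ?P (gauss_steps n (\<sigma> * sqrt L)) (\<lambda>x. \<lambda>j\<in>{..<n}. ?X j x)"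
    by (intro distr_cong) (auto simp: sets_gauss_steps)
  finally show ?thesis .
qed

lemma sum_blocks: "(\<Sum>j<k. \<Sum>i\<in>{j * L..<Suc j * L}. x i) = (\<Sum>i<k * L. x i :: real)"
proof (induction k)
  case (Suc k)
  have "{..<Suc k * L} = {..<k * L} \<union> {k * L..<Suc k * L}" by auto
  then show ?case using Suc by (simp add: sum.union_disjoint ivl_disj_int)
qed simp

text \<open>Spitzer's identity gives both expectations exactly and their leading terms cancel, so
  the mean fall of the fine walk below its coarse values is of order \<open>1 / sqrt n\<close>,
  uniformly in the refinement \<open>L\<close>. The hypotheses force \<open>r = n - 1\<close>: the
  last block is kept for the excursion.\<close>

lemma expectation_coarse_minus_fine:
  fixes n L r :: nat
  assumes "n > 0" "L > 0" "r < n" "n \<le> Suc r"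
  defines "N \<equiv> n * L"
  defines "P \<equiv> gauss_steps N (1 / sqrt N)"
  defines "X \<equiv> \<lambda>x j. \<Sum>i\<in>{j * L..<Suc j * L}. x i :: real"
  shows "integrable P (\<lambda>x. walk_min (X x) r - walk_min x (r * L))"
    and "(\<integral>x. walk_min (X x) r - walk_min x (r * L) \<partial>P) \<le> 1 / sqrt n"
proof -
  have N: "N > 0" using assms by simp
  have s: "1 / sqrt N > 0" using N by simp
  let ?R = "\<lambda>x. \<lambda>j\<in>{..<n}. X x j"
  have sn: "1 / sqrt N * sqrt L = 1 / sqrt n" using assms by (simp add: real_sqrt_mult)
  have law: "distr P (gauss_steps n (1 / sqrt n)) ?R = gauss_steps n (1 / sqrt n)"
    using gauss_steps_blocks[OF s assms(2,1)] sn by (simp add: P_def N_def X_def)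
  have Rm: "?R \<in> measurable P (gauss_steps n (1 / sqrt n))"
  proof -
    have "(\<lambda>x. X x j) \<in> borel_measurable P" if "j < n" for j
      unfolding X_def P_def using mult_le_mono1[of "Suc j" n L] that
      by (intro borel_measurable_sum measurable_gauss_steps_component) (auto simp: N_def)
    then show ?thesis by (simp add: measurable_cong_sets[OF refl sets_gauss_steps] measurable_restrict)
  qed
  have wR: "walk_min (?R x) r = walk_min (X x) r" for x
    using assms by (intro walk_min_cong) auto
  have pn: "0 < 1 / sqrt n" using assms by simp
  note En = expectation_walk_min[OF pn less_imp_le[OF assms(3)]]
  have wm: "(\<lambda>x. walk_min x r) \<in> borel_measurable (gauss_steps n (1 / sqrt n))"
    using En(1) by auto
  have c1: "integrable P (\<lambda>x. walk_min (X x) r)"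
    using En(1) integrable_distr_eq[OF Rm wm] unfolding law wR by simp
  have c2: "(\<integral>x. walk_min (X x) r \<partial>P) = (\<integral>x. walk_min x r \<partial>gauss_steps n (1 / sqrt n))"
    using integral_distr[OF Rm wm] unfolding law wR by simp
  have rL: "r * L \<le> N" using assms by (simp add: N_def)
  note EN = expectation_walk_min[OF s rL, folded P_def]
  show "integrable P (\<lambda>x. walk_min (X x) r - walk_min x (r * L))" using c1 EN(1) by simp
  have "(\<integral>x. walk_min (X x) r - walk_min x (r * L) \<partial>P) =
    (sqrt (2 / pi) / 2) * (1 / sqrt N * (\<Sum>k<r * L. 1 / sqrt (Suc k)) - 1 / sqrt n * (\<Sum>k<r. 1 / sqrt (Suc k)))"
    using c1 c2 EN En by (simp add: algebra_simps)
  also have "\<dots> \<le> (sqrt (2 / pi) / 2) * (1 / sqrt N * (2 * sqrt N) - 1 / sqrt n * (2 * sqrt n - 2))"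
  proof (intro mult_left_mono diff_mono)
    show "(\<Sum>k<r * L. 1 / sqrt (Suc k)) \<le> 2 * sqrt N"
      using sum_inverse_sqrt_bounds(1)[of "r * L"] rL by (meson mult_left_mono of_nat_mono order_trans real_sqrt_le_mono zero_le_numeral)
    have "sqrt n \<le> sqrt (Suc r)" using assms by simp
    then show "2 * sqrt n - 2 \<le> (\<Sum>k<r. 1 / sqrt (Suc k))"
      using sum_inverse_sqrt_bounds(2)[of r] by linarith
  qed auto
  also have "\<dots> = sqrt (2 / pi) * (1 / sqrt n)" using N assms by (simp add: field_simps)
  also have "\<dots> \<le> 1 * (1 / sqrt n)" using pi_gt3 by (intro mult_right_mono) auto
  finally show "(\<integral>x. walk_min (X x) r - walk_min x (r * L) \<partial>P) \<le> 1 / sqrt n" by simp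
qed

section \<open>Locating the insertion block\<close>

definition first_argmin :: "nat \<Rightarrow> (nat \<Rightarrow> real) \<Rightarrow> nat \<Rightarrow> bool" where
  "first_argmin n f k \<longleftrightarrow> k \<le> n \<and> (\<forall>j<k. f k < f j) \<and> (\<forall>j\<le>n. f k \<le> f j)"

text \<open>Taking the first minimizer excludes ties; events that prescribe different minimizers are
  then disjoint and their probabilities add up.\<close>

lemma first_argmin_unique: "first_argmin n f k \<Longrightarrow> first_argmin n f k' \<Longrightarrow> k = k'"
  unfolding first_argmin_def by (metis linorder_neqE_nat not_le)

lemma first_argmin_cong:
  "(\<And>j. j \<le> n \<Longrightarrow> f j = g j) \<Longrightarrow> first_argmin n f k = first_argmin n g k"
  unfolding first_argmin_def by (metis less_imp_le order_trans)

lemma first_argmin_exists: "\<exists>k. first_argmin n f k"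
proof -
  let ?m = "Min (f ` {..n})"
  have ex: "\<exists>k. k \<le> n \<and> f k = ?m" using Min_in[of "f ` {..n}"] by fastforce
  define k where "k = (LEAST k. k \<le> n \<and> f k = ?m)"
  have k: "k \<le> n" "f k = ?m" using LeastI_ex[OF ex] unfolding k_def by auto
  have ge: "?m \<le> f j" if "j \<le> n" for j using that by simp
  have "f k < f j" if "j < k" for j
  proof -
    have "\<not> (j \<le> n \<and> f j = ?m)" using not_less_Least[of j "\<lambda>k. k \<le> n \<and> f k = ?m"] that unfolding k_def by blast
    then show ?thesis using ge[of j] that k by (simp add: less_le)
  qed
  then show ?thesis using k ge unfolding first_argmin_def by auto
qed

lemma sum_graft_blocks:
  "(\<Sum>i<j * L. graft (k * L) L e y i) = (if j \<le> k then \<Sum>i<j * L. y i else (\<Sum>i<(j - 1) * L. y i) + (\<Sum>i<L. e i))"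
proof (cases "j \<le> k")
  case False
  then obtain j' where j': "j = Suc j'" "k \<le> j'" by (cases j) auto
  show ?thesis
  proof (cases "L = 0")
    case False
    then have "k * L < Suc j' * L" using j' by (intro mult_less_mono1) auto
    moreover have "Suc j' * L \<le> k * L + L \<longleftrightarrow> j' = k" using False j' by auto
    ultimately show ?thesis using j' by (auto simp: sum_graft)
  qed (simp add: sum_graft)
qed (simp add: sum_graft)

text \<open>The excursion fills exactly one coarse block and ends no lower than it starts, so the
  grafted walk still shows on the coarse grid where the insertion took place.\<close>

lemma first_argmin_graft:
  assumes "first_argmin n (\<lambda>j. \<Sum>i<j * L. y i) k" "0 \<le> (\<Sum>i<L. e i)"
  shows "first_argmin (Suc n) (\<lambda>j. \<Sum>i<j * L. graft (k * L) L e y i) k"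
  using assms unfolding sum_graft_blocks
  by (auto simp: first_argmin_def intro: add_increasing2)

text \<open>The level \<open>- a\<close> lets the minimum, not the starting point, govern the
  reflection. The height \<open>1\<close> above the minimum keeps the endpoint of the reflected walk
  away from 0.\<close>

definition good_walk :: "real \<Rightarrow> real \<Rightarrow> nat \<Rightarrow> nat \<Rightarrow> (nat \<Rightarrow> real) \<Rightarrow> nat \<Rightarrow> bool" where
  "good_walk a \<kappa> r L y k \<longleftrightarrow> first_argmin r (\<lambda>j. \<Sum>i<j * L. y i) k \<and>
    (\<Sum>i<k * L. y i) \<le> - a \<and> 1 \<le> (\<Sum>i<r * L. y i) - (\<Sum>i<k * L. y i) \<and>
    (\<Sum>i<k * L. y i) - \<kappa> \<le> walk_min y (r * L)"

text \<open>The second half is described by its own sum, hence by coordinates disjoint from those of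
  the first half, so that the two conditions are independent.\<close>

definition good_excursion :: "real \<Rightarrow> nat \<Rightarrow> (nat \<Rightarrow> real) \<Rightarrow> bool" where
  "good_excursion \<kappa> l e \<longleftrightarrow> 4 * \<kappa> \<le> (\<Sum>i<l. e i) \<and> (\<Sum>i=l..<l + l. e i) \<in> {- 4 * \<kappa>..- 2 * \<kappa>}"

lemma sum_second_half:
  fixes l :: nat
  shows "(\<Sum>i=l..<l + l. e i) = (\<Sum>i<l + l. e i) - (\<Sum>i<l. e i :: real)"
proof -
  have "{..<l + l} = {..<l} \<union> {l..<l + l}" by (intro set_eqI) (simp, linarith)
  then show ?thesis by (simp add: sum.union_disjoint ivl_disj_int)
qed

text \<open>One vector of \<open>m + L\<close> steps stores the walk in its first \<open>m\<close>
  coordinates and the excursion in the last \<open>L\<close>. Grafting then only rearranges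
  coordinates, and so preserves the Gaussian law.\<close>

definition graft_index :: "nat \<Rightarrow> nat \<Rightarrow> nat \<Rightarrow> nat \<Rightarrow> nat" where
  "graft_index m k L i = (if i < k then i else if i < k + L then m + (i - k) else i - L)"

definition graft_swap_index :: "nat \<Rightarrow> nat \<Rightarrow> nat \<Rightarrow> nat \<Rightarrow> nat" where
  "graft_swap_index m k l i = (if i < k then i else if i < k + l then m + l + (i - k)
    else if i < k + (l + l) then m + (i - k - l) else i - (l + l))"

lemma graft_index:
  assumes "k \<le> m"
  shows "inj_on (graft_index m k L) {..<m + L}" "graft_index m k L \<in> {..<m + L} \<rightarrow> {..<m + L}"
    "graft k L (\<lambda>i. y (m + i)) y i = y (graft_index m k L i)"
  using assms by (auto simp: graft_index_def inj_on_def graft_def split: if_splits)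

lemma graft_swap_index:
  assumes "k \<le> m"
  shows "inj_on (graft_swap_index m k l) {..<m + (l + l)}" "graft_swap_index m k l \<in> {..<m + (l + l)} \<rightarrow> {..<m + (l + l)}"
    "graft k (l + l) (swap_halves l (\<lambda>i. y (m + i))) y i = y (graft_swap_index m k l i)"
  using assms by (auto simp: graft_swap_index_def inj_on_def graft_def swap_halves_def add.assoc split: if_splits)

lemma reflected_cong: "(\<And>i. i < N \<Longrightarrow> x i = y i) \<Longrightarrow> reflected a x N = reflected a y N"
  unfolding reflected_def using walk_min_cong[of N x y] by simp

lemma measurable_walk [measurable]:
  assumes "j \<le> N" 
  shows "(\<lambda>x. \<Sum>i<j. x i) \<in> borel_measurable (gauss_steps N \<sigma>)"
    "(\<lambda>x. walk_min x j) \<in> borel_measurable (gauss_steps N \<sigma>)"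
    "(\<lambda>x. reflected a x j) \<in> borel_measurable (gauss_steps N \<sigma>)"
proof -
  show 1: "(\<lambda>x. \<Sum>i<j. x i) \<in> borel_measurable (gauss_steps N \<sigma>)"
    using assms by (intro borel_measurable_sum measurable_gauss_steps_component) auto
  show 2: "(\<lambda>x. walk_min x j) \<in> borel_measurable (gauss_steps N \<sigma>)"
    using assms by (intro measurable_walk_min measurable_gauss_steps_component) auto
  show "(\<lambda>x. reflected a x j) \<in> borel_measurable (gauss_steps N \<sigma>)"
    unfolding reflected_def using 1 2 by measurable
qed

text \<open>The two grafts have the same values at the coarse grid points, hence the same approximation, but
  their reflected walks differ by at least \<open>\<kappa>\<close>.\<close>

lemma conflict_probability:
  fixes a \<kappa> \<sigma> :: real and r l :: nat and \<psi> :: "(nat \<Rightarrow> real) \<Rightarrow> real"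
  defines "L \<equiv> l + l" and "N \<equiv> r * (l + l) + (l + l)"
  assumes "\<sigma> > 0" "\<kappa> > 0" "l > 0"
    and \<psi>m: "\<psi> \<in> borel_measurable (gauss_steps N \<sigma>)"
    and \<psi>: "\<And>x x'. (\<And>j. j \<le> Suc r \<Longrightarrow> (\<Sum>i<j * L. x i) = (\<Sum>i<j * L. x' i)) \<Longrightarrow> \<psi> x = \<psi> x'"
  shows "measure (gauss_steps N \<sigma>) {y \<in> space (gauss_steps N \<sigma>). (\<exists>k\<le>r. good_walk a \<kappa> r L y k) \<and> good_excursion \<kappa> l (\<lambda>i. y (r * L + i))} \<le>
    2 * measure (gauss_steps N \<sigma>) {x \<in> space (gauss_steps N \<sigma>). \<kappa> / 2 \<le> \<bar>reflected a x N - \<psi> x\<bar> \<and> 1 \<le> reflected a x N}"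
proof -
  let ?P = "gauss_steps N \<sigma>"
  let ?m = "r * L"
  interpret prob_space ?P using assms by (simp add: prob_space_gauss_steps)
  have N: "N = ?m + L" by (simp add: N_def L_def)
  have mN: "j * L \<le> N" if "j \<le> Suc r" for j
    using mult_le_mono1[OF that, of L] by (simp add: N add.commute)
  \<comment> \<open>This event reads the insertion block off the grafted path itself.\<close>
  define C where "C k = {x \<in> space ?P. first_argmin (Suc r) (\<lambda>j. \<Sum>i<j * L. x i) k}" for k
  define Q where "Q = {x \<in> space ?P. \<kappa> / 2 \<le> \<bar>reflected a x N - \<psi> x\<bar> \<and> 1 \<le> reflected a x N}"
  define A where "A k = {y \<in> space ?P. good_walk a \<kappa> r L y k \<and> good_excursion \<kappa> l (\<lambda>i. y (?m + i))}" for k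
  have Sm: "(\<lambda>x. \<Sum>i<j * L. x i) \<in> borel_measurable ?P" if "j \<le> Suc r" for j
    using mN[OF that] by (rule measurable_walk)
  have Cm [measurable]: "C k \<in> sets ?P" for k
  proof (cases "k \<le> Suc r")
    case True
    have "C k = {x \<in> space ?P. (\<forall>j\<in>{..<k}. (\<Sum>i<k * L. x i) < (\<Sum>i<j * L. x i)) \<and> (\<forall>j\<in>{..Suc r}. (\<Sum>i<k * L. x i) \<le> (\<Sum>i<j * L. x i))}"
      using True by (auto simp: C_def first_argmin_def)
    also have "\<dots> \<in> sets ?P"
      by (intro sets.sets_Collect_conj sets.sets_Collect_finite_All borel_measurable_less borel_measurable_le Sm)
        (use True in auto)
    finally show ?thesis .
  next
    case False
    then have "C k = {}" by (auto simp: C_def first_argmin_def)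
    then show ?thesis by simp
  qed
  have Qm [measurable]: "Q \<in> sets ?P"
    unfolding Q_def
    by (intro sets.sets_Collect_conj borel_measurable_le borel_measurable_const borel_measurable_abs
        borel_measurable_diff measurable_walk(3) \<psi>m order_refl)
  have Am: "A k \<in> sets ?P" if "k \<le> r" for k
  proof -
    have em: "(\<lambda>y. \<Sum>i<l. y (?m + i)) \<in> borel_measurable ?P" "(\<lambda>y. \<Sum>i=l..<l + l. y (?m + i)) \<in> borel_measurable ?P"
      by (intro borel_measurable_sum measurable_gauss_steps_component; simp add: N L_def)+
    have "A k = {y \<in> space ?P. (((\<forall>j\<in>{..<k}. (\<Sum>i<k * L. y i) < (\<Sum>i<j * L. y i)) \<and> (\<forall>j\<in>{..r}. (\<Sum>i<k * L. y i) \<le> (\<Sum>i<j * L. y i))) \<and>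
      ((\<Sum>i<k * L. y i) \<le> - a \<and> 1 \<le> (\<Sum>i<r * L. y i) - (\<Sum>i<k * L. y i) \<and>
        (\<Sum>i<k * L. y i) - \<kappa> \<le> walk_min y (r * L))) \<and>
       (4 * \<kappa> \<le> (\<Sum>i<l. y (?m + i)) \<and> (- 4 * \<kappa> \<le> (\<Sum>i=l..<l + l. y (?m + i)) \<and> (\<Sum>i=l..<l + l. y (?m + i)) \<le> - 2 * \<kappa>))}"
      using that by (auto simp: A_def good_walk_def first_argmin_def good_excursion_def)
    also have "\<dots> \<in> sets ?P"
      by (intro sets.sets_Collect_conj sets.sets_Collect_finite_All borel_measurable_less borel_measurable_le
          borel_measurable_const borel_measurable_diff Sm em measurable_walk(2)) (use that mN[of r] in auto)
    finally show ?thesis .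
  qed
  \<comment> \<open>For fixed \<open>k\<close> both grafts preserve the measure, and at least one of
    them sends a given point of \<open>A k\<close> into \<open>Q \<inter> C k\<close>; hence the
    factor \<open>2\<close>.\<close>
  have half: "prob (A k) \<le> 2 * prob (Q \<inter> C k)" if "k \<le> r" for k
  proof -
    let ?g = "graft_index ?m (k * L) L" and ?g' = "graft_swap_index ?m (k * L) l"
    have km: "k * L \<le> ?m" using that by simp
    note gi = graft_index[OF km, of L, folded N] and gi' = graft_swap_index[OF km, of l, folded L_def, folded N]
    let ?f = "\<lambda>y. \<lambda>i\<in>{..<N}. y (?g i)" and ?f' = "\<lambda>y. \<lambda>i\<in>{..<N}. y (?g' i)"
    have fm: "?f \<in> measurable ?P ?P" "?f' \<in> measurable ?P ?P"
      by (rule measurable_gauss_steps_reindex gi(2) gi'(2))+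
    have QC: "Q \<inter> C k \<in> sets ?P" by measurable
    have p: "prob (?f -` (Q \<inter> C k) \<inter> space ?P) = prob (Q \<inter> C k)"
      using measure_distr[OF fm(1) QC] gauss_steps_reindex[OF assms(3) gi(1,2)] by simp
    have p': "prob (?f' -` (Q \<inter> C k) \<inter> space ?P) = prob (Q \<inter> C k)"
      using measure_distr[OF fm(2) QC] gauss_steps_reindex[OF assms(3) gi'(1,2)] by simp
    have "A k \<subseteq> (?f -` (Q \<inter> C k) \<inter> space ?P) \<union> (?f' -` (Q \<inter> C k) \<inter> space ?P)"
    proof
      fix y assume "y \<in> A k"
      then have y: "y \<in> space ?P" "good_walk a \<kappa> r L y k" "good_excursion \<kappa> l (\<lambda>i. y (?m + i))"
        by (auto simp: A_def)
      define e where "e i = y (?m + i)" for i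
      let ?x = "graft (k * L) L e y" and ?x' = "graft (k * L) L (swap_halves l e) y"
      have exc: "4 * \<kappa> \<le> (\<Sum>i<l. e i)" "- 4 * \<kappa> \<le> (\<Sum>i<l + l. e i) - (\<Sum>i<l. e i)"
        "(\<Sum>i<l + l. e i) - (\<Sum>i<l. e i) \<le> - 2 * \<kappa>"
        using y(3) unfolding good_excursion_def sum_second_half e_def by auto
      have d: "0 \<le> (\<Sum>i<L. e i)" using exc unfolding L_def by linarith
      have d': "(\<Sum>i<L. swap_halves l e i) = (\<Sum>i<L. e i)" unfolding L_def sum_swap_halves(2) by simp
      define z z' where "z = ?f y" and "z' = ?f' y"
      have fx: "z i = ?x i" "z' i = ?x' i" if "i < N" for i
        using that gi(3)[of y i] gi'(3)[of y i] by (simp_all add: e_def[abs_def] z_def z'_def)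
      have sx: "(\<Sum>i<j. z i) = (\<Sum>i<j. ?x i)" "(\<Sum>i<j. z' i) = (\<Sum>i<j. ?x' i)" if "j \<le> N" for j
        by (intro sum.cong refl; use fx that in auto)+
      have rx: "reflected a z N = reflected a ?x N" "reflected a z' N = reflected a ?x' N"
        by (intro reflected_cong fx; assumption)+
      have gw: "first_argmin r (\<lambda>j. \<Sum>i<j * L. y i) k" "(\<Sum>i<k * L. y i) \<le> - a"
        "1 \<le> (\<Sum>i<?m. y i) - (\<Sum>i<k * L. y i)" "(\<Sum>i<k * L. y i) - \<kappa> \<le> walk_min y ?m"
        using y(2) unfolding good_walk_def by auto
      have fsp: "z \<in> space ?P" "z' \<in> space ?P"
        using measurable_space[OF fm(1) y(1)] measurable_space[OF fm(2) y(1)] unfolding z_def z'_def by blast+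
      have first: "first_argmin (Suc r) (\<lambda>j. \<Sum>i<j * L. ?x i) k" "first_argmin (Suc r) (\<lambda>j. \<Sum>i<j * L. ?x' i) k"
        using first_argmin_graft[OF gw(1), of e] first_argmin_graft[OF gw(1), of "swap_halves l e"] d d' by simp_all
      have fcong: "first_argmin (Suc r) (\<lambda>j. \<Sum>i<j * L. z i) k = first_argmin (Suc r) (\<lambda>j. \<Sum>i<j * L. ?x i) k"
        "first_argmin (Suc r) (\<lambda>j. \<Sum>i<j * L. z' i) k = first_argmin (Suc r) (\<lambda>j. \<Sum>i<j * L. ?x' i) k"
        by (intro first_argmin_cong sx mN; assumption)+
      have inC: "z \<in> C k" "z' \<in> C k" using first fsp fcong unfolding C_def by blast+
      have same: "\<psi> z = \<psi> z'"
      proof (rule \<psi>)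
        fix j assume j: "j \<le> Suc r"
        have "(\<Sum>i<j * L. ?x i) = (\<Sum>i<j * L. ?x' i)"
          unfolding sum_graft_blocks d' ..
        then show "(\<Sum>i<j * L. z i) = (\<Sum>i<j * L. z' i)" using sx mN[OF j] by simp
      qed
      note gap = reflected_graft_gap[OF km assms(4) gw(2-4) exc, folded L_def, folded N]
      \<comment> \<open>A single value of \<open>\<psi>\<close> must miss one of two numbers at
        distance \<open>\<kappa>\<close> by at least half that distance.\<close>
      have "\<kappa> / 2 \<le> \<bar>reflected a z N - \<psi> z\<bar> \<or> \<kappa> / 2 \<le> \<bar>reflected a z' N - \<psi> z'\<bar>"
        unfolding rx same using gap(3) by linarith
      moreover have "1 \<le> reflected a z N" "1 \<le> reflected a z' N" unfolding rx using gap(1,2) by auto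
      ultimately have "z \<in> Q \<or> z' \<in> Q" unfolding Q_def mem_Collect_eq using fsp by blast
      then show "y \<in> (?f -` (Q \<inter> C k) \<inter> space ?P) \<union> (?f' -` (Q \<inter> C k) \<inter> space ?P)"
        unfolding Un_iff Int_iff vimage_eq z_def[symmetric] z'_def[symmetric] using inC y(1) by blast
    qed
    then have "prob (A k) \<le> prob ((?f -` (Q \<inter> C k) \<inter> space ?P) \<union> (?f' -` (Q \<inter> C k) \<inter> space ?P))"
      by (intro finite_measure_mono sets.Un measurable_sets[OF fm(1) QC] measurable_sets[OF fm(2) QC])
    also have "\<dots> \<le> prob (?f -` (Q \<inter> C k) \<inter> space ?P) + prob (?f' -` (Q \<inter> C k) \<inter> space ?P)"
      by (intro measure_Un_le measurable_sets[OF fm(1) QC] measurable_sets[OF fm(2) QC])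
    finally show ?thesis using p p' by simp
  qed
  have "{y \<in> space ?P. (\<exists>k\<le>r. good_walk a \<kappa> r L y k) \<and> good_excursion \<kappa> l (\<lambda>i. y (r * L + i))} = (\<Union>k\<in>{..r}. A k)"
    by (auto simp: A_def)
  then have "prob {y \<in> space ?P. (\<exists>k\<le>r. good_walk a \<kappa> r L y k) \<and> good_excursion \<kappa> l (\<lambda>i. y (r * L + i))} \<le> (\<Sum>k\<le>r. prob (A k))"
    using finite_measure_subadditive_finite[of "{..r}" A] Am by auto
  also have "\<dots> \<le> (\<Sum>k\<le>r. 2 * prob (Q \<inter> C k))" by (intro sum_mono half) auto
  also have "\<dots> = 2 * prob (\<Union>k\<in>{..r}. Q \<inter> C k)"
  proof -
    \<comment> \<open>A path lies in at most one \<open>C k\<close>, so summing over the insertion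
      blocks costs no factor of order \<open>r\<close>.\<close>
    have "disjoint_family_on (\<lambda>k. Q \<inter> C k) {..r}"
      unfolding disjoint_family_on_def C_def using first_argmin_unique by fastforce
    then have "prob (\<Union>k\<in>{..r}. Q \<inter> C k) = (\<Sum>k\<le>r. prob (Q \<inter> C k))"
      by (intro finite_measure_finite_Union) auto
    then show ?thesis by (simp add: sum_distrib_left)
  qed
  also have "\<dots> \<le> 2 * prob Q" by (intro mult_left_mono finite_measure_mono) auto
  finally show ?thesis unfolding Q_def .
qed

section \<open>Measurability and locality of the favourable events\<close>

lemma pred_good_walk:
  assumes "r * L \<le> N"
  shows "Measurable.pred (gauss_steps N \<sigma>) (\<lambda>y. \<exists>k\<le>r. good_walk a \<kappa> r L y k)"
proof -
  have jN: "j * L \<le> N" if "j \<le> r" for j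
    using mult_le_mono1[OF that, of L] assms by (rule order_trans)
  have "{y \<in> space (gauss_steps N \<sigma>). good_walk a \<kappa> r L y k} \<in> sets (gauss_steps N \<sigma>)" if "k \<le> r" for k
  proof -
    have "{y \<in> space (gauss_steps N \<sigma>). good_walk a \<kappa> r L y k} =
     {y \<in> space (gauss_steps N \<sigma>). ((\<forall>j\<in>{..<k}. (\<Sum>i<k * L. y i) < (\<Sum>i<j * L. y i)) \<and> (\<forall>j\<in>{..r}. (\<Sum>i<k * L. y i) \<le> (\<Sum>i<j * L. y i))) \<and>
      ((\<Sum>i<k * L. y i) \<le> - a \<and> 1 \<le> (\<Sum>i<r * L. y i) - (\<Sum>i<k * L. y i) \<and>
        (\<Sum>i<k * L. y i) - \<kappa> \<le> walk_min y (r * L))}"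
      using that by (auto simp: good_walk_def first_argmin_def)
    also have "\<dots> \<in> sets (gauss_steps N \<sigma>)"
      by (intro sets.sets_Collect_conj sets.sets_Collect_finite_All borel_measurable_less borel_measurable_le
          borel_measurable_const borel_measurable_diff measurable_walk jN) (use that in auto)
    finally show ?thesis .
  qed
  then have "{y \<in> space (gauss_steps N \<sigma>). \<exists>k\<in>{..r}. good_walk a \<kappa> r L y k} \<in> sets (gauss_steps N \<sigma>)"
    by (intro sets.sets_Collect_finite_Ex) auto
  moreover have "(\<exists>k\<in>{..r}. Q k) \<longleftrightarrow> (\<exists>k\<le>r. Q k)" for Q by auto
  ultimately show ?thesis unfolding pred_def by (simp only:)
qed

lemma good_walk_cong:
  assumes "\<And>i. i < r * L \<Longrightarrow> x i = y i" "k \<le> r"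
  shows "good_walk a \<kappa> r L x k = good_walk a \<kappa> r L y k"
proof -
  have S: "(\<Sum>i<j * L. x i) = (\<Sum>i<j * L. y i)" if "j \<le> r" for j
  proof (intro sum.cong refl assms(1))
    fix i assume "i \<in> {..<j * L}"
    then have "i < j * L" by simp
    then show "i < r * L" using mult_le_mono1[OF that, of L] by (rule less_le_trans)
  qed
  have "first_argmin r (\<lambda>j. \<Sum>i<j * L. x i) k = first_argmin r (\<lambda>j. \<Sum>i<j * L. y i) k"
    by (rule first_argmin_cong) (rule S)
  moreover have "walk_min x (r * L) = walk_min y (r * L)" by (rule walk_min_cong) (rule assms(1))
  ultimately show ?thesis unfolding good_walk_def by (simp only: S[OF assms(2)] S[OF order_refl])
qed

lemma sum_shift_ivl: "(\<Sum>i=p..<q. f (m + i)) = (\<Sum>i\<in>{m + p..<m + q}. f i :: real)" for m p q :: nat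
  using sum.shift_bounds_nat_ivl[of f p m q] by (simp add: add.commute)

lemma good_excursion_shift:
  "good_excursion \<kappa> l (\<lambda>i. y (m + i)) \<longleftrightarrow>
    4 * \<kappa> \<le> (\<Sum>i\<in>{m..<m + l}. y i) \<and> (\<Sum>i\<in>{m + l..<m + (l + l)}. y i) \<in> {- 4 * \<kappa>..- 2 * \<kappa>}"
proof -
  have "(\<Sum>i<l. y (m + i)) = (\<Sum>i\<in>{m..<m + l}. y i)"
    using sum_shift_ivl[of y m 0 l] by (simp add: lessThan_atLeast0)
  then show ?thesis unfolding good_excursion_def sum_shift_ivl by simp
qed

lemma pred_good_excursion:
  assumes "m + (l + l) \<le> N"
  shows "Measurable.pred (PiM {m..<N} (\<lambda>_. borel)) (\<lambda>y. good_excursion \<kappa> l (\<lambda>i. y (m + i)))"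
proof -
  have *: "(\<lambda>y. \<Sum>i\<in>J. y i :: real) \<in> borel_measurable (PiM {m..<N} (\<lambda>_. borel))" if "J \<subseteq> {m..<N}" for J
    by (intro borel_measurable_sum measurable_component_singleton) (use that in auto)
  have sub: "{m..<m + l} \<subseteq> {m..<N}" "{m + l..<m + (l + l)} \<subseteq> {m..<N}" using assms by auto
  note [measurable] = *[OF sub(1)] *[OF sub(2)]
  show ?thesis unfolding good_excursion_shift by measurable
qed

lemma good_excursion_restrict:
  assumes "m + (l + l) \<le> N"
  shows "good_excursion \<kappa> l (\<lambda>i. restrict y {m..<N} (m + i)) = good_excursion \<kappa> l (\<lambda>i. y (m + i))"
proof -
  have "(\<Sum>i<l. restrict y {m..<N} (m + i)) = (\<Sum>i<l. y (m + i))"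
    "(\<Sum>i=l..<l + l. restrict y {m..<N} (m + i)) = (\<Sum>i=l..<l + l. y (m + i))"
    using assms by (auto intro!: sum.cong)
  then show ?thesis by (simp only: good_excursion_def)
qed

section \<open>Lower bounds for the favourable events\<close>

lemma prob_normal_interval:
  assumes "\<sigma> > 0" "J \<subseteq> {..<N}" "J \<noteq> {}"
    and "\<And>z. z \<in> {\<alpha>..\<beta>} \<Longrightarrow> p (\<sigma> * sqrt (card J) * z)"
    and "{x \<in> space (gauss_steps N \<sigma>). p (\<Sum>i\<in>J. x i)} \<in> sets (gauss_steps N \<sigma>)"
  shows "measure (density lborel std_normal_density) {\<alpha>..\<beta>} \<le>
    measure (gauss_steps N \<sigma>) {x \<in> space (gauss_steps N \<sigma>). p (\<Sum>i\<in>J. x i)}"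
proof -
  interpret prob_space "gauss_steps N \<sigma>" using assms by (simp add: prob_space_gauss_steps)
  let ?s = "\<sigma> * sqrt (card J)"
  have "card J > 0" using assms finite_subset[OF assms(2)] by (simp add: card_gt_0_iff)
  then have s: "?s > 0" using assms by simp
  have "prob {x \<in> space (gauss_steps N \<sigma>). (\<Sum>i\<in>J. x i) / ?s \<in> {\<alpha>..\<beta>}} = measure (density lborel std_normal_density) {\<alpha>..\<beta>}"
    by (rule normal_scaled_prob[OF gauss_steps_block_sum[OF assms(1-3)] s]) simp
  moreover have "prob {x \<in> space (gauss_steps N \<sigma>). (\<Sum>i\<in>J. x i) / ?s \<in> {\<alpha>..\<beta>}} \<le> prob {x \<in> space (gauss_steps N \<sigma>). p (\<Sum>i\<in>J. x i)}"
  proof (rule finite_measure_mono[OF _ assms(5)], safe)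
    fix x assume "(\<Sum>i\<in>J. x i) / ?s \<in> {\<alpha>..\<beta>}"
    from assms(4)[OF this] have "p (?s * ((\<Sum>i\<in>J. x i) / ?s))" .
    moreover have "t * (u / t) = u" if "t > 0" for t u :: real using that by simp
    ultimately show "p (\<Sum>i\<in>J. x i)" using s by (simp only:)
  qed
  ultimately show ?thesis by simp
qed

text \<open>In units of the standard deviation \<open>\<sigma> * sqrt l\<close> of one half,
  \<open>\<kappa>\<close> becomes \<open>\<gamma>\<close>, so the lower bound depends on
  \<open>\<gamma>\<close> alone. Any interval of positive length above \<open>4 * \<gamma>\<close>
  would serve for the first half.\<close>

lemma prob_good_excursion:
  assumes "\<sigma> > 0" "l > 0" "\<kappa> > 0" "m + (l + l) \<le> N" and s: "\<sigma> * sqrt l * \<gamma> = \<kappa>"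
  defines "\<nu> \<equiv> density lborel std_normal_density"
  shows "measure \<nu> {4 * \<gamma>..4 * \<gamma> + 1} * measure \<nu> {- 4 * \<gamma>..- 2 * \<gamma>} \<le>
    measure (gauss_steps N \<sigma>) {y \<in> space (gauss_steps N \<sigma>). good_excursion \<kappa> l (\<lambda>i. y (m + i))}"
proof -
  let ?P = "gauss_steps N \<sigma>"
  let ?A = "{m..<m + l}" and ?B = "{m + l..<m + (l + l)}"
  define p where "p x \<longleftrightarrow> 4 * \<kappa> \<le> (\<Sum>i\<in>?A. x i)" for x :: "nat \<Rightarrow> real"
  define q where "q x \<longleftrightarrow> (\<Sum>i\<in>?B. x i) \<in> {- 4 * \<kappa>..- 2 * \<kappa>}" for x :: "nat \<Rightarrow> real"
  have pm: "Measurable.pred (PiM ?A (\<lambda>_. borel)) p" and qm: "Measurable.pred (PiM ?B (\<lambda>_. borel)) q"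
    unfolding p_def q_def by measurable
  have loc: "p (restrict x ?A) = p x" "q (restrict x ?B) = q x" for x by (simp_all add: p_def q_def)
  have sub: "?A \<inter> ?B = {}" "?A \<subseteq> {..<N}" "?B \<subseteq> {..<N}" using assms(4) by auto
  have subB: "?B \<inter> ?A = {}" by auto
  note ind = gauss_steps_indep_events[OF assms(1) sub pm loc(1) qm loc(2)]
  note ind' = gauss_steps_indep_events[OF assms(1) subB sub(3,2) qm loc(2) pm loc(1)]
  have l: "\<sigma> * sqrt l > 0" using assms by simp
  have e: "\<sigma> * sqrt l * (c * \<gamma>) = c * \<kappa>" for c using s by (simp add: mult_ac)
  have "measure \<nu> {4 * \<gamma>..4 * \<gamma> + 1} \<le> measure ?P {x \<in> space ?P. 4 * \<kappa> \<le> (\<Sum>i\<in>?A. x i)}"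
    unfolding \<nu>_def
  proof (rule prob_normal_interval[OF assms(1) sub(2)])
    fix z assume "z \<in> {4 * \<gamma>..4 * \<gamma> + 1}"
    then have "\<sigma> * sqrt l * (4 * \<gamma>) \<le> \<sigma> * sqrt l * z" using l by (intro mult_left_mono) auto
    then show "4 * \<kappa> \<le> \<sigma> * sqrt (card ?A) * z" unfolding e by simp
  qed (use ind(1) assms(2) in \<open>auto simp: p_def\<close>)
  moreover have "measure \<nu> {- 4 * \<gamma>..- 2 * \<gamma>} \<le> measure ?P {x \<in> space ?P. (\<Sum>i\<in>?B. x i) \<in> {- 4 * \<kappa>..- 2 * \<kappa>}}"
    unfolding \<nu>_def
  proof (rule prob_normal_interval[OF assms(1) sub(3)])
    fix z assume "z \<in> {- 4 * \<gamma>..- 2 * \<gamma>}"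
    then have "\<sigma> * sqrt l * (- 4 * \<gamma>) \<le> \<sigma> * sqrt l * z" "\<sigma> * sqrt l * z \<le> \<sigma> * sqrt l * (- 2 * \<gamma>)"
      using l by (intro mult_left_mono; simp)+
    then show "\<sigma> * sqrt (card ?B) * z \<in> {- 4 * \<kappa>..- 2 * \<kappa>}" unfolding e by simp
  qed (use ind'(1) assms(2) in \<open>auto simp: q_def\<close>)
  ultimately have "measure \<nu> {4 * \<gamma>..4 * \<gamma> + 1} * measure \<nu> {- 4 * \<gamma>..- 2 * \<gamma>} \<le>
      measure ?P {x \<in> space ?P. p x} * measure ?P {x \<in> space ?P. q x}"
    unfolding p_def q_def by (intro mult_mono) auto
  also have "\<dots> = measure ?P {x \<in> space ?P. p x \<and> q x}" using ind(2) by simp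
  also have "(\<lambda>x. p x \<and> q x) = (\<lambda>y. good_excursion \<kappa> l (\<lambda>i. y (m + i)))"
    by (simp only: p_def q_def good_excursion_shift)
  finally show ?thesis .
qed

text \<open>The first \<open>n\<close> of the \<open>3 * n\<close> blocks bring the walk to
  \<open>- a\<close>, the following ones lift it by \<open>1\<close>, and these events are
  independent. Each has a normal sum with standard deviation at least \<open>1 / sqrt 3\<close>, the
  source of the factors \<open>sqrt 3\<close>. The subtracted \<open>1 / \<kappa>\<close> is
  Markov's bound for a fine walk that falls too far below its coarse minimum.\<close>

lemma prob_good_walk:
  fixes n L :: nat and a \<kappa> :: real
  assumes "n > 0" "L > 0" "a \<ge> 0" "\<kappa> > 0"
  defines "\<nu> \<equiv> density lborel std_normal_density" and "N \<equiv> 3 * n * L"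
  shows "measure \<nu> {- a * sqrt 3 - 1..- a * sqrt 3} * measure \<nu> {sqrt 3..sqrt 3 + 1} - 1 / \<kappa> \<le>
    measure (gauss_steps N (1 / sqrt N)) {y \<in> space (gauss_steps N (1 / sqrt N)).
      \<exists>k\<le>3 * n - 1. good_walk a (\<kappa> / sqrt (3 * n)) (3 * n - 1) L y k}"
proof -
  let ?\<sigma> = "1 / sqrt N" and ?r = "3 * n - 1"
  let ?P = "gauss_steps N ?\<sigma>"
  define \<kappa>' where "\<kappa>' = \<kappa> / sqrt (3 * n)"
  have N: "N > 0" using assms by simp
  then have \<sigma>: "?\<sigma> > 0" by simp
  interpret prob_space ?P using \<sigma> by (rule prob_space_gauss_steps)
  let ?A = "{..<n * L}" and ?B = "{n * L..<?r * L}"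
  have nr: "n < ?r" using assms by simp
  have rN: "?r * L \<le> N" unfolding N_def by (intro mult_le_mono1) simp
  have nL: "n * L < ?r * L" using nr assms by simp
  define p where "p x \<longleftrightarrow> (\<Sum>i\<in>?A. x i) \<le> - a" for x :: "nat \<Rightarrow> real"
  define q where "q x \<longleftrightarrow> 1 \<le> (\<Sum>i\<in>?B. x i)" for x :: "nat \<Rightarrow> real"
  have pm: "Measurable.pred (PiM ?A (\<lambda>_. borel)) p" and qm: "Measurable.pred (PiM ?B (\<lambda>_. borel)) q"
    unfolding p_def q_def by measurable
  have loc: "p (restrict x ?A) = p x" "q (restrict x ?B) = q x" for x by (simp_all add: p_def q_def)
  have sub: "?A \<inter> ?B = {}" "?A \<subseteq> {..<N}" "?B \<subseteq> {..<N}" using rN less_le_trans[OF nL rN] by auto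
  have subB: "?B \<inter> ?A = {}" by auto
  note ind = gauss_steps_indep_events[OF \<sigma> sub pm loc(1) qm loc(2)]
  note ind' = gauss_steps_indep_events[OF \<sigma> subB sub(3,2) qm loc(2) pm loc(1)]
  have sA: "?\<sigma> * sqrt (card ?A) = 1 / sqrt 3"
    using assms by (simp add: N_def real_sqrt_mult)
  \<comment> \<open>\<open>?B\<close> comprises \<open>2 * n - 1\<close> blocks, which is at least
    \<open>n\<close>, so its sum is spread at least as widely as that over
    \<open>?A\<close>.\<close>
  have sB: "1 / sqrt 3 \<le> ?\<sigma> * sqrt (card ?B)"
  proof -
    have "n * L \<le> card ?B" using assms by (simp add: diff_mult_distrib[symmetric])
    then have "card ?A \<le> card ?B" unfolding card_lessThan .
    then have "sqrt (card ?A) \<le> sqrt (card ?B)" by (simp only: real_sqrt_le_iff of_nat_le_iff)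
    then show ?thesis unfolding sA[symmetric] using \<sigma> by (intro mult_left_mono) auto
  qed
  have "measure \<nu> {- a * sqrt 3 - 1..- a * sqrt 3} \<le> measure ?P {x \<in> space ?P. (\<Sum>i\<in>?A. x i) \<le> - a}"
    unfolding \<nu>_def
  proof (rule prob_normal_interval[OF \<sigma> sub(2), where p = "\<lambda>s. s \<le> - a"])
    fix z assume "z \<in> {- a * sqrt 3 - 1..- a * sqrt 3}"
    then have "1 / sqrt 3 * z \<le> 1 / sqrt 3 * (- a * sqrt 3)" by (intro mult_left_mono) auto
    then show "?\<sigma> * sqrt (card ?A) * z \<le> - a" unfolding sA by simp
  next
    show "?A \<noteq> {}" using assms(1,2) by (simp add: lessThan_empty_iff)
  qed (use ind(1) in \<open>simp only: p_def\<close>)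
  moreover have "measure \<nu> {sqrt 3..sqrt 3 + 1} \<le> measure ?P {x \<in> space ?P. 1 \<le> (\<Sum>i\<in>?B. x i)}"
    unfolding \<nu>_def
  proof (rule prob_normal_interval[OF \<sigma> sub(3), where p = "\<lambda>s. 1 \<le> s"])
    fix z assume z: "z \<in> {sqrt 3..sqrt 3 + 1}"
    have "1 = 1 / sqrt 3 * sqrt 3" by simp
    also have "\<dots> \<le> ?\<sigma> * sqrt (card ?B) * z" using z sB by (intro mult_mono) (auto intro: order_trans[OF _ sB])
    finally show "1 \<le> ?\<sigma> * sqrt (card ?B) * z" .
  next
    show "?B \<noteq> {}" using nL by (simp only: atLeastLessThan_empty_iff not_le not_not)
  qed (use ind'(1) in \<open>simp only: q_def\<close>)
  ultimately have "measure \<nu> {- a * sqrt 3 - 1..- a * sqrt 3} * measure \<nu> {sqrt 3..sqrt 3 + 1} \<le>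
      prob {x \<in> space ?P. p x} * prob {x \<in> space ?P. q x}"
    unfolding p_def q_def by (intro mult_mono) auto
  also have "\<dots> = prob {x \<in> space ?P. p x \<and> q x}" using ind(2) by simp
  finally have U: "measure \<nu> {- a * sqrt 3 - 1..- a * sqrt 3} * measure \<nu> {sqrt 3..sqrt 3 + 1} \<le>
    prob {x \<in> space ?P. p x \<and> q x}" .
  define X where "X x j = (\<Sum>i\<in>{j * L..<Suc j * L}. x i)" for x :: "nat \<Rightarrow> real" and j
  define D where "D x = walk_min (X x) ?r - walk_min x (?r * L)" for x
  have n3: "0 < 3 * n" "?r < 3 * n" "3 * n \<le> Suc ?r" using assms by auto
  have E: "integrable ?P D" "expectation D \<le> 1 / sqrt (3 * n)"
    unfolding D_def[abs_def] X_def[abs_def] N_def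
    by (rule expectation_coarse_minus_fine[OF n3(1) assms(2) n3(2,3)])+
  have \<kappa>': "\<kappa>' > 0" using assms by (simp add: \<kappa>'_def)
  have D0: "0 \<le> D x" for x
  proof -
    obtain j where j: "j \<le> ?r" "walk_min (X x) ?r = (\<Sum>i<j. X x i)" using walk_min_attained by blast
    have "walk_min x (?r * L) \<le> (\<Sum>i<j * L. x i)" using j by (intro walk_min_le mult_le_mono1)
    then show ?thesis unfolding D_def j(2) X_def sum_blocks by simp
  qed
  have "prob {x \<in> space ?P. \<kappa>' \<le> D x} \<le> expectation D / \<kappa>'"
    using E(1) D0 \<kappa>' by (intro integral_Markov_inequality_measure[where A = "{}"]) auto
  also have "\<dots> \<le> (1 / sqrt (3 * n)) / \<kappa>'" using E(2) \<kappa>' by (intro divide_right_mono) auto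
  also have "\<dots> = 1 / \<kappa>" using assms by (simp add: \<kappa>'_def)
  finally have V: "prob {x \<in> space ?P. \<kappa>' \<le> D x} \<le> 1 / \<kappa>" .
  let ?G = "{y \<in> space ?P. \<exists>k\<le>?r. good_walk a \<kappa>' ?r L y k}"
  have Gm: "?G \<in> sets ?P" using pred_good_walk[OF rN] unfolding pred_def .
  have Dm: "{x \<in> space ?P. \<kappa>' \<le> D x} \<in> sets ?P"
    by (rule borel_measurable_le[OF borel_measurable_const borel_measurable_integrable[OF E(1)]])
  have "{x \<in> space ?P. p x \<and> q x} \<subseteq> ?G \<union> {x \<in> space ?P. \<kappa>' \<le> D x}"
  proof
    fix y assume "y \<in> {x \<in> space ?P. p x \<and> q x}"
    then have y': "y \<in> space ?P" "p y" "q y" by auto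
    show "y \<in> ?G \<union> {x \<in> space ?P. \<kappa>' \<le> D x}"
    proof (cases "\<kappa>' \<le> D y")
      case True
      then show ?thesis using y' by simp
    next
      case False
      note y = y'(2,3) False
      obtain k where k: "first_argmin ?r (\<lambda>j. \<Sum>i<j * L. y i) k" using first_argmin_exists by blast
      then have kr: "k \<le> ?r" and le: "\<And>j. j \<le> ?r \<Longrightarrow> (\<Sum>i<k * L. y i) \<le> (\<Sum>i<j * L. y i)"
        by (auto simp: first_argmin_def)
      have 1: "(\<Sum>i<k * L. y i) \<le> - a" using le[of n] nr y(1) by (simp add: p_def)
      have "{..<?r * L} = ?A \<union> ?B" by (rule ivl_disj_un_one(2)[OF less_imp_le[OF nL], symmetric])
      then have "(\<Sum>i<?r * L. y i) = (\<Sum>i\<in>?A. y i) + (\<Sum>i\<in>?B. y i)" by (simp add: sum.union_disjoint ivl_disj_int)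
      \<comment> \<open>The coarse minimum is no higher than the value after \<open>n\<close>
        blocks, from which the walk rises by at least \<open>1\<close>.\<close>
      then have 2: "1 \<le> (\<Sum>i<?r * L. y i) - (\<Sum>i<k * L. y i)" using le[of n] nr y(2) by (simp add: q_def)
      obtain j where j: "j \<le> ?r" "walk_min (X y) ?r = (\<Sum>i<j. X y i)" using walk_min_attained by blast
      then have "walk_min (X y) ?r = (\<Sum>i<j * L. y i)" unfolding X_def sum_blocks by simp
      then have 3: "(\<Sum>i<k * L. y i) - \<kappa>' \<le> walk_min y (?r * L)" using le[OF j(1)] y(3) by (simp add: D_def)
      have "\<exists>k\<le>?r. good_walk a \<kappa>' ?r L y k" unfolding good_walk_def using k kr 1 2 3 by blast
      then show ?thesis using y'(1) by blast
    qed
  qed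
  then have "prob {x \<in> space ?P. p x \<and> q x} \<le> prob (?G \<union> {x \<in> space ?P. \<kappa>' \<le> D x})"
    by (intro finite_measure_mono sets.Un Gm Dm)
  also have "\<dots> \<le> prob ?G + prob {x \<in> space ?P. \<kappa>' \<le> D x}" by (rule measure_Un_le[OF Gm Dm])
  finally show ?thesis using U V unfolding \<kappa>'_def by linarith
qed

text \<open>The order of quantifiers matters: independence of \<open>l\<close> permits refining the
  grid at fixed \<open>n\<close>, and independence of \<open>n\<close> gives the rate.\<close>

lemma walk_lower_bound:
  fixes a :: real
  assumes "a \<ge> 0"
  shows "\<exists>c>0. \<exists>\<kappa>>0. \<forall>n l \<psi>. n > 0 \<longrightarrow> l > 0 \<longrightarrow>
    \<psi> \<in> borel_measurable (gauss_steps (3 * n * (l + l)) (1 / sqrt (real (3 * n * (l + l))))) \<longrightarrow>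
    (\<forall>x x'. (\<forall>j\<le>3 * n. (\<Sum>i<j * (l + l). x i) = (\<Sum>i<j * (l + l). x' i)) \<longrightarrow> \<psi> x = \<psi> x') \<longrightarrow>
    c \<le> measure (gauss_steps (3 * n * (l + l)) (1 / sqrt (real (3 * n * (l + l)))))
      {x \<in> space (gauss_steps (3 * n * (l + l)) (1 / sqrt (real (3 * n * (l + l))))).
        \<kappa> / sqrt n \<le> \<bar>reflected a x (3 * n * (l + l)) - \<psi> x\<bar> \<and> 1 \<le> reflected a x (3 * n * (l + l))}"
proof -
  define \<nu> where "\<nu> = density lborel (\<lambda>x. ennreal (std_normal_density x))"
  define c1 where "c1 = measure \<nu> {- a * sqrt 3 - 1..- a * sqrt 3} * measure \<nu> {sqrt 3..sqrt 3 + 1}"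
  have c1: "c1 > 0" unfolding c1_def \<nu>_def by (intro mult_pos_pos normal_measure_pos) auto
  \<comment> \<open>Markov's bound \<open>1 / \<kappa>\<close> then consumes exactly half of
    \<open>c1\<close>.\<close>
  define \<kappa> where "\<kappa> = 2 / c1"
  have \<kappa>: "\<kappa> > 0" using c1 by (simp add: \<kappa>_def)
  \<comment> \<open>With \<open>N = 6 * n * l\<close>, one half of the excursion has standard
    deviation \<open>1 / sqrt (6 * n)\<close>, so \<open>\<kappa> / sqrt (3 * n)\<close> amounts to
    \<open>sqrt 2 * \<kappa>\<close> of these units.\<close>
  define \<gamma> where "\<gamma> = sqrt 2 * \<kappa>"
  define c2 where "c2 = measure \<nu> {4 * \<gamma>..4 * \<gamma> + 1} * measure \<nu> {- 4 * \<gamma>..- 2 * \<gamma>}"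
  have \<gamma>: "\<gamma> > 0" using \<kappa> by (simp add: \<gamma>_def)
  have c2: "c2 > 0" unfolding c2_def \<nu>_def using \<gamma> by (intro mult_pos_pos normal_measure_pos) auto
  \<comment> \<open>The favourable events have probability at least \<open>c1 / 2 * c2\<close>, and
    the conflict argument retains half of it. It also halves the gap
    \<open>\<kappa> / sqrt (3 * n)\<close>.\<close>
  have main: "c1 / 4 * c2 \<le> measure (gauss_steps N (1 / sqrt (real N)))
      {x \<in> space (gauss_steps N (1 / sqrt (real N))).
        \<kappa> / (2 * sqrt 3) / sqrt n \<le> \<bar>reflected a x N - \<psi> x\<bar> \<and> 1 \<le> reflected a x N}"
    if "n > 0" "l > 0" and N: "N = 3 * n * (l + l)" and \<psi>m: "\<psi> \<in> borel_measurable (gauss_steps N (1 / sqrt (real N)))"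
      and \<psi>: "\<forall>x x'. (\<forall>j\<le>3 * n. (\<Sum>i<j * (l + l). x i) = (\<Sum>i<j * (l + l). x' i)) \<longrightarrow> \<psi> x = \<psi> x'"
    for n l N :: nat and \<psi>
  proof -
    let ?L = "l + l" and ?r = "3 * n - 1" and ?\<sigma> = "1 / sqrt (real N)"
    let ?P = "gauss_steps N ?\<sigma>"
    define \<kappa>' where "\<kappa>' = \<kappa> / sqrt (3 * n)"
    have \<kappa>': "\<kappa>' > 0" using \<kappa> that by (simp add: \<kappa>'_def)
    have N0: "N > 0" using that by simp
    then have \<sigma>: "?\<sigma> > 0" by simp
    interpret prob_space ?P using \<sigma> by (rule prob_space_gauss_steps)
    have r: "Suc ?r = 3 * n" using that by simp
    have N': "N = ?r * ?L + ?L" using r N by (metis add.commute mult_Suc)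
    have "sqrt (real N) = sqrt (3 * n) * (sqrt 2 * sqrt l)"
      by (simp add: N real_sqrt_mult[symmetric] mult_ac)
    then have s: "?\<sigma> * sqrt l * \<gamma> = \<kappa>'"
      using that(1,2) by (simp add: \<kappa>'_def \<gamma>_def)
    have exc: "c2 \<le> prob {y \<in> space ?P. good_excursion \<kappa>' l (\<lambda>i. y (?r * ?L + i))}"
      unfolding c2_def \<nu>_def
      by (rule prob_good_excursion[OF \<sigma> that(2) \<kappa>' _ s]) (simp add: N')
    have "c1 - 1 / \<kappa> \<le> prob {y \<in> space ?P. \<exists>k\<le>?r. good_walk a \<kappa>' ?r ?L y k}"
      unfolding c1_def \<nu>_def \<kappa>'_def N
      by (rule prob_good_walk[OF that(1) _ assms \<kappa>]) (use that in simp)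
    moreover have "1 / \<kappa> = c1 / 2" by (simp add: \<kappa>_def)
    ultimately have walk: "c1 / 2 \<le> prob {y \<in> space ?P. \<exists>k\<le>?r. good_walk a \<kappa>' ?r ?L y k}" by simp
    have "c1 / 2 * c2 \<le> prob {y \<in> space ?P. \<exists>k\<le>?r. good_walk a \<kappa>' ?r ?L y k} * prob {y \<in> space ?P. good_excursion \<kappa>' l (\<lambda>i. y (?r * ?L + i))}"
      using walk exc c1 c2 by (intro mult_mono) auto
    also have "\<dots> = prob {y \<in> space ?P. (\<exists>k\<le>?r. good_walk a \<kappa>' ?r ?L y k) \<and> good_excursion \<kappa>' l (\<lambda>i. y (?r * ?L + i))}"
    proof (rule gauss_steps_indep_events(2)[symmetric, OF \<sigma>, where A = "{..<?r * ?L}" and B = "{?r * ?L..<N}"])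
      show "{..<?r * ?L} \<inter> {?r * ?L..<N} = {}" "{..<?r * ?L} \<subseteq> {..<N}" "{?r * ?L..<N} \<subseteq> {..<N}"
      proof -
        have "?r * ?L \<le> N" unfolding N' by (rule le_add1)
        moreover have "{..<K} \<inter> {K..<N} = {}" "{..<K} \<subseteq> {..<N}" "{K..<N} \<subseteq> {..<N}" if "K \<le> N" for K
          using that by auto
        ultimately show "{..<?r * ?L} \<inter> {?r * ?L..<N} = {}" "{..<?r * ?L} \<subseteq> {..<N}" "{?r * ?L..<N} \<subseteq> {..<N}"
          by blast+
      qed
      show "Measurable.pred (PiM {..<?r * ?L} (\<lambda>_. borel)) (\<lambda>y. \<exists>k\<le>?r. good_walk a \<kappa>' ?r ?L y k)"
      proof -
        have "Measurable.pred (gauss_steps (?r * ?L) ?\<sigma>) (\<lambda>y. \<exists>k\<le>?r. good_walk a \<kappa>' ?r ?L y k)"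
          by (rule pred_good_walk[OF order_refl])
        then show ?thesis unfolding measurable_cong_sets[OF sets_gauss_steps refl] .
      qed
      show "(\<exists>k\<le>?r. good_walk a \<kappa>' ?r ?L (restrict x {..<?r * ?L}) k) = (\<exists>k\<le>?r. good_walk a \<kappa>' ?r ?L x k)" for x
      proof -
        have "restrict x {..<K} i = x i" if "i < K" for K i :: nat using that by simp
        then have "good_walk a \<kappa>' ?r ?L (restrict x {..<?r * ?L}) k = good_walk a \<kappa>' ?r ?L x k" if "k \<le> ?r" for k
          using that by (intro good_walk_cong) blast+
        then show ?thesis by blast
      qed
      show "Measurable.pred (PiM {?r * ?L..<N} (\<lambda>_. borel)) (\<lambda>y. good_excursion \<kappa>' l (\<lambda>i. y (?r * ?L + i)))"
        by (rule pred_good_excursion) (simp only: N')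
      show "good_excursion \<kappa>' l (\<lambda>i. restrict x {?r * ?L..<N} (?r * ?L + i)) = good_excursion \<kappa>' l (\<lambda>i. x (?r * ?L + i))" for x
        by (rule good_excursion_restrict) (simp only: N')
    qed
    also have "\<dots> \<le> 2 * prob {x \<in> space ?P. \<kappa>' / 2 \<le> \<bar>reflected a x N - \<psi> x\<bar> \<and> 1 \<le> reflected a x N}"
    proof (rule conflict_probability[of ?\<sigma> \<kappa>' l \<psi> ?r a, folded N', OF \<sigma> \<kappa>' that(2) \<psi>m])
      fix x x' :: "nat \<Rightarrow> real"
      assume "\<And>j. j \<le> Suc ?r \<Longrightarrow> (\<Sum>i<j * ?L. x i) = (\<Sum>i<j * ?L. x' i)"
      then show "\<psi> x = \<psi> x'" unfolding r using \<psi> by blast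
    qed
    finally have "c1 / 4 * c2 \<le> prob {x \<in> space ?P. \<kappa>' / 2 \<le> \<bar>reflected a x N - \<psi> x\<bar> \<and> 1 \<le> reflected a x N}"
      by simp
    moreover have "\<kappa>' / 2 = \<kappa> / (2 * sqrt 3) / sqrt n" by (simp add: \<kappa>'_def real_sqrt_mult)
    ultimately show ?thesis by simp
  qed
  have pos: "0 < c1 / 4 * c2" "0 < \<kappa> / (2 * sqrt 3)" using c1 c2 \<kappa> by simp_all
  show ?thesis
  proof (rule exI[of _ "c1 / 4 * c2"], rule conjI[OF pos(1)], rule exI[of _ "\<kappa> / (2 * sqrt 3)"],
      rule conjI[OF pos(2)], (rule allI)+, (rule impI)+, goal_cases)
    case (1 n l \<psi>)
    show ?case by (rule main[OF 1(1,2) refl 1(3,4)])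
  qed
qed

subsection \<open>Riemann sums of the stochastic integral\<close>

text \<open>Dominated convergence for indicators; through it, continuity of almost every path turns
  into convergence in probability.\<close>

lemma (in prob_space) prob_tendsto_0:
  assumes A: "\<And>N. A N \<in> events" and "AE \<omega> in M. \<forall>\<^sub>F N in sequentially. \<omega> \<notin> A N"
  shows "(\<lambda>N. prob (A N)) \<longlonglongrightarrow> 0"
proof -
  have "(\<lambda>N. \<integral>\<omega>. indicator (A N) \<omega> \<partial>M) \<longlonglongrightarrow> (\<integral>\<omega>. (0::real) \<partial>M)"
  proof (rule integral_dominated_convergence[where w = "\<lambda>_. 1"])
    show "AE \<omega> in M. (\<lambda>N. indicator (A N) \<omega> :: real) \<longlonglongrightarrow> 0"
      using assms(2)
    proof eventually_elim
      case (elim \<omega>)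
      then have "\<forall>\<^sub>F N in sequentially. (indicator (A N) \<omega> :: real) = 0"
        by eventually_elim simp
      then show ?case by (rule tendsto_eventually)
    qed
    show "(\<lambda>\<omega>. indicator (A N) \<omega> :: real) \<in> borel_measurable M" for N using A by simp
    show "AE \<omega> in M. norm (indicator (A N) \<omega> :: real) \<le> 1" for N by (simp add: indicator_def)
  qed auto
  then show ?thesis using A by simp
qed

lemma sum_strict_mono_telescope:
  fixes s :: "nat \<Rightarrow> real" and f :: "real \<Rightarrow> real"
  assumes s: "\<And>i j. i < j \<Longrightarrow> j \<le> m \<Longrightarrow> s i < s j" and "p \<le> r" "r \<le> m"
  shows "(\<Sum>i<m. indicator {s p<..s r} (s (Suc i)) * (f (s (Suc i)) - f (s i))) = f (s r) - f (s p)"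
proof -
  have "indicator {s p<..s r} (s (Suc i)) = (if i \<in> {p..<r} then 1 else 0 :: real)" if "i < m" for i
  proof -
    have "s p < s (Suc i) \<longleftrightarrow> p \<le> i"
      using s[of p "Suc i"] s[of "Suc i" p] order_trans[OF assms(2,3)] that
      by (cases p "Suc i" rule: linorder_cases) auto
    moreover have "s (Suc i) \<le> s r \<longleftrightarrow> i < r"
      using s[of r "Suc i"] s[of "Suc i" r] assms(3) that
      by (cases r "Suc i" rule: linorder_cases) auto
    ultimately show ?thesis by (auto simp: indicator_def)
  qed
  then have "(\<Sum>i<m. indicator {s p<..s r} (s (Suc i)) * (f (s (Suc i)) - f (s i))) =
      (\<Sum>i<m. if i \<in> {p..<r} then f (s (Suc i)) - f (s i) else 0)"
    by (intro sum.cong) auto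
  also have "\<dots> = (\<Sum>i\<in>{p..<r}. f (s (Suc i)) - f (s i))"
    using assms by (subst sum.inter_restrict[symmetric]) (auto intro!: sum.cong)
  also have "\<dots> = f (s r) - f (s p)" using sum_Suc_diff'[OF assms(2), of "\<lambda>i. f (s i)"] by simp
  finally show ?thesis .
qed

section \<open>Simple processes on a common refinement\<close>

context brownian_motion begin

text \<open>Unlike \<^const>\<open>simple_adapted\<close>, the coefficients may be unbounded.\<close>

definition step_adapted :: "'a simple_process \<Rightarrow> bool" where
  "step_adapted K \<longleftrightarrow> 0 \<le> knot K 0 \<and>
    (\<forall>i<pieces K. knot K i < knot K (Suc i) \<and> coef K i \<in> borel_measurable (F (knot K i)))"

lemma simple_adapted_step: "simple_adapted F K \<Longrightarrow> step_adapted K"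
  by (auto simp: simple_adapted_def step_adapted_def)

lemma knot_nonneg: "step_adapted K \<Longrightarrow> i \<le> pieces K \<Longrightarrow> 0 \<le> knot K i"
proof (induction i)
  case (Suc i)
  then show ?case unfolding step_adapted_def by (metis Suc_le_lessD less_imp_le order_trans Suc_leD)
qed (simp add: step_adapted_def)

text \<open>Knots beyond \<open>t\<close> may be missing from the grid, since the integral is
  stopped at \<open>t\<close>.\<close>

definition refines :: "(nat \<Rightarrow> real) \<Rightarrow> nat \<Rightarrow> real \<Rightarrow> 'a simple_process \<Rightarrow> bool" where
  "refines s m t K \<longleftrightarrow> s 0 = 0 \<and> s m = t \<and> (\<forall>i j. i < j \<longrightarrow> j \<le> m \<longrightarrow> s i < s j) \<and>
    (\<forall>q\<le>pieces K. knot K q \<le> t \<longrightarrow> (\<exists>p\<le>m. s p = knot K q))"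

lemma ex_common_refinement:
  assumes "step_adapted K" "step_adapted S" "0 \<le> t"
  shows "\<exists>s m. refines s m t K \<and> refines s m t S"
proof -
  define P where "P = {0, t} \<union> ((knot K ` {..pieces K} \<union> knot S ` {..pieces S}) \<inter> {0..t})"
  define xs where "xs = sorted_list_of_set P"
  have fin: "finite P" by (simp add: P_def)
  have xs: "set xs = P" "sorted_wrt (<) xs" using fin by (simp_all add: xs_def)
  have ne: "xs \<noteq> []" using xs(1) by (auto simp: P_def)
  define m where "m = length xs - 1"
  have len: "length xs = Suc m" using ne by (simp add: m_def)
  have mono: "xs ! i < xs ! j" if "i < j" "j \<le> m" for i j
    using sorted_wrt_nth_less[OF xs(2), of i j] that len by simp
  have range: "0 \<le> x" "x \<le> t" if "x \<in> set xs" for x using that assms(3) unfolding xs(1) P_def by auto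
  have nth: "\<exists>p\<le>m. xs ! p = x" if "x \<in> P" for x
    using that len unfolding xs(1)[symmetric] in_set_conv_nth by (metis less_Suc_eq_le)
  have "xs ! 0 = 0"
  proof -
    obtain p where "p \<le> m" "xs ! p = 0" using nth[of 0] by (auto simp: P_def)
    then show ?thesis using mono[of 0 p] range(1)[of "xs ! 0"] len by (cases "p = 0") auto
  qed
  moreover have "xs ! m = t"
  proof -
    obtain p where "p \<le> m" "xs ! p = t" using nth[of t] by (auto simp: P_def)
    then show ?thesis using mono[of p m] range(2)[of "xs ! m"] len by (cases "p = m") auto
  qed
  moreover have "\<exists>p\<le>m. xs ! p = knot K q" if "q \<le> pieces K" "knot K q \<le> t" for q
    using that knot_nonneg[OF assms(1)] by (intro nth) (auto simp: P_def)
  moreover have "\<exists>p\<le>m. xs ! p = knot S q" if "q \<le> pieces S" "knot S q \<le> t" for q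
    using that knot_nonneg[OF assms(2)] by (intro nth) (auto simp: P_def)
  ultimately show ?thesis using mono unfolding refines_def by (intro exI[of _ "\<lambda>i. xs ! i"] exI[of _ m]) auto
qed

lemma refines_knot_le:
  assumes "refines s m t K" "q \<le> pieces K" "i < m" "knot K q < s (Suc i)"
  shows "knot K q \<le> s i"
proof -
  have s: "\<And>i j. i < j \<Longrightarrow> j \<le> m \<Longrightarrow> s i < s j" using assms by (auto simp: refines_def)
  have "s (Suc i) \<le> t" using s[of "Suc i" m] assms by (cases "Suc i = m") (auto simp: refines_def)
  then have "knot K q \<le> t" using assms(4) by simp
  then obtain p where p: "p \<le> m" "s p = knot K q" using assms(1,2) unfolding refines_def by blast
  have "\<not> Suc i \<le> p"
  proof
    assume "Suc i \<le> p"
    then have "s (Suc i) \<le> s p" using s[of "Suc i" p] p(1) by (cases "Suc i = p") auto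
    then show False using p(2) assms(4) by simp
  qed
  then have "s p \<le> s i" using s[of p i] assms(3) by (cases "p = i") auto
  then show ?thesis using p(2) by simp
qed

text \<open>The pieces of a simple process are open on the left, so its value on a cell is read at
  the right end \<open>s (Suc i)\<close>.\<close>

lemma simple_integral_refined:
  assumes "step_adapted K" "refines s m t K"
  shows "simple_integral W K t \<omega> = (\<Sum>i<m. simple_value K (s (Suc i)) \<omega> * (W (s (Suc i)) \<omega> - W (s i) \<omega>))"
proof -
  have s: "\<And>i j. i < j \<Longrightarrow> j \<le> m \<Longrightarrow> s i < s j" and sm: "s m = t" using assms by (auto simp: refines_def)
  have le_t: "s (Suc i) \<le> t" if "i < m" for i
    using s[of "Suc i" m] that sm by (cases "Suc i = m") auto
  have mem: "\<exists>p\<le>m. s p = min (knot K q) t" if "q \<le> pieces K" for q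
    using assms(2) that unfolding refines_def by (cases "knot K q \<le> t") (auto simp: min_def)
  have "simple_integral W K t \<omega> = (\<Sum>q<pieces K. coef K q \<omega> * (\<Sum>i<m. indicator {knot K q<..knot K (Suc q)} (s (Suc i)) * (W (s (Suc i)) \<omega> - W (s i) \<omega>)))"
    unfolding simple_integral_def
  proof (intro sum.cong refl arg_cong2[where f = "(*)"])
    fix q assume "q \<in> {..<pieces K}"
    then have q: "q < pieces K" "Suc q \<le> pieces K" by auto
    then have kk: "knot K q < knot K (Suc q)" using assms(1) by (auto simp: step_adapted_def)
    obtain p where p: "p \<le> m" "s p = min (knot K q) t" using mem[of q] q by auto
    obtain r where r: "r \<le> m" "s r = min (knot K (Suc q)) t" using mem[of "Suc q"] q by auto
    have "s p \<le> s r" using p r kk by (auto simp: min_def)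
    then have "p \<le> r" using s[of r p] p by (meson not_le)
    have "indicator {knot K q<..knot K (Suc q)} (s (Suc i)) = (indicator {s p<..s r} (s (Suc i)) :: real)" if "i < m" for i
      unfolding p(2) r(2) using le_t[OF that] by (auto simp: indicator_def min_def)
    then have "(\<Sum>i<m. indicator {knot K q<..knot K (Suc q)} (s (Suc i)) * (W (s (Suc i)) \<omega> - W (s i) \<omega>)) =
        (\<Sum>i<m. indicator {s p<..s r} (s (Suc i)) * (W (s (Suc i)) \<omega> - W (s i) \<omega>))"
      by (intro sum.cong) auto
    also have "\<dots> = W (s r) \<omega> - W (s p) \<omega>"
      using sum_strict_mono_telescope[OF s \<open>p \<le> r\<close> r(1), where f = "\<lambda>x. W x \<omega>"] by simp
    finally show "W (min (knot K (Suc q)) t) \<omega> - W (min (knot K q) t) \<omega> =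
      (\<Sum>i<m. indicator {knot K q<..knot K (Suc q)} (s (Suc i)) * (W (s (Suc i)) \<omega> - W (s i) \<omega>))"
      unfolding p(2) r(2) by simp
  qed
  also have "\<dots> = (\<Sum>i<m. \<Sum>q<pieces K. coef K q \<omega> * indicator {knot K q<..knot K (Suc q)} (s (Suc i)) * (W (s (Suc i)) \<omega> - W (s i) \<omega>))"
    unfolding sum_distrib_left by (subst sum.swap) (simp add: mult.assoc)
  finally show ?thesis unfolding simple_value_def sum_distrib_right .
qed

text \<open>Although the value is read at the right end of a cell, no knot lies inside the cell, so
  each coefficient active there is already known at the left end.\<close>

lemma simple_value_adapted:
  assumes "step_adapted K" "refines s m t K" "i < m"
  shows "simple_value K (s (Suc i)) \<in> borel_measurable (F (s i))"
  unfolding simple_value_def[abs_def]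
proof (intro borel_measurable_sum)
  fix q assume "q \<in> {..<pieces K}"
  then have q: "q < pieces K" by simp
  show "(\<lambda>\<omega>. coef K q \<omega> * indicator {knot K q<..knot K (Suc q)} (s (Suc i))) \<in> borel_measurable (F (s i))"
  proof (cases "knot K q < s (Suc i)")
    case True
    then have "knot K q \<le> s i" using refines_knot_le[OF assms(2) _ assms(3)] q by simp
    then have "coef K q \<in> borel_measurable (F (s i))"
      using assms(1) q measurable_F_mono[of "coef K q" "knot K q" borel "s i"] by (auto simp: step_adapted_def)
    then show ?thesis by (intro borel_measurable_times borel_measurable_const)
  qed simp
qed

lemma simple_value_const:
  assumes "refines s m t K" "i < m" "s i < u" "u \<le> s (Suc i)"
  shows "simple_value K u \<omega> = simple_value K (s (Suc i)) \<omega>"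
proof -
  have "knot K q < u \<longleftrightarrow> knot K q < s (Suc i)" if "q \<le> pieces K" for q
    using refines_knot_le[OF assms(1) that assms(2)] assms(3,4) by (meson le_less_trans less_le_trans)
  then have "indicator {knot K q<..knot K (Suc q)} u = (indicator {knot K q<..knot K (Suc q)} (s (Suc i)) :: real)" if "q < pieces K" for q
    using that by (auto simp: indicator_def not_less[symmetric])
  then show ?thesis unfolding simple_value_def by (intro sum.cong) auto
qed

lemma step_sum_le_nn_integral:
  assumes "refines s m t K" "refines s m t S"
  shows "ennreal (\<Sum>i<m. (simple_value K (s (Suc i)) \<omega> - simple_value S (s (Suc i)) \<omega>)\<^sup>2 * (s (Suc i) - s i)) \<le>
    (\<integral>\<^sup>+ u\<in>{0..t}. ennreal ((simple_value K u \<omega> - simple_value S u \<omega>)\<^sup>2) \<partial>lborel)"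
proof -
  have s: "\<And>i j. i < j \<Longrightarrow> j \<le> m \<Longrightarrow> s i < s j" and sm: "s m = t" and s0: "s 0 = 0" using assms by (auto simp: refines_def)
  let ?c = "\<lambda>i. (simple_value K (s (Suc i)) \<omega> - simple_value S (s (Suc i)) \<omega>)\<^sup>2"
  let ?I = "\<lambda>i. {s i<..s (Suc i)}"
  have d: "0 \<le> s (Suc i) - s i" if "i < m" for i using s[of i "Suc i"] that by simp
  have "ennreal (\<Sum>i<m. ?c i * (s (Suc i) - s i)) = (\<Sum>i<m. ennreal (?c i) * emeasure lborel (?I i))"
    using d by (subst sum_ennreal[symmetric]) (auto simp: ennreal_mult intro!: sum.cong)
  also have "\<dots> = (\<Sum>i<m. \<integral>\<^sup>+ u. ennreal (?c i) * indicator (?I i) u \<partial>lborel)"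
    by (simp add: nn_integral_cmult_indicator)
  also have "\<dots> = (\<integral>\<^sup>+ u. (\<Sum>i<m. ennreal (?c i) * indicator (?I i) u) \<partial>lborel)"
    by (rule nn_integral_sum[symmetric]) simp
  also have "\<dots> \<le> (\<integral>\<^sup>+ u\<in>{0..t}. ennreal ((simple_value K u \<omega> - simple_value S u \<omega>)\<^sup>2) \<partial>lborel)"
  proof (rule nn_integral_mono)
    fix u
    show "(\<Sum>i<m. ennreal (?c i) * indicator (?I i) u) \<le> ennreal ((simple_value K u \<omega> - simple_value S u \<omega>)\<^sup>2) * indicator {0..t} u"
    proof (cases "\<exists>i<m. u \<in> ?I i")
      case True
      then obtain i where i: "i < m" "u \<in> ?I i" by auto
      have "u \<notin> ?I j" if "j < m" "j \<noteq> i" for j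
      proof (cases "j < i")
        case True
        then show ?thesis using s[of "Suc j" i] i by (cases "Suc j = i") auto
      next
        case False
        then have "i < j" using that by simp
        then show ?thesis using s[of "Suc i" j] i that by (cases "Suc i = j") auto
      qed
      then have "(\<Sum>i<m. ennreal (?c i) * indicator (?I i) u) = (\<Sum>j<m. if j = i then ennreal (?c i) else 0)"
        using i by (intro sum.cong) auto
      also have "\<dots> = ennreal (?c i)" using i by simp
      also have "?c i = (simple_value K u \<omega> - simple_value S u \<omega>)\<^sup>2"
        using simple_value_const[OF assms(1) i(1), of u \<omega>] simple_value_const[OF assms(2) i(1), of u \<omega>] i by simp
      also have "u \<in> {0..t}"
        using i s[of 0 i] s[of "Suc i" m] s0 sm by (cases "i = 0"; cases "Suc i = m") auto
      ultimately show ?thesis by simp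
    next
      case False
      then have "(\<Sum>i<m. ennreal (?c i) * indicator (?I i) u) = (\<Sum>i<m. 0)" by (intro sum.cong) auto
      then show ?thesis by simp
    qed
  qed
  finally show ?thesis .
qed

text \<open>Over a common refinement the difference of the integrals is one adapted sum. Its
  quadratic sum is dominated by the pathwise squared distance of the processes, which is at most
  \<open>b\<close> outside \<open>B\<close>.\<close>

lemma simple_integral_diff_tail:
  assumes K: "step_adapted K" and S: "step_adapted S" and "0 \<le> t" "\<alpha> > 0" "b \<ge> 0"
    and B: "B \<in> events" "\<And>\<omega>. \<omega> \<in> space M - B \<Longrightarrow>
      (\<integral>\<^sup>+ u\<in>{0..t}. ennreal ((simple_value K u \<omega> - simple_value S u \<omega>)\<^sup>2) \<partial>lborel) \<le> ennreal b"
  shows "prob {\<omega>\<in>space M. \<bar>simple_integral W K t \<omega> - simple_integral W S t \<omega>\<bar> > \<alpha>} \<le> prob B + b / \<alpha>\<^sup>2"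
proof -
  obtain s m where r: "refines s m t K" "refines s m t S" using ex_common_refinement[OF K S assms(3)] by blast
  let ?c = "\<lambda>i \<omega>. simple_value K (s (Suc i)) \<omega> - simple_value S (s (Suc i)) \<omega>"
  have s: "0 \<le> s 0" "\<And>i. i < m \<Longrightarrow> s i < s (Suc i)" using r by (auto simp: refines_def)
  have c: "?c i \<in> borel_measurable (F (s i))" if "i < m" for i
    by (intro borel_measurable_diff simple_value_adapted[OF K r(1) that] simple_value_adapted[OF S r(2) that])
  have "prob {\<omega>\<in>space M. \<bar>\<Sum>i<m. ?c i \<omega> * (W (s (Suc i)) \<omega> - W (s i) \<omega>)\<bar> > \<alpha>} \<le>
      prob {\<omega>\<in>space M. (\<Sum>i<m. (?c i \<omega>)\<^sup>2 * (s (Suc i) - s i)) > b} + b / \<alpha>\<^sup>2"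
    by (rule discrete_integral_tail[OF s c assms(4,5)])
  also have "prob {\<omega>\<in>space M. (\<Sum>i<m. (?c i \<omega>)\<^sup>2 * (s (Suc i) - s i)) > b} \<le> prob B"
  proof (rule finite_measure_mono[OF _ B(1)], safe)
    fix \<omega> assume w: "\<omega> \<in> space M" "(\<Sum>i<m. (?c i \<omega>)\<^sup>2 * (s (Suc i) - s i)) > b"
    have "\<not> ennreal (\<Sum>i<m. (?c i \<omega>)\<^sup>2 * (s (Suc i) - s i)) \<le> ennreal b"
      using w assms(5) by (simp add: not_le ennreal_lessI)
    then show "\<omega> \<in> B" using step_sum_le_nn_integral[OF r, of \<omega>] B(2)[of \<omega>] w(1) by (meson DiffI order_trans)
  qed
  finally have "prob {\<omega>\<in>space M. \<bar>\<Sum>i<m. ?c i \<omega> * (W (s (Suc i)) \<omega> - W (s i) \<omega>)\<bar> > \<alpha>} \<le> prob B + b / \<alpha>\<^sup>2"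
    by simp
  moreover have "simple_integral W K t \<omega> - simple_integral W S t \<omega> = (\<Sum>i<m. ?c i \<omega> * (W (s (Suc i)) \<omega> - W (s i) \<omega>))" for \<omega>
    unfolding simple_integral_refined[OF K r(1)] simple_integral_refined[OF S r(2)]
    by (simp only: sum_subtractf left_diff_distrib)
  ultimately show ?thesis by (simp only:)
qed

end

section \<open>Joint measurability in time and outcome\<close>

context brownian_motion begin

lemma time_section_measurable:
  fixes G :: "real \<Rightarrow> 'a \<Rightarrow> real"
  assumes "(\<lambda>(s, \<omega>). G s \<omega>) \<in> borel_measurable (restrict_space borel {0..t} \<Otimes>\<^sub>M M)" "\<omega> \<in> space M"
  shows "(\<lambda>s. ennreal ((G s \<omega>)\<^sup>2) * indicator {0..t} s) \<in> borel_measurable lborel"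
proof -
  have "(\<lambda>s. (s, \<omega>)) \<in> measurable (restrict_space borel {0..t}) (restrict_space borel {0..t} \<Otimes>\<^sub>M M)"
    using assms(2) by simp
  from measurable_compose[OF this assms(1)]
  have "(\<lambda>s. G s \<omega>) \<in> borel_measurable (restrict_space borel {0..t})" by simp
  then have "(\<lambda>s. ennreal ((G s \<omega>)\<^sup>2)) \<in> borel_measurable (restrict_space borel {0..t})" by measurable
  then show ?thesis by (subst (asm) borel_measurable_restrict_space_iff_ennreal) auto
qed

lemma time_integral_measurable:
  fixes G :: "real \<Rightarrow> 'a \<Rightarrow> real"
  assumes "(\<lambda>(s, \<omega>). G s \<omega>) \<in> borel_measurable (restrict_space borel {0..t} \<Otimes>\<^sub>M M)"
  shows "(\<lambda>\<omega>. \<integral>\<^sup>+ s\<in>{0..t}. ennreal ((G s \<omega>)\<^sup>2) \<partial>lborel) \<in> borel_measurable M"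
proof -
  let ?R = "restrict_space lborel {0..t::real}"
  interpret R: sigma_finite_measure ?R
    by (intro sigma_finite_measure_restrict_space lborel.sigma_finite_measure_axioms) simp
  have "sets (?R \<Otimes>\<^sub>M M) = sets (restrict_space borel {0..t} \<Otimes>\<^sub>M M)"
    by (intro sets_pair_measure_cong) (auto simp: sets_restrict_space)
  then have "(\<lambda>(s, \<omega>). G s \<omega>) \<in> borel_measurable (?R \<Otimes>\<^sub>M M)"
    using assms by (simp add: measurable_cong_sets[of "?R \<Otimes>\<^sub>M M" "restrict_space borel {0..t} \<Otimes>\<^sub>M M"])
  from measurable_compose[OF measurable_pair_swap' this]
  have "(\<lambda>(\<omega>, s). G s \<omega>) \<in> borel_measurable (M \<Otimes>\<^sub>M ?R)" by (simp add: case_prod_beta')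
  then have "(\<lambda>(\<omega>, s). ennreal ((G s \<omega>)\<^sup>2)) \<in> borel_measurable (M \<Otimes>\<^sub>M ?R)"
    unfolding case_prod_beta' by measurable
  then have "(\<lambda>\<omega>. \<integral>\<^sup>+ s. ennreal ((G s \<omega>)\<^sup>2) \<partial>?R) \<in> borel_measurable M"
    by (rule R.borel_measurable_nn_integral)
  then show ?thesis by (simp add: nn_integral_restrict_space)
qed

lemma progressively_measurable_M:
  assumes "progressively_measurable F H" "0 \<le> t"
  shows "(\<lambda>(s, \<omega>). H s \<omega>) \<in> borel_measurable (restrict_space borel {0..t} \<Otimes>\<^sub>M M)"
proof -
  have "(\<lambda>\<omega>. \<omega>) \<in> measurable M (F t)" by (rule measurable_F_M) (rule measurable_ident_sets[OF refl])
  then have "(\<lambda>x. (fst x, snd x)) \<in> measurable (restrict_space borel {0..t} \<Otimes>\<^sub>M M) (restrict_space borel {0..t} \<Otimes>\<^sub>M F t)"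
    by (intro measurable_Pair measurable_fst measurable_compose[OF measurable_snd])
  moreover have "(\<lambda>(s, \<omega>). H s \<omega>) \<in> borel_measurable (restrict_space borel {0..t} \<Otimes>\<^sub>M F t)"
    using assms unfolding progressively_measurable_def by blast
  ultimately have "(\<lambda>x. case (fst x, snd x) of (s, \<omega>) \<Rightarrow> H s \<omega>) \<in> borel_measurable (restrict_space borel {0..t} \<Otimes>\<^sub>M M)"
    by (rule measurable_compose)
  then show ?thesis by (simp add: case_prod_beta')
qed

lemma progressively_measurable_adapted:
  assumes "progressively_measurable F H" "0 \<le> t"
  shows "H t \<in> borel_measurable (F t)"
proof -
  have "(\<lambda>\<omega>. (t, \<omega>)) \<in> measurable (F t) (restrict_space borel {0..t} \<Otimes>\<^sub>M F t)"
    using assms(2) by (intro measurable_Pair measurable_ident_sets[OF refl]) (simp add: space_restrict_space)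
  moreover have "(\<lambda>(s, \<omega>). H s \<omega>) \<in> borel_measurable (restrict_space borel {0..t} \<Otimes>\<^sub>M F t)"
    using assms unfolding progressively_measurable_def by blast
  ultimately have "(\<lambda>\<omega>. case (t, \<omega>) of (s, \<omega>) \<Rightarrow> H s \<omega>) \<in> borel_measurable (F t)" by (rule measurable_compose)
  then show ?thesis by simp
qed

lemma simple_value_joint_measurable:
  assumes "step_adapted K"
  shows "(\<lambda>(s, \<omega>). simple_value K s \<omega>) \<in> borel_measurable (restrict_space borel {0..t} \<Otimes>\<^sub>M M)"
  unfolding case_prod_beta' simple_value_def
proof (intro borel_measurable_sum borel_measurable_times)
  fix q assume "q \<in> {..<pieces K}"
  then have "coef K q \<in> borel_measurable M" using assms measurable_F_M by (auto simp: step_adapted_def)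
  then show "(\<lambda>x. coef K q (snd x)) \<in> borel_measurable (restrict_space borel {0..t} \<Otimes>\<^sub>M M)"
    by (intro measurable_compose[OF measurable_snd])
  have "(\<lambda>u. indicator {knot K q<..knot K (Suc q)} u :: real) \<in> borel_measurable (restrict_space borel {0..t})"
    by (intro measurable_restrict_space1) simp
  then show "(\<lambda>x. indicator {knot K q<..knot K (Suc q)} (fst x) :: real) \<in> borel_measurable (restrict_space borel {0..t} \<Otimes>\<^sub>M M)"
    by (intro measurable_compose[OF measurable_fst])
qed

lemma diff_joint_measurable:
  fixes G H :: "real \<Rightarrow> 'a \<Rightarrow> real"
  assumes "(\<lambda>(s, \<omega>). G s \<omega>) \<in> borel_measurable N" "(\<lambda>(s, \<omega>). H s \<omega>) \<in> borel_measurable N"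
  shows "(\<lambda>(s, \<omega>). G s \<omega> - H s \<omega>) \<in> borel_measurable N"
  using borel_measurable_diff[OF assms] by (simp add: case_prod_beta')

section \<open>Riemann sums at left endpoints\<close>

definition grid_process :: "(real \<Rightarrow> 'a \<Rightarrow> real) \<Rightarrow> nat \<Rightarrow> 'a simple_process" where
  "grid_process H N = Simple N (\<lambda>i. real i / real N) (\<lambda>i. H (real i / real N))"

lemma grid_process_adapted:
  assumes "progressively_measurable F H" "N > 0"
  shows "step_adapted (grid_process H N)"
  using assms progressively_measurable_adapted[OF assms(1)]
  by (auto simp: step_adapted_def grid_process_def divide_strict_right_mono)

lemma simple_integral_grid:
  assumes "j \<le> N" "N > 0"
  shows "simple_integral W (grid_process H N) (real j / real N) \<omega> = (\<Sum>i<j. H (real i / real N) \<omega> * step N i \<omega>)"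
proof -
  have "simple_integral W (grid_process H N) (real j / real N) \<omega> =
    (\<Sum>i<N. if i < j then H (real i / real N) \<omega> * step N i \<omega> else 0)"
    unfolding simple_integral_def grid_process_def simple_process.sel
  proof (intro sum.cong refl)
    fix i assume "i \<in> {..<N}"
    show "H (real i / real N) \<omega> * (W (min (real (Suc i) / real N) (real j / real N)) \<omega> - W (min (real i / real N) (real j / real N)) \<omega>) =
      (if i < j then H (real i / real N) \<omega> * step N i \<omega> else 0)"
    proof (cases "i < j")
      case True
      then have "min (real (Suc i) / real N) (real j / real N) = real (Suc i) / real N"
        "min (real i / real N) (real j / real N) = real i / real N"
        using assms by (auto intro!: min_absorb1 divide_right_mono)
      then show ?thesis using True by (simp add: step_def)
    next
      case False
      then have "min (real (Suc i) / real N) (real j / real N) = real j / real N"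
        "min (real i / real N) (real j / real N) = real j / real N"
        using assms by (auto intro!: min_absorb2 divide_right_mono)
      then show ?thesis using False by simp
    qed
  qed
  also have "\<dots> = (\<Sum>i\<in>{..<j}. H (real i / real N) \<omega> * step N i \<omega>)"
    using assms by (subst sum.inter_filter[symmetric]) (auto intro!: sum.cong)
  finally show ?thesis .
qed

definition grid_error :: "(real \<Rightarrow> 'a \<Rightarrow> real) \<Rightarrow> nat \<Rightarrow> 'a \<Rightarrow> ennreal" where
  "grid_error H N \<omega> = (\<integral>\<^sup>+ s\<in>{0..1}. ennreal ((H s \<omega> - simple_value (grid_process H N) s \<omega>)\<^sup>2) \<partial>lborel)"

lemma grid_error_measurable:
  assumes "progressively_measurable F H" "N > 0"
  shows "grid_error H N \<in> borel_measurable M"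
  unfolding grid_error_def[abs_def]
  by (intro time_integral_measurable diff_joint_measurable progressively_measurable_M assms
      simple_value_joint_measurable grid_process_adapted) simp

lemma simple_value_grid:
  assumes "N > 0" "i < N" "real i / real N < s" "s \<le> real (Suc i) / real N"
  shows "simple_value (grid_process H N) s \<omega> = H (real i / real N) \<omega>"
proof -
  have "indicator {real q / real N<..real (Suc q) / real N} s = (if q = i then 1 else 0 :: real)" for q
  proof (cases q i rule: linorder_cases)
    case less
    then have "real (Suc q) / real N \<le> real i / real N" by (intro divide_right_mono) auto
    then show ?thesis using less assms(3) by (simp add: indicator_def)
  next
    case greater
    then have "real (Suc i) / real N \<le> real q / real N" by (intro divide_right_mono) auto
    then show ?thesis using greater assms(4) by (simp add: indicator_def)
  qed (use assms in simp)
  then have "simple_value (grid_process H N) s \<omega> = (\<Sum>q<N. if q = i then H (real q / real N) \<omega> else 0)"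
    unfolding simple_value_def grid_process_def simple_process.sel by (intro sum.cong) auto
  then show ?thesis using assms by simp
qed

lemma grid_index:
  assumes "N > 0" "0 < s" "s \<le> 1"
  obtains i where "i < N" "real i / real N < s" "s \<le> real (Suc i) / real N"
proof -
  \<comment> \<open>The ceiling fits cells that are open on the left and closed on the right; the
    cell index is \<open>k - 1\<close>.\<close>
  define k where "k = \<lceil>s * real N\<rceil>"
  have k: "of_int k - 1 < s * real N" "s * real N \<le> of_int k" unfolding k_def by linarith+
  have "0 < s * real N" using assms by simp
  then have "0 < k" using k by linarith
  then have i: "of_int k = real (Suc (nat (k - 1)))" by simp
  have "s * real N \<le> real N" using assms by (simp add: mult_le_cancel_right1)
  then have "k - 1 < int N" using k by linarith
  then have "nat (k - 1) < N" using \<open>0 < k\<close> by linarith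
  then show ?thesis
    using k assms(1) that[of "nat (k - 1)"] unfolding i by (simp add: field_simps)
qed

lemma uniform_grid_modulus:
  fixes f :: "real \<Rightarrow> real"
  assumes "continuous_on {0..} f" "\<epsilon> > 0"
  shows "\<forall>\<^sub>F N in sequentially. N > 0 \<and>
    (\<forall>i<N. \<forall>s. real i / real N \<le> s \<longrightarrow> s \<le> real (Suc i) / real N \<longrightarrow> \<bar>f s - f (real i / real N)\<bar> < \<epsilon>)"
proof -
  have "uniformly_continuous_on {0..1} f"
    by (intro compact_uniformly_continuous continuous_on_subset[OF assms(1)]) auto
  then obtain d where d: "d > 0" "\<And>x y. x \<in> {0..1} \<Longrightarrow> y \<in> {0..1} \<Longrightarrow> dist y x < d \<Longrightarrow> dist (f y) (f x) < \<epsilon>"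
    using assms(2) unfolding uniformly_continuous_on_def by metis
  have "(\<lambda>N. 1 / real N) \<longlonglongrightarrow> 0" by (rule lim_1_over_n)
  then have "\<forall>\<^sub>F N in sequentially. 1 / real N < d" using d(1) by (rule order_tendstoD)
  then show ?thesis using eventually_gt_at_top[of 0]
  proof eventually_elim
    case (elim N)
    show ?case
    proof (intro conjI allI impI elim)
      fix i s assume i: "i < N" "real i / real N \<le> s" "s \<le> real (Suc i) / real N"
      have "real (Suc i) / real N \<le> 1" "0 \<le> real i / real N" using i elim by simp_all
      then have r: "real i / real N \<in> {0..1}" "s \<in> {0..1}"
        using order_trans[OF _ i(2), of 0] order_trans[OF i(3), of 1] order_trans[OF i(2,3)] by auto
      have "s - real i / real N \<le> 1 / real N" using i by (simp add: add_divide_distrib)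
      then have "dist s (real i / real N) < d" using elim i by (simp add: dist_real_def)
      then show "\<bar>f s - f (real i / real N)\<bar> < \<epsilon>" using d(2)[OF r] by (simp add: dist_real_def)
    qed
  qed
qed

lemma grid_error_tendsto:
  assumes H: "progressively_measurable F H" and c: "AE \<omega> in M. continuous_on {0..} (\<lambda>t. H t \<omega>)" and "b > 0"
  shows "(\<lambda>N. prob {\<omega>\<in>space M. grid_error H (Suc N) \<omega> > ennreal b}) \<longlonglongrightarrow> 0"
proof (rule prob_tendsto_0)
  show "{\<omega>\<in>space M. grid_error H (Suc N) \<omega> > ennreal b} \<in> events" for N
    using grid_error_measurable[OF H, of "Suc N"] by simp
  show "AE \<omega> in M. \<forall>\<^sub>F N in sequentially. \<omega> \<notin> {\<omega>\<in>space M. grid_error H (Suc N) \<omega> > ennreal b}"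
    using c
  proof eventually_elim
    case (elim \<omega>)
    have sqrt_b: "0 < sqrt b" using assms by simp
    have "\<forall>\<^sub>F N in sequentially. grid_error H N \<omega> \<le> ennreal b"
      using uniform_grid_modulus[OF elim sqrt_b]
    proof eventually_elim
      case (elim N)
      have "grid_error H N \<omega> \<le> (\<integral>\<^sup>+ s\<in>{0..1::real}. ennreal b \<partial>lborel)"
        unfolding grid_error_def
      proof (rule nn_integral_mono_AE)
        \<comment> \<open>At time 0 no cell is active and the grid process takes the value 0
          whatever \<open>H\<close> is there; a single point is negligible.\<close>
        show "AE s in lborel. ennreal ((H s \<omega> - simple_value (grid_process H N) s \<omega>)\<^sup>2) * indicator {0..1} s \<le> ennreal b * indicator {0..1} s"
          using AE_lborel_singleton[of 0]
        proof eventually_elim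
          fix s :: real assume "s \<noteq> 0"
          show "ennreal ((H s \<omega> - simple_value (grid_process H N) s \<omega>)\<^sup>2) * indicator {0..1} s \<le> ennreal b * indicator {0..1} s"
          proof (cases "s \<in> {0..1}")
            case True
            then have "0 < s" "s \<le> 1" using \<open>s \<noteq> 0\<close> by auto
            then obtain i where i: "i < N" "real i / real N < s" "s \<le> real (Suc i) / real N"
              using grid_index[of N s] elim by blast
            have "\<bar>H s \<omega> - H (real i / real N) \<omega>\<bar> < sqrt b" using elim i by auto
            then have "\<bar>H s \<omega> - H (real i / real N) \<omega>\<bar>\<^sup>2 \<le> (sqrt b)\<^sup>2" by (intro power_mono) auto
            then have "(H s \<omega> - simple_value (grid_process H N) s \<omega>)\<^sup>2 \<le> b"
              using simple_value_grid[OF _ i, of H \<omega>] elim assms by simp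
            then show ?thesis by (intro mult_right_mono ennreal_leI) auto
          qed simp
        qed
      qed
      also have "\<dots> = ennreal b" by (simp add: nn_integral_cmult_indicator)
      finally show "grid_error H N \<omega> \<le> ennreal b" .
    qed
    then have "\<forall>\<^sub>F N in sequentially. grid_error H (Suc N) \<omega> \<le> ennreal b"
      by (rule eventually_compose_filterlim[OF _ filterlim_Suc])
    then show ?case by eventually_elim auto
  qed
qed

text \<open>The integral is defined by some approximating simple processes, not by Riemann sums.
  Both are close to \<open>H\<close>, so the tail bound compares them, and the limit in
  \<open>k\<close> removes everything that depends on \<open>K k\<close>. The factor
  \<open>4\<close> comes from \<open>(x - z)\<^sup>2 \<le> 2 * (x - y)\<^sup>2 + 2 * (y -
  z)\<^sup>2\<close> with two terms of size \<open>b\<close>.\<close>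

lemma riemann_sum_tail:
  assumes J: "has_ito_integral M F W H (real j / real N) J" and N: "N > 0" "j \<le> N" and "\<alpha> > 0" "b > 0"
  shows "prob {\<omega>\<in>space M. \<bar>(\<Sum>i<j. H (real i / real N) \<omega> * step N i \<omega>) - J \<omega>\<bar> > 2 * \<alpha>} \<le>
    prob {\<omega>\<in>space M. grid_error H N \<omega> > ennreal b} + 4 * b / \<alpha>\<^sup>2"
proof -
  let ?t = "real j / real N" and ?S = "grid_process H N"
  have t: "0 \<le> ?t" "?t \<le> 1" using N by auto
  have H: "progressively_measurable F H" and Jm: "J \<in> borel_measurable M"
    using J by (auto simp: has_ito_integral_def ito_integrand_def)
  obtain K where K: "\<And>k. simple_adapted F (K k)"
    and K1: "\<And>\<epsilon>. \<epsilon> > 0 \<Longrightarrow> (\<lambda>k. prob {\<omega> \<in> space M. (\<integral>\<^sup>+ s\<in>{0..?t}. ennreal ((simple_value (K k) s \<omega> - H s \<omega>)\<^sup>2) \<partial>lborel) > ennreal \<epsilon>}) \<longlonglongrightarrow> 0"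
    and K2: "\<And>\<epsilon>. \<epsilon> > 0 \<Longrightarrow> (\<lambda>k. prob {\<omega> \<in> space M. \<bar>simple_integral W (K k) ?t \<omega> - J \<omega>\<bar> > \<epsilon>}) \<longlonglongrightarrow> 0"
    using J unfolding has_ito_integral_def by blast
  have S: "step_adapted ?S" using grid_process_adapted[OF H N(1)] .
  let ?E = "\<lambda>k \<omega>. \<integral>\<^sup>+ s\<in>{0..?t}. ennreal ((simple_value (K k) s \<omega> - H s \<omega>)\<^sup>2) \<partial>lborel"
  let ?B1 = "\<lambda>k. {\<omega>\<in>space M. ?E k \<omega> > ennreal b}" and ?B2 = "{\<omega>\<in>space M. grid_error H N \<omega> > ennreal b}"
  have jm: "(\<lambda>(s, \<omega>). simple_value (K k) s \<omega> - H s \<omega>) \<in> borel_measurable (restrict_space borel {0..?t} \<Otimes>\<^sub>M M)" for k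
    by (intro diff_joint_measurable simple_value_joint_measurable progressively_measurable_M H t simple_adapted_step K)
  have jm': "(\<lambda>(s, \<omega>). H s \<omega> - simple_value ?S s \<omega>) \<in> borel_measurable (restrict_space borel {0..?t} \<Otimes>\<^sub>M M)"
    by (intro diff_joint_measurable simple_value_joint_measurable progressively_measurable_M H t S)
  have B1: "?B1 k \<in> events" for k using time_integral_measurable[OF jm[of k]] by simp
  have B2: "?B2 \<in> events" using grid_error_measurable[OF H N(1)] by simp
  have Wm: "simple_integral W L ?t \<in> borel_measurable M" if "step_adapted L" for L
  proof -
    have "coef L q \<in> borel_measurable M" "0 \<le> knot L q" "0 \<le> knot L (Suc q)" if "q < pieces L" for q
      using \<open>step_adapted L\<close> that knot_nonneg[OF \<open>step_adapted L\<close>] measurable_F_M[of "coef L q" "knot L q" borel]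
      by (auto simp: step_adapted_def)
    then show ?thesis unfolding simple_integral_def[abs_def] using t
      by (intro borel_measurable_sum borel_measurable_times borel_measurable_diff W_measurable_M) auto
  qed
  have bound: "prob {\<omega>\<in>space M. \<bar>simple_integral W ?S ?t \<omega> - J \<omega>\<bar> > 2 * \<alpha>} \<le>
    prob {\<omega> \<in> space M. \<bar>simple_integral W (K k) ?t \<omega> - J \<omega>\<bar> > \<alpha>} + (prob (?B1 k) + prob ?B2 + 4 * b / \<alpha>\<^sup>2)" for k
  proof -
    have Kk: "step_adapted (K k)" using K by (rule simple_adapted_step)
    note [measurable] = Wm[OF Kk] Wm[OF S] Jm
    have "prob {\<omega>\<in>space M. \<bar>simple_integral W ?S ?t \<omega> - J \<omega>\<bar> > 2 * \<alpha>} \<le>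
      prob ({\<omega> \<in> space M. \<bar>simple_integral W (K k) ?t \<omega> - J \<omega>\<bar> > \<alpha>} \<union> {\<omega> \<in> space M. \<bar>simple_integral W (K k) ?t \<omega> - simple_integral W ?S ?t \<omega>\<bar> > \<alpha>})"
      by (rule finite_measure_mono) auto
    also have "\<dots> \<le> prob {\<omega> \<in> space M. \<bar>simple_integral W (K k) ?t \<omega> - J \<omega>\<bar> > \<alpha>} + prob {\<omega> \<in> space M. \<bar>simple_integral W (K k) ?t \<omega> - simple_integral W ?S ?t \<omega>\<bar> > \<alpha>}"
      by (rule measure_Un_le) measurable
    also have "prob {\<omega> \<in> space M. \<bar>simple_integral W (K k) ?t \<omega> - simple_integral W ?S ?t \<omega>\<bar> > \<alpha>} \<le> prob (?B1 k \<union> ?B2) + 4 * b / \<alpha>\<^sup>2"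
    proof (rule simple_integral_diff_tail[OF Kk S t(1) assms(4)])
      show "?B1 k \<union> ?B2 \<in> events" using B1 B2 by simp
      fix \<omega> assume "\<omega> \<in> space M - (?B1 k \<union> ?B2)"
      then have w: "\<omega> \<in> space M" "?E k \<omega> \<le> ennreal b" "grid_error H N \<omega> \<le> ennreal b" by (auto simp: not_less)
      have "(\<integral>\<^sup>+ s\<in>{0..?t}. ennreal ((H s \<omega> - simple_value ?S s \<omega>)\<^sup>2) \<partial>lborel) \<le> grid_error H N \<omega>"
        unfolding grid_error_def using t by (intro nn_integral_mono mult_left_mono) (auto simp: indicator_def)
      then have w3: "(\<integral>\<^sup>+ s\<in>{0..?t}. ennreal ((H s \<omega> - simple_value ?S s \<omega>)\<^sup>2) \<partial>lborel) \<le> ennreal b"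
        using w(3) by (rule order_trans)
      have "(\<integral>\<^sup>+ s\<in>{0..?t}. ennreal ((simple_value (K k) s \<omega> - simple_value ?S s \<omega>)\<^sup>2) \<partial>lborel) \<le>
        (\<integral>\<^sup>+ s. 2 * (ennreal ((simple_value (K k) s \<omega> - H s \<omega>)\<^sup>2) * indicator {0..?t} s) + 2 * (ennreal ((H s \<omega> - simple_value ?S s \<omega>)\<^sup>2) * indicator {0..?t} s) \<partial>lborel)"
      proof (rule nn_integral_mono)
        fix s
        have "(x - z)\<^sup>2 \<le> 2 * (x - y)\<^sup>2 + 2 * (y - z)\<^sup>2" for x y z :: real
          using sum_squares_bound[of "x - y" "y - z"] by (simp add: power2_eq_square algebra_simps)
        then have "ennreal ((simple_value (K k) s \<omega> - simple_value ?S s \<omega>)\<^sup>2) \<le> ennreal (2 * (simple_value (K k) s \<omega> - H s \<omega>)\<^sup>2 + 2 * (H s \<omega> - simple_value ?S s \<omega>)\<^sup>2)"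
          by (rule ennreal_leI)
        also have "\<dots> = 2 * ennreal ((simple_value (K k) s \<omega> - H s \<omega>)\<^sup>2) + 2 * ennreal ((H s \<omega> - simple_value ?S s \<omega>)\<^sup>2)"
          by (simp add: ennreal_mult)
        finally show "ennreal ((simple_value (K k) s \<omega> - simple_value ?S s \<omega>)\<^sup>2) * indicator {0..?t} s \<le>
          2 * (ennreal ((simple_value (K k) s \<omega> - H s \<omega>)\<^sup>2) * indicator {0..?t} s) + 2 * (ennreal ((H s \<omega> - simple_value ?S s \<omega>)\<^sup>2) * indicator {0..?t} s)"
          by (simp add: indicator_def)
      qed
      also have "\<dots> = 2 * ?E k \<omega> + 2 * (\<integral>\<^sup>+ s\<in>{0..?t}. ennreal ((H s \<omega> - simple_value ?S s \<omega>)\<^sup>2) \<partial>lborel)"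
        using time_section_measurable[OF jm[of k] w(1)] time_section_measurable[OF jm' w(1)]
        by (subst nn_integral_add) (auto simp: nn_integral_cmult)
      also have "\<dots> \<le> 2 * ennreal b + 2 * ennreal b"
        using w(2) w3 by (intro add_mono mult_left_mono) auto
      also have "\<dots> = ennreal (2 * b) + ennreal (2 * b)" using assms by (simp add: ennreal_mult)
      also have "\<dots> = ennreal (4 * b)" using assms by (subst ennreal_plus[symmetric]) auto
      finally show "(\<integral>\<^sup>+ s\<in>{0..?t}. ennreal ((simple_value (K k) s \<omega> - simple_value ?S s \<omega>)\<^sup>2) \<partial>lborel) \<le> ennreal (4 * b)" .
    qed (use assms in simp)
    also have "prob (?B1 k \<union> ?B2) \<le> prob (?B1 k) + prob ?B2" by (rule measure_Un_le[OF B1 B2])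
    finally show ?thesis by simp
  qed
  have "(\<lambda>k. prob {\<omega> \<in> space M. \<bar>simple_integral W (K k) ?t \<omega> - J \<omega>\<bar> > \<alpha>} + (prob (?B1 k) + prob ?B2 + 4 * b / \<alpha>\<^sup>2)) \<longlonglongrightarrow> 0 + (0 + prob ?B2 + 4 * b / \<alpha>\<^sup>2)"
    by (intro tendsto_add K1 K2 tendsto_const assms)
  then have "prob {\<omega>\<in>space M. \<bar>simple_integral W ?S ?t \<omega> - J \<omega>\<bar> > 2 * \<alpha>} \<le> 0 + (0 + prob ?B2 + 4 * b / \<alpha>\<^sup>2)"
    by (rule LIMSEQ_le_const) (use bound in blast)
  then show ?thesis unfolding simple_integral_grid[OF N(2,1)] by simp
qed

text \<open>The grid error over all of \<open>{0..1}\<close> controls every \<open>j\<close> at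
  once. The probabilities are bounded for each \<open>j\<close> separately, which suffices for an
  estimate by expectations, one step at a time.\<close>

lemma riemann_sums_uniform:
  assumes H: "progressively_measurable F H" and c: "AE \<omega> in M. continuous_on {0..} (\<lambda>t. H t \<omega>)"
    and J: "\<And>t. 0 \<le> t \<Longrightarrow> has_ito_integral M F W H t (J t)" and "\<epsilon> > 0" "\<eta> > 0"
  shows "\<forall>\<^sub>F N in sequentially. \<forall>j\<le>N.
    prob {\<omega>\<in>space M. \<bar>(\<Sum>i<j. H (real i / real N) \<omega> * step N i \<omega>) - J (real j / real N) \<omega>\<bar> > \<epsilon>} \<le> \<eta>"
proof -
  \<comment> \<open>This choice makes the remaining term
    \<open>4 * b / (\<epsilon> / 2)\<^sup>2\<close> equal to \<open>\<eta> / 2\<close>.\<close>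
  define b where "b = \<eta> * \<epsilon>\<^sup>2 / 32"
  have b: "b > 0" using assms by (simp add: b_def)
  have "\<forall>\<^sub>F N in sequentially. prob {\<omega>\<in>space M. grid_error H (Suc N) \<omega> > ennreal b} < \<eta> / 2"
    using grid_error_tendsto[OF H c b] by (rule order_tendstoD) (use assms in simp)
  then have "\<forall>\<^sub>F N in sequentially. N > 0 \<and> prob {\<omega>\<in>space M. grid_error H N \<omega> > ennreal b} < \<eta> / 2"
    by (subst eventually_sequentially_Suc[symmetric]) simp
  then show ?thesis
  proof eventually_elim
    case (elim N)
    show ?case
    proof (intro allI impI)
      fix j assume j: "j \<le> N"
      have "prob {\<omega>\<in>space M. \<bar>(\<Sum>i<j. H (real i / real N) \<omega> * step N i \<omega>) - J (real j / real N) \<omega>\<bar> > 2 * (\<epsilon> / 2)} \<le>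
        prob {\<omega>\<in>space M. grid_error H N \<omega> > ennreal b} + 4 * b / (\<epsilon> / 2)\<^sup>2"
        using elim j assms b by (intro riemann_sum_tail J) auto
      also have "4 * b / (\<epsilon> / 2)\<^sup>2 = \<eta> / 2" using assms by (simp add: b_def field_simps power2_eq_square)
      finally show "prob {\<omega>\<in>space M. \<bar>(\<Sum>i<j. H (real i / real N) \<omega> * step N i \<omega>) - J (real j / real N) \<omega>\<bar> > \<epsilon>} \<le> \<eta>"
        using elim by simp
    qed
  qed
qed

end

subsection \<open>The reflected walk\<close>

lemma reflected_0: "0 \<le> a \<Longrightarrow> reflected a x 0 = a"
  by (simp add: reflected_def)

lemma reflected_Suc: "reflected a x (Suc j) = max 0 (reflected a x j + x j)"
  by (auto simp: reflected_def)

lemma reflected_nonneg: "0 \<le> a \<Longrightarrow> 0 \<le> reflected a x j"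
  by (cases j) (simp_all add: reflected_0 reflected_Suc)

text \<open>The increments of Skorokhod's reflecting term, a discrete local time at 0.\<close>

definition overshoot :: "real \<Rightarrow> (nat \<Rightarrow> real) \<Rightarrow> nat \<Rightarrow> real" where
  "overshoot a x i = max 0 (- (reflected a x i + x i))"

text \<open>A discrete Ito formula. By
  \<open>(max 0 u)\<^sup>2 = u\<^sup>2 - (max 0 (- u))\<^sup>2\<close>, reflection costs just the
  squared overshoot; there is no mixed term.\<close>

lemma reflected_square:
  assumes "0 \<le> a"
  shows "(reflected a x j)\<^sup>2 = a\<^sup>2 + (\<Sum>i<j. 2 * reflected a x i * x i) + (\<Sum>i<j. (x i)\<^sup>2) - (\<Sum>i<j. (overshoot a x i)\<^sup>2)"
proof (induction j)
  case (Suc j)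
  have "(reflected a x (Suc j))\<^sup>2 = (reflected a x j + x j)\<^sup>2 - (overshoot a x j)\<^sup>2"
    using power2_minus[of "reflected a x j + x j"] by (auto simp: reflected_Suc overshoot_def max_def)
  then show ?case using Suc by (simp add: power2_sum)
qed (simp add: reflected_0 assms)

lemma sum_overshoot: "0 \<le> a \<Longrightarrow> (\<Sum>i<j. overshoot a x i) = reflected a x j - a - (\<Sum>i<j. x i)"
  by (induction j) (auto simp: reflected_0 reflected_Suc overshoot_def max_def)

text \<open>Each overshoot is at most the largest step \<open>\<delta>\<close>, and their sum is the
  total push, which is at most the depth of the walk.\<close>

lemma sum_overshoot_square_le:
  assumes "0 \<le> a" "j \<le> N" "\<And>i. i < N \<Longrightarrow> \<bar>x i\<bar> \<le> \<delta>"
  shows "(\<Sum>i<j. (overshoot a x i)\<^sup>2) \<le> \<delta> * (- walk_min x N)"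
proof -
  have o: "0 \<le> overshoot a x i" "i < N \<Longrightarrow> overshoot a x i \<le> \<delta>" for i
    using reflected_nonneg[OF assms(1), of x i] assms(3)[of i] by (auto simp: overshoot_def)
  have "(\<Sum>i<j. (overshoot a x i)\<^sup>2) \<le> (\<Sum>i<N. (overshoot a x i)\<^sup>2)"
    using assms by (intro sum_mono2) auto
  also have "\<dots> \<le> (\<Sum>i<N. \<delta> * overshoot a x i)"
    unfolding power2_eq_square by (intro sum_mono mult_right_mono o) auto
  also have "\<dots> = \<delta> * (reflected a x N - a - (\<Sum>i<N. x i))"
    using sum_overshoot[OF assms(1)] by (simp add: sum_distrib_left[symmetric])
  also have "\<dots> \<le> \<delta> * (- walk_min x N)"
  proof (cases "N = 0")
    case False
    then have "0 \<le> \<delta>" using assms(3)[of 0] by simp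
    then show ?thesis using assms(1) walk_min_nonpos[of x N] by (intro mult_left_mono) (auto simp: reflected_def)
  qed (simp add: reflected_0 assms)
  finally show ?thesis .
qed

lemma measurable_reflected:
  assumes "\<And>i. i < r \<Longrightarrow> (\<lambda>\<omega>. x \<omega> i) \<in> borel_measurable M"
  shows "(\<lambda>\<omega>. reflected a (x \<omega>) r) \<in> borel_measurable M"
proof -
  have [measurable]: "(\<lambda>\<omega>. \<Sum>i<r. x \<omega> i) \<in> borel_measurable M" "(\<lambda>\<omega>. walk_min (x \<omega>) r) \<in> borel_measurable M"
    using assms by (auto intro!: measurable_walk_min)
  show ?thesis unfolding reflected_def by measurable
qed

section \<open>The equation of the squared reflected walk\<close>

context brownian_motion begin

lemma step_F: "i < j \<Longrightarrow> step N i \<in> borel_measurable (F (real j / real N))"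
  unfolding step_def[abs_def] by (intro borel_measurable_diff W_measurable divide_right_mono) auto

lemma grid_step: "N > 0 \<Longrightarrow> 0 \<le> real j / real N" "N > 0 \<Longrightarrow> real j / real N < real (Suc j) / real N"
  "N > 0 \<Longrightarrow> real (Suc j) / real N - real j / real N = 1 / real N"
  by (auto simp: divide_strict_right_mono diff_divide_distrib[symmetric])

text \<open>The centred squares are orthogonal, and each has variance \<open>3 - 2 + 1 = 2\<close>
  in units of the squared time step, by the fourth moment of a normal variable.\<close>

lemma quadratic_variation:
  assumes "N > 0"
  shows "(\<lambda>\<omega>. \<Sum>i<j. (step N i \<omega>)\<^sup>2 - 1 / real N) \<in> borel_measurable (F (real j / real N))"
    and "integrable M (\<lambda>\<omega>. (\<Sum>i<j. (step N i \<omega>)\<^sup>2 - 1 / real N)\<^sup>2)"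
    and "expectation (\<lambda>\<omega>. (\<Sum>i<j. (step N i \<omega>)\<^sup>2 - 1 / real N)\<^sup>2) = 2 * real j * (1 / real N)\<^sup>2"
proof -
  let ?Z = "\<lambda>j \<omega>. \<Sum>i<j. (step N i \<omega>)\<^sup>2 - 1 / real N"
  have m: "?Z j \<in> borel_measurable (F (real j / real N))" for j
    by (intro borel_measurable_sum borel_measurable_diff borel_measurable_power borel_measurable_const step_F) auto
  have "integrable M (\<lambda>\<omega>. (?Z j \<omega>)\<^sup>2) \<and> expectation (\<lambda>\<omega>. (?Z j \<omega>)\<^sup>2) = 2 * real j * (1 / real N)\<^sup>2"
  proof (induction j)
    case (Suc j)
    let ?h = "1 / real N" and ?D = "step N j"
    note g = grid_step(1,2)[OF assms, of j]
    have Zi: "integrable M (\<lambda>\<omega>. (?Z j \<omega>)\<^sup>2)" using Suc.IH by (rule conjunct1)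
    have Zi1: "integrable M (?Z j)"
      using square_integrable_imp_integrable[OF measurable_F_M[OF m] Zi] .
    have D: "integrable M (\<lambda>\<omega>. (?D \<omega>)\<^sup>2)" "integrable M (\<lambda>\<omega>. (?D \<omega>) ^ 4)"
      "expectation (\<lambda>\<omega>. (?D \<omega>)\<^sup>2) = ?h" "expectation (\<lambda>\<omega>. (?D \<omega>) ^ 4) = 3 * ?h\<^sup>2"
      using increment_moments(1)[OF g, of 2] increment_moments(1)[OF g, of 4] increment_moments(4,6)[OF g]
      unfolding grid_step(3)[OF assms] step_def by auto
    have t1: "integrable M (\<lambda>\<omega>. ?Z j \<omega> * ((?D \<omega>)\<^sup>2 - ?h))" "expectation (\<lambda>\<omega>. ?Z j \<omega> * ((?D \<omega>)\<^sup>2 - ?h)) = 0"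
      using increment_mult[OF g m Zi1, of "\<lambda>x. x\<^sup>2 - ?h"] D unfolding step_def by (simp_all add: prob_space)
    have eq: "(\<lambda>\<omega>. (?Z (Suc j) \<omega>)\<^sup>2) = (\<lambda>\<omega>. (?Z j \<omega>)\<^sup>2 + 2 * (?Z j \<omega> * ((?D \<omega>)\<^sup>2 - ?h)) + (?D \<omega> ^ 4 - 2 * ?h * (?D \<omega>)\<^sup>2 + ?h\<^sup>2))"
      by (simp add: fun_eq_iff power2_eq_square eval_nat_numeral algebra_simps)
    have E: "expectation (\<lambda>\<omega>. ?D \<omega> ^ 4 - 2 * ?h * (?D \<omega>)\<^sup>2 + ?h\<^sup>2) = 2 * ?h\<^sup>2"
      using D by (simp add: prob_space power2_eq_square)
    have i: "integrable M (\<lambda>\<omega>. ?D \<omega> ^ 4 - 2 * ?h * (?D \<omega>)\<^sup>2 + ?h\<^sup>2)" using D by simp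
    have "expectation (\<lambda>\<omega>. (?Z (Suc j) \<omega>)\<^sup>2) = 2 * real j * ?h\<^sup>2 + 2 * 0 + 2 * ?h\<^sup>2"
      unfolding eq using Zi t1 i E conjunct2[OF Suc.IH] by simp
    moreover have "integrable M (\<lambda>\<omega>. (?Z (Suc j) \<omega>)\<^sup>2)" unfolding eq using Zi t1 i by simp
    ultimately show ?case by (simp add: algebra_simps)
  qed simp
  then show "(\<lambda>\<omega>. \<Sum>i<j. (step N i \<omega>)\<^sup>2 - 1 / real N) \<in> borel_measurable (F (real j / real N))"
    "integrable M (\<lambda>\<omega>. (\<Sum>i<j. (step N i \<omega>)\<^sup>2 - 1 / real N)\<^sup>2)"
    "expectation (\<lambda>\<omega>. (\<Sum>i<j. (step N i \<omega>)\<^sup>2 - 1 / real N)\<^sup>2) = 2 * real j * (1 / real N)\<^sup>2"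
    using m by auto
qed

definition refl_walk :: "real \<Rightarrow> nat \<Rightarrow> nat \<Rightarrow> 'a \<Rightarrow> real" where
  "refl_walk a N j \<omega> = reflected a (\<lambda>i. step N i \<omega>) j"

lemma refl_walk_F: "refl_walk a N j \<in> borel_measurable (F (real j / real N))"
  unfolding refl_walk_def[abs_def] by (intro measurable_reflected step_F)

lemma refl_walk_M: "refl_walk a N j \<in> borel_measurable M"
  by (rule measurable_F_M[OF refl_walk_F])

lemma overshoot_tendsto:
  assumes "0 \<le> a" "\<epsilon> > 0"
  shows "(\<lambda>N. prob {\<omega>\<in>space M. (\<Sum>i<N. (overshoot a (\<lambda>i. step N i \<omega>) i)\<^sup>2) > \<epsilon>}) \<longlonglongrightarrow> 0"
proof (rule prob_tendsto_0)
  show "{\<omega>\<in>space M. (\<Sum>i<N. (overshoot a (\<lambda>i. step N i \<omega>) i)\<^sup>2) > \<epsilon>} \<in> events" for N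
  proof -
    have [measurable]: "(\<lambda>\<omega>. reflected a (\<lambda>i. step N i \<omega>) i) \<in> borel_measurable M" for i
      by (intro measurable_reflected step_measurable)
    show ?thesis unfolding overshoot_def by measurable
  qed
  show "AE \<omega> in M. \<forall>\<^sub>F N in sequentially. \<omega> \<notin> {\<omega>\<in>space M. (\<Sum>i<N. (overshoot a (\<lambda>i. step N i \<omega>) i)\<^sup>2) > \<epsilon>}"
    using continuous_paths
  proof eventually_elim
    case (elim \<omega>)
    have "compact ((\<lambda>t. W t \<omega>) ` {0..1})"
      by (intro compact_continuous_image continuous_on_subset[OF elim]) auto
    then obtain B where B: "\<And>t. t \<in> {0..1} \<Longrightarrow> \<bar>W t \<omega>\<bar> \<le> B"
      by (metis bounded_iff compact_imp_bounded image_eqI real_norm_def)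
    then have B0: "0 \<le> B" by (meson abs_ge_zero atLeastAtMost_iff order_refl order_trans zero_le_one)
    \<comment> \<open>Then \<open>d * (2 * B) \<le> \<epsilon>\<close>, and the summand
      \<open>1\<close> covers \<open>B = 0\<close>.\<close>
    define d where "d = \<epsilon> / (2 * B + 1)"
    have d: "d > 0" using assms B0 by (simp add: d_def)
    show ?case
      using uniform_grid_modulus[OF elim d]
    proof eventually_elim
      case (elim N)
      have x: "\<bar>step N i \<omega>\<bar> \<le> d" if "i < N" for i
      proof -
        have "real i / real N \<le> real (Suc i) / real N" by (intro divide_right_mono) auto
        then show ?thesis using elim that unfolding step_def by (meson less_imp_le order_refl)
      qed
      obtain j where j: "j \<le> N" "walk_min (\<lambda>i. step N i \<omega>) N = (\<Sum>i<j. step N i \<omega>)" using walk_min_attained by blast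
      have "real j / real N \<in> {0..1}" using j elim by simp
      then have "- walk_min (\<lambda>i. step N i \<omega>) N \<le> 2 * B"
        using B[of "real j / real N"] B[of 0] unfolding j(2) sum_step by simp
      then have "d * (- walk_min (\<lambda>i. step N i \<omega>) N) \<le> d * (2 * B)" using d by (intro mult_left_mono) auto
      also have "\<dots> \<le> \<epsilon>" using B0 assms by (simp add: d_def field_simps)
      finally have "(\<Sum>i<N. (overshoot a (\<lambda>i. step N i \<omega>) i)\<^sup>2) \<le> \<epsilon>"
        using sum_overshoot_square_le[of a N N "\<lambda>i. step N i \<omega>" d, OF assms(1) order_refl x] by linarith
      then show ?case by simp
    qed
  qed
qed

text \<open>Up to a small error the squared reflected walk solves the same discretized equation as
  the solution. By \<open>reflected_square\<close> the error consists of the squared overshoots and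
  the fluctuation of the quadratic variation.\<close>

lemma refl_walk_uniform:
  assumes "0 \<le> a" "\<epsilon> > 0" "\<eta> > 0"
  shows "\<forall>\<^sub>F N in sequentially. \<forall>j\<le>N.
    prob {\<omega>\<in>space M. \<bar>(\<Sum>i<j. 2 * refl_walk a N i \<omega> * step N i \<omega>) - ((refl_walk a N j \<omega>)\<^sup>2 - a\<^sup>2 - real j / real N)\<bar> > \<epsilon>} \<le> \<eta>"
proof -
  have "\<forall>\<^sub>F N in sequentially. prob {\<omega>\<in>space M. (\<Sum>i<N. (overshoot a (\<lambda>i. step N i \<omega>) i)\<^sup>2) > \<epsilon> / 2} < \<eta> / 2"
    using overshoot_tendsto[OF assms(1), of "\<epsilon> / 2"] assms(2,3) by (intro order_tendstoD) auto
  \<comment> \<open>Chebyshev's inequality at level \<open>\<epsilon> / 2\<close>, applied to a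
    second moment of at most \<open>2 / N\<close>, yields this bound.\<close>
  moreover have "\<forall>\<^sub>F N in sequentially. 8 / \<epsilon>\<^sup>2 * (1 / real N) < \<eta> / 2"
    using tendsto_mult_right_zero[OF lim_1_over_n, of "8 / \<epsilon>\<^sup>2"] assms(3) by (intro order_tendstoD) auto
  ultimately show ?thesis using eventually_gt_at_top[of 0]
  proof eventually_elim
    case (elim N)
    show ?case
    proof (intro allI impI)
      fix j assume j: "j \<le> N"
      let ?Z = "\<lambda>\<omega>. \<Sum>i<j. (step N i \<omega>)\<^sup>2 - 1 / real N"
      let ?O = "\<lambda>j \<omega>. \<Sum>i<j. (overshoot a (\<lambda>i. step N i \<omega>) i)\<^sup>2"
      note q = quadratic_variation[OF elim(3), of j]
      have Zm [measurable]: "?Z \<in> borel_measurable M" using measurable_F_M[OF q(1)] .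
      have [measurable]: "(\<lambda>\<omega>. reflected a (\<lambda>i. step N i \<omega>) i) \<in> borel_measurable M" for i
        by (intro measurable_reflected step_measurable)
      have Om [measurable]: "?O N \<in> borel_measurable M" unfolding overshoot_def by measurable
      have "{\<omega>\<in>space M. \<bar>(\<Sum>i<j. 2 * refl_walk a N i \<omega> * step N i \<omega>) - ((refl_walk a N j \<omega>)\<^sup>2 - a\<^sup>2 - real j / real N)\<bar> > \<epsilon>} \<subseteq>
        {\<omega>\<in>space M. (\<epsilon> / 2)\<^sup>2 \<le> (?Z \<omega>)\<^sup>2} \<union> {\<omega>\<in>space M. ?O N \<omega> > \<epsilon> / 2}"
      proof
        fix \<omega> assume "\<omega> \<in> {\<omega>\<in>space M. \<bar>(\<Sum>i<j. 2 * refl_walk a N i \<omega> * step N i \<omega>) - ((refl_walk a N j \<omega>)\<^sup>2 - a\<^sup>2 - real j / real N)\<bar> > \<epsilon>}"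
        then have w: "\<omega> \<in> space M" "\<bar>(\<Sum>i<j. 2 * refl_walk a N i \<omega> * step N i \<omega>) - ((refl_walk a N j \<omega>)\<^sup>2 - a\<^sup>2 - real j / real N)\<bar> > \<epsilon>" by auto
        have "(\<Sum>i<j. 2 * refl_walk a N i \<omega> * step N i \<omega>) - ((refl_walk a N j \<omega>)\<^sup>2 - a\<^sup>2 - real j / real N) = ?O j \<omega> - ?Z \<omega>"
          unfolding refl_walk_def reflected_square[OF assms(1)] by (simp add: sum_subtractf)
        then have "\<bar>?O j \<omega>\<bar> > \<epsilon> / 2 \<or> \<bar>?Z \<omega>\<bar> \<ge> \<epsilon> / 2" using w(2) by linarith
        moreover have "0 \<le> ?O j \<omega>" "?O j \<omega> \<le> ?O N \<omega>" using j by (auto intro: sum_nonneg sum_mono2)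
        moreover have "(\<epsilon> / 2)\<^sup>2 \<le> (?Z \<omega>)\<^sup>2" if "\<bar>?Z \<omega>\<bar> \<ge> \<epsilon> / 2"
          using power_mono[OF that, of 2] assms(2) by simp
        ultimately show "\<omega> \<in> {\<omega>\<in>space M. (\<epsilon> / 2)\<^sup>2 \<le> (?Z \<omega>)\<^sup>2} \<union> {\<omega>\<in>space M. ?O N \<omega> > \<epsilon> / 2}"
          using w(1) by auto
      qed
      then have "prob {\<omega>\<in>space M. \<bar>(\<Sum>i<j. 2 * refl_walk a N i \<omega> * step N i \<omega>) - ((refl_walk a N j \<omega>)\<^sup>2 - a\<^sup>2 - real j / real N)\<bar> > \<epsilon>} \<le>
        prob ({\<omega>\<in>space M. (\<epsilon> / 2)\<^sup>2 \<le> (?Z \<omega>)\<^sup>2} \<union> {\<omega>\<in>space M. ?O N \<omega> > \<epsilon> / 2})"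
        by (intro finite_measure_mono) measurable
      also have "\<dots> \<le> prob {\<omega>\<in>space M. (\<epsilon> / 2)\<^sup>2 \<le> (?Z \<omega>)\<^sup>2} + prob {\<omega>\<in>space M. ?O N \<omega> > \<epsilon> / 2}"
        by (rule measure_Un_le) measurable
      also have "prob {\<omega>\<in>space M. (\<epsilon> / 2)\<^sup>2 \<le> (?Z \<omega>)\<^sup>2} \<le> expectation (\<lambda>\<omega>. (?Z \<omega>)\<^sup>2) / (\<epsilon> / 2)\<^sup>2"
        using q(2) assms(2) by (intro integral_Markov_inequality_measure[where A = "{}"]) auto
      also have "\<dots> \<le> 2 * real N * (1 / real N)\<^sup>2 / (\<epsilon> / 2)\<^sup>2"
        unfolding q(3) using j by (intro divide_right_mono mult_right_mono mult_left_mono) auto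
      also have "\<dots> = 8 / \<epsilon>\<^sup>2 * (1 / real N)" using elim(3) by (simp add: field_simps power2_eq_square)
      finally show "prob {\<omega>\<in>space M. \<bar>(\<Sum>i<j. 2 * refl_walk a N i \<omega> * step N i \<omega>) - ((refl_walk a N j \<omega>)\<^sup>2 - a\<^sup>2 - real j / real N)\<bar> > \<epsilon>} \<le> \<eta>"
        using elim(1,2) by linarith
    qed
  qed
qed

end

subsection \<open>Pathwise uniqueness by the Yamada-Watanabe potential\<close>

lemma arsinh_real_bounds:
  fixes x :: real
  assumes "0 \<le> x"
  shows "arsinh x \<le> x" "0 \<le> arsinh x"
proof -
  have "1 \<le> sqrt (x\<^sup>2 + 1)" by simp
  then have "1 \<le> x + sqrt (x\<^sup>2 + 1)" using assms by linarith
  then show "0 \<le> arsinh x" by (simp add: arsinh_real_def)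
  have "(\<lambda>x. x - arsinh x) 0 \<le> (\<lambda>x. x - arsinh x) x"
  proof (rule DERIV_nonneg_imp_nondecreasing[OF assms])
    fix y :: real
    have "1 \<le> sqrt (y\<^sup>2 + 1)" by simp
    then have "1 / sqrt (y\<^sup>2 + 1) \<le> 1" by (subst pos_divide_le_eq) linarith+
    moreover have "((\<lambda>x. x - arsinh x) has_real_derivative 1 - 1 / sqrt (y\<^sup>2 + 1)) (at y)"
      by (rule DERIV_diff[OF DERIV_ident arsinh_real_has_field_derivative])
    ultimately show "\<exists>d. ((\<lambda>x. x - arsinh x) has_real_derivative d) (at y) \<and> 0 \<le> d" by fastforce
  qed
  then show "arsinh x \<le> x" by simp
qed

text \<open>The Yamada-Watanabe potential: \<open>\<bar>z\<bar> \<phi>''(z) \<le> 1\<close>, while \<open>\<phi>(z) \<longlongrightarrow> \<infinity>\<close> as \<open>\<delta> \<longlongrightarrow> 0\<close> for every \<open>z \<noteq> 0\<close>.\<close>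

definition yw :: "real \<Rightarrow> real \<Rightarrow> real" where
  "yw \<delta> z = z * arsinh (z / \<delta>) - sqrt (z\<^sup>2 + \<delta>\<^sup>2) + \<delta>"

context
  fixes \<delta> :: real
  assumes \<delta>: "\<delta> > 0"
begin

lemma yw_pos: "0 < z\<^sup>2 + \<delta>\<^sup>2"
  using \<delta> by (intro add_nonneg_pos) auto

lemma DERIV_yw1: "((\<lambda>z. arsinh (z / \<delta>)) has_real_derivative 1 / sqrt (z\<^sup>2 + \<delta>\<^sup>2)) (at z)"
proof -
  have "((\<lambda>z. arsinh (z / \<delta>)) has_real_derivative 1 / sqrt ((z / \<delta>)\<^sup>2 + 1) * (1 / \<delta>)) (at z)"
    by (rule DERIV_chain2[OF arsinh_real_has_field_derivative DERIV_cdivide[OF DERIV_ident]])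
  moreover have "sqrt ((z / \<delta>)\<^sup>2 + 1) * \<delta> = sqrt (z\<^sup>2 + \<delta>\<^sup>2)"
  proof -
    have "sqrt ((z / \<delta>)\<^sup>2 + 1) * \<delta> = sqrt ((z / \<delta>)\<^sup>2 + 1) * sqrt (\<delta>\<^sup>2)" using \<delta> by simp
    also have "\<dots> = sqrt (((z / \<delta>)\<^sup>2 + 1) * \<delta>\<^sup>2)" by (simp only: real_sqrt_mult)
    also have "((z / \<delta>)\<^sup>2 + 1) * \<delta>\<^sup>2 = z\<^sup>2 + \<delta>\<^sup>2" using \<delta> by (simp add: field_simps)
    finally show ?thesis .
  qed
  ultimately show ?thesis by (simp only: times_divide_eq_right mult_1_right divide_divide_eq_left)
qed

lemma DERIV_sqrt_yw: "((\<lambda>z. sqrt (z\<^sup>2 + \<delta>\<^sup>2)) has_real_derivative z / sqrt (z\<^sup>2 + \<delta>\<^sup>2)) (at z)"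
proof -
  have "((\<lambda>z. z\<^sup>2 + \<delta>\<^sup>2) has_real_derivative 2 * z) (at z)" by (auto intro!: derivative_eq_intros)
  from DERIV_chain2[OF DERIV_real_sqrt[OF yw_pos] this] show ?thesis
    by (simp add: field_simps inverse_eq_divide)
qed

lemma DERIV_yw2: "((\<lambda>z. 1 / sqrt (z\<^sup>2 + \<delta>\<^sup>2)) has_real_derivative - z / sqrt (z\<^sup>2 + \<delta>\<^sup>2) ^ 3) (at z)"
proof -
  let ?w = "sqrt (z\<^sup>2 + \<delta>\<^sup>2)"
  have w: "?w > 0" using yw_pos by simp
  then have "?w \<noteq> 0" by (rule less_imp_neq[symmetric])
  from DERIV_inverse'[OF DERIV_sqrt_yw this]
  have "((\<lambda>z. inverse (sqrt (z\<^sup>2 + \<delta>\<^sup>2))) has_real_derivative - (inverse ?w * (z / ?w) * inverse ?w)) (at z)" .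
  moreover have "- (inverse w * (z / w) * inverse w) = - z / w ^ 3" for w :: real
    by (simp add: divide_inverse power3_eq_cube)
  ultimately show ?thesis by (simp only: inverse_eq_divide)
qed

lemma DERIV_yw0: "(yw \<delta> has_real_derivative arsinh (z / \<delta>)) (at z)"
  unfolding yw_def[abs_def]
  using DERIV_add[OF DERIV_diff[OF DERIV_mult[OF DERIV_ident DERIV_yw1] DERIV_sqrt_yw] DERIV_const[of \<delta>], of z]
  by simp

lemma yw2_le: "1 / sqrt (z\<^sup>2 + \<delta>\<^sup>2) \<le> 1 / \<delta>"
  using \<delta> real_le_rsqrt[of \<delta> "z\<^sup>2 + \<delta>\<^sup>2"] by (intro divide_left_mono) (auto intro!: mult_pos_pos simp: yw_pos)

lemma yw3_le: "\<bar>- z / sqrt (z\<^sup>2 + \<delta>\<^sup>2) ^ 3\<bar> \<le> 1 / \<delta>\<^sup>2"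
proof -
  let ?w = "sqrt (z\<^sup>2 + \<delta>\<^sup>2)"
  have w: "?w > 0" using yw_pos by simp
  have "\<bar>z\<bar> \<le> ?w" by (rule real_le_rsqrt) simp
  have "\<bar>- z / ?w ^ 3\<bar> = \<bar>z\<bar> / ?w * (1 / ?w) * (1 / ?w)" using w by (simp add: abs_divide power3_eq_cube)
  also have "\<dots> \<le> 1 * (1 / \<delta>) * (1 / \<delta>)"
    using w \<open>\<bar>z\<bar> \<le> ?w\<close> yw2_le \<delta> by (intro mult_mono) auto
  finally show ?thesis by (simp add: power2_eq_square)
qed

text \<open>This replaces Ito's formula. For increments over time \<open>1 / N\<close> the cubic
  remainder has mean of order \<open>N\<close> to the power \<open>-3/2\<close>, hence vanishes
  after summation over \<open>N\<close> steps.\<close>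

lemma yw_taylor:
  "yw \<delta> (z + u) \<le> yw \<delta> z + arsinh (z / \<delta>) * u + 1 / sqrt (z\<^sup>2 + \<delta>\<^sup>2) * u\<^sup>2 / 2 + \<bar>u\<bar> ^ 3 / (6 * \<delta>\<^sup>2)"
proof (cases "u = 0")
  case False
  define D where "D m = (case m of 0 \<Rightarrow> yw \<delta> | Suc 0 \<Rightarrow> (\<lambda>z. arsinh (z / \<delta>)) | Suc (Suc 0) \<Rightarrow> (\<lambda>z. 1 / sqrt (z\<^sup>2 + \<delta>\<^sup>2))
    | _ \<Rightarrow> (\<lambda>z. - z / sqrt (z\<^sup>2 + \<delta>\<^sup>2) ^ 3))" for m :: nat
  have "\<exists>t. (if z + u < z then z + u < t \<and> t < z else z < t \<and> t < z + u) \<and>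
      yw \<delta> (z + u) = (\<Sum>m<3. D m z / fact m * ((z + u) - z) ^ m) + D 3 t / fact 3 * ((z + u) - z) ^ 3"
  proof (rule Taylor[where a = "min z (z + u)" and b = "max z (z + u)"])
    show "\<forall>m t. m < 3 \<and> min z (z + u) \<le> t \<and> t \<le> max z (z + u) \<longrightarrow> (D m has_real_derivative D (Suc m) t) (at t)"
      using DERIV_yw0 DERIV_yw1 DERIV_yw2 by (auto simp: D_def less_Suc_eq numeral_3_eq_3)
  qed (use False in \<open>auto simp: D_def\<close>)
  then obtain t where "yw \<delta> (z + u) = (\<Sum>m<3. D m z / fact m * u ^ m) + D 3 t / fact 3 * u ^ 3" by auto
  also have "(\<Sum>m<3. D m z / fact m * u ^ m) = yw \<delta> z + arsinh (z / \<delta>) * u + 1 / sqrt (z\<^sup>2 + \<delta>\<^sup>2) * u\<^sup>2 / 2"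
    by (simp add: D_def numeral_3_eq_3 numeral_2_eq_2)
  also have "D 3 t / fact 3 * u ^ 3 \<le> \<bar>D 3 t\<bar> / 6 * \<bar>u\<bar> ^ 3"
    using abs_ge_self[of "D 3 t / fact 3 * u ^ 3"] by (simp add: abs_mult power_abs fact_numeral)
  also have "\<dots> \<le> 1 / \<delta>\<^sup>2 / 6 * \<bar>u\<bar> ^ 3"
    using yw3_le[of t] by (intro mult_right_mono divide_right_mono) (auto simp: D_def numeral_3_eq_3)
  finally show ?thesis by simp
qed simp

lemma yw1_le: "\<bar>arsinh (z / \<delta>)\<bar> \<le> \<bar>z\<bar> / \<delta>"
proof -
  note * = arsinh_real_bounds
  show ?thesis
  proof (cases "0 \<le> z")
    case True
    then show ?thesis using *[of "z / \<delta>"] \<delta> by simp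
  next
    case False
    then have "0 \<le> - z / \<delta>" using \<delta> by (simp add: divide_nonpos_pos)
    then show ?thesis using *[of "- z / \<delta>"] \<delta> False by (simp add: arsinh_minus_real minus_divide_left[symmetric])
  qed
qed

lemma yw_even: "yw \<delta> (- z) = yw \<delta> z"
  by (simp add: yw_def arsinh_minus_real)

lemma yw_nonneg: "0 \<le> yw \<delta> z"
proof -
  have mono: "0 \<le> yw \<delta> z" if "0 \<le> z" for z
  proof -
    have "yw \<delta> 0 \<le> yw \<delta> z"
    proof (rule DERIV_nonneg_imp_nondecreasing[OF that])
      fix y :: real assume "0 \<le> y"
      then have "0 \<le> arsinh (y / \<delta>)" using \<delta> by (intro arsinh_real_bounds) simp
      then show "\<exists>d. (yw \<delta> has_real_derivative d) (at y) \<and> 0 \<le> d" using DERIV_yw0 by blast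
    qed
    then show ?thesis using \<delta> by (simp add: yw_def)
  qed
  show "0 \<le> yw \<delta> z" using mono[of z] mono[of "- z"] yw_even[of z] by (cases "0 \<le> z") auto
qed

text \<open>The growth is logarithmic in \<open>1 / \<delta>\<close>, by
  \<open>arsinh x \<ge> ln x\<close> and
  \<open>sqrt (z\<^sup>2 + \<delta>\<^sup>2) \<le> z + \<delta>\<close>. Together with a bounded
  expectation of the potential, Markov's inequality then makes \<open>\<bar>z\<bar> \<ge> r\<close>
  improbable.\<close>

lemma yw_ge:
  assumes "r > 0" "r \<le> \<bar>z\<bar>" "1 \<le> ln (r / \<delta>)"
  shows "r * (ln (r / \<delta>) - 1) \<le> yw \<delta> z"
proof -
  have *: "r * (ln (r / \<delta>) - 1) \<le> yw \<delta> z" if "r \<le> z" for z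
  proof -
    have z: "0 < z" using that assms by simp
    have "r / \<delta> \<le> z / \<delta> + sqrt ((z / \<delta>)\<^sup>2 + 1)"
      using that \<delta> by (intro add_increasing2) (auto simp: divide_right_mono)
    then have l: "ln (r / \<delta>) \<le> arsinh (z / \<delta>)"
      using assms \<delta> by (auto simp: arsinh_real_def intro!: ln_mono)
    have "sqrt (z\<^sup>2 + \<delta>\<^sup>2) \<le> z + \<delta>" using z \<delta> by (intro real_le_lsqrt) (auto simp: power2_sum)
    then have "z * (arsinh (z / \<delta>) - 1) \<le> yw \<delta> z" by (simp add: yw_def right_diff_distrib)
    moreover have "r * (ln (r / \<delta>) - 1) \<le> z * (arsinh (z / \<delta>) - 1)"
      using l that assms z by (intro mult_mono) auto
    ultimately show ?thesis by simp
  qed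
  show ?thesis using *[of z] *[of "- z"] yw_even[of z] assms(2) by (cases "0 \<le> z") auto
qed

lemma yw_measurable [measurable]: "yw \<delta> \<in> borel_measurable borel"
  using DERIV_yw0 by (intro borel_measurable_continuous_onI) (meson DERIV_isCont continuous_at_imp_continuous_on)

lemma yw1_measurable [measurable]: "(\<lambda>z. arsinh (z / \<delta>)) \<in> borel_measurable borel"
  using DERIV_yw1 by (intro borel_measurable_continuous_onI) (meson DERIV_isCont continuous_at_imp_continuous_on)

end

text \<open>In the Taylor expansion the linear term has mean zero, the quadratic one contributes
  half the time step, and the third absolute moment of the increment bounds the remainder.\<close>

lemma (in brownian_motion) expectation_yw_step:
  assumes st: "0 \<le> s" "s < t" and "\<delta> > 0" "C \<ge> 0"
    and V: "V \<in> borel_measurable (F s)" "integrable M (\<lambda>\<omega>. (V \<omega>)\<^sup>2)"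
    and c: "c \<in> borel_measurable (F s)" "\<And>\<omega>. \<bar>c \<omega>\<bar> \<le> C"
    and iV: "integrable M (\<lambda>\<omega>. yw \<delta> (V \<omega>))"
  shows "integrable M (\<lambda>\<omega>. yw \<delta> (V \<omega> + c \<omega> * (W t \<omega> - W s \<omega>)))"
    and "expectation (\<lambda>\<omega>. yw \<delta> (V \<omega> + c \<omega> * (W t \<omega> - W s \<omega>))) \<le> expectation (\<lambda>\<omega>. yw \<delta> (V \<omega>)) +
      (t - s) / 2 * expectation (\<lambda>\<omega>. 1 / sqrt ((V \<omega>)\<^sup>2 + \<delta>\<^sup>2) * (c \<omega>)\<^sup>2) + C ^ 3 * sqrt (t - s) ^ 3 / (3 * \<delta>\<^sup>2)"
proof -
  let ?D = "\<lambda>\<omega>. W t \<omega> - W s \<omega>"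
  note \<delta> = assms(3)
  note [measurable] = measurable_F_M[OF V(1)] measurable_F_M[OF c(1)] yw_measurable[OF \<delta>] yw1_measurable[OF \<delta>]
  have Wm [measurable]: "W t \<in> borel_measurable M" "W s \<in> borel_measurable M" using st by (auto intro: W_measurable_M)
  have V1: "integrable M V" using square_integrable_imp_integrable[OF measurable_F_M[OF V(1)] V(2)] .
  let ?a = "\<lambda>\<omega>. arsinh (V \<omega> / \<delta>) * c \<omega>" and ?b = "\<lambda>\<omega>. 1 / sqrt ((V \<omega>)\<^sup>2 + \<delta>\<^sup>2) * (c \<omega>)\<^sup>2"
  have aF: "?a \<in> borel_measurable (F s)"
    using measurable_compose[OF V(1) yw1_measurable[OF \<delta>]] c(1) by measurable
  have bF: "?b \<in> borel_measurable (F s)" using V(1) c(1) by measurable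
  have c2: "(c \<omega>)\<^sup>2 \<le> C\<^sup>2" for \<omega> using power_mono[OF c(2) abs_ge_zero, of \<omega> 2] by simp
  have ai: "integrable M ?a"
  proof (rule Bochner_Integration.integrable_bound)
    show "integrable M (\<lambda>\<omega>. C / \<delta> * V \<omega>)" using V1 by simp
    have "\<bar>arsinh (V \<omega> / \<delta>)\<bar> * \<bar>c \<omega>\<bar> \<le> \<bar>V \<omega>\<bar> / \<delta> * C" for \<omega>
      using yw1_le[OF \<delta>] c(2) \<delta> by (intro mult_mono) auto
    then show "AE \<omega> in M. norm (?a \<omega>) \<le> norm (C / \<delta> * V \<omega>)"
      using \<delta> assms(4) by (simp add: abs_mult mult_ac)
  qed measurable
  have bi: "integrable M ?b"
  proof (rule integrable_const_bound[where B = "1 / \<delta> * C\<^sup>2"])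
    have "1 / sqrt ((V \<omega>)\<^sup>2 + \<delta>\<^sup>2) * (c \<omega>)\<^sup>2 \<le> 1 / \<delta> * C\<^sup>2" for \<omega>
      using yw2_le[OF \<delta>] c2 \<delta> by (intro mult_mono) auto
    then show "AE \<omega> in M. norm (?b \<omega>) \<le> 1 / \<delta> * C\<^sup>2" by simp
  qed measurable
  have D: "integrable M ?D" "integrable M (\<lambda>\<omega>. (?D \<omega>)\<^sup>2)" "integrable M (\<lambda>\<omega>. \<bar>?D \<omega>\<bar> ^ 3)"
    using increment_moments(1)[OF st, of 1] increment_moments(1)[OF st, of 2] increment_moments(2)[OF st, of 3] by auto
  have ta: "integrable M (\<lambda>\<omega>. ?a \<omega> * ?D \<omega>)" "expectation (\<lambda>\<omega>. ?a \<omega> * ?D \<omega>) = 0"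
    using increment_mult[OF st aF ai measurable_ident_sets[OF refl] D(1)] unfolding increment_moments(3)[OF st] by simp_all
  have tb: "integrable M (\<lambda>\<omega>. ?b \<omega> * (?D \<omega>)\<^sup>2)" "expectation (\<lambda>\<omega>. ?b \<omega> * (?D \<omega>)\<^sup>2) = expectation ?b * (t - s)"
    using increment_mult[OF st bF bi _ D(2)] unfolding increment_moments(4)[OF st] by simp_all
  let ?R = "\<lambda>\<omega>. yw \<delta> (V \<omega>) + ?a \<omega> * ?D \<omega> + (?b \<omega> * (?D \<omega>)\<^sup>2) / 2 + C ^ 3 / (6 * \<delta>\<^sup>2) * \<bar>?D \<omega>\<bar> ^ 3"
  have le: "yw \<delta> (V \<omega> + c \<omega> * ?D \<omega>) \<le> ?R \<omega>" for \<omega>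
  proof -
    have "\<bar>c \<omega>\<bar> ^ 3 * \<bar>?D \<omega>\<bar> ^ 3 \<le> C ^ 3 * \<bar>?D \<omega>\<bar> ^ 3"
      using c(2) by (intro mult_right_mono power_mono) auto
    then have "\<bar>c \<omega> * ?D \<omega>\<bar> ^ 3 / (6 * \<delta>\<^sup>2) \<le> C ^ 3 * \<bar>?D \<omega>\<bar> ^ 3 / (6 * \<delta>\<^sup>2)"
      by (intro divide_right_mono) (auto simp: abs_mult power_mult_distrib)
    then show ?thesis using yw_taylor[OF \<delta>, of "V \<omega>" "c \<omega> * ?D \<omega>"] by (simp add: power_mult_distrib mult_ac)
  qed
  note i1 = Bochner_Integration.integrable_add[OF iV ta(1)]
  note i2 = Bochner_Integration.integrable_add[OF i1 integrable_divide[OF tb(1), of 2]]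
  have i3: "integrable M (\<lambda>\<omega>. C ^ 3 / (6 * \<delta>\<^sup>2) * \<bar>?D \<omega>\<bar> ^ 3)" using D(3) by (rule integrable_mult_right)
  have iR: "integrable M ?R" by (rule Bochner_Integration.integrable_add[OF i2 i3])
  show iy: "integrable M (\<lambda>\<omega>. yw \<delta> (V \<omega> + c \<omega> * ?D \<omega>))"
  proof (rule Bochner_Integration.integrable_bound[OF iR])
    show "AE \<omega> in M. norm (yw \<delta> (V \<omega> + c \<omega> * ?D \<omega>)) \<le> norm (?R \<omega>)"
    proof (rule AE_I2)
      fix \<omega>
      have "norm (yw \<delta> (V \<omega> + c \<omega> * ?D \<omega>)) = yw \<delta> (V \<omega> + c \<omega> * ?D \<omega>)"
        unfolding real_norm_def by (rule abs_of_nonneg[OF yw_nonneg[OF \<delta>]])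
      also have "\<dots> \<le> norm (?R \<omega>)"
        unfolding real_norm_def by (rule order_trans[OF le abs_ge_self])
      finally show "norm (yw \<delta> (V \<omega> + c \<omega> * ?D \<omega>)) \<le> norm (?R \<omega>)" .
    qed
    show "(\<lambda>\<omega>. yw \<delta> (V \<omega> + c \<omega> * ?D \<omega>)) \<in> borel_measurable M" by measurable
  qed
  have "expectation (\<lambda>\<omega>. yw \<delta> (V \<omega> + c \<omega> * ?D \<omega>)) \<le> expectation ?R"
    by (rule integral_mono[OF iy iR le])
  moreover have "expectation ?R = expectation (\<lambda>\<omega>. yw \<delta> (V \<omega>) + ?a \<omega> * ?D \<omega> + (?b \<omega> * (?D \<omega>)\<^sup>2) / 2) +
      expectation (\<lambda>\<omega>. C ^ 3 / (6 * \<delta>\<^sup>2) * \<bar>?D \<omega>\<bar> ^ 3)"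
    by (rule Bochner_Integration.integral_add[OF i2 i3])
  moreover have "expectation (\<lambda>\<omega>. yw \<delta> (V \<omega>) + ?a \<omega> * ?D \<omega> + (?b \<omega> * (?D \<omega>)\<^sup>2) / 2) =
      expectation (\<lambda>\<omega>. yw \<delta> (V \<omega>) + ?a \<omega> * ?D \<omega>) + expectation (\<lambda>\<omega>. (?b \<omega> * (?D \<omega>)\<^sup>2) / 2)"
    by (rule Bochner_Integration.integral_add[OF i1 integrable_divide[OF tb(1)]])
  moreover have "expectation (\<lambda>\<omega>. yw \<delta> (V \<omega>) + ?a \<omega> * ?D \<omega>) = expectation (\<lambda>\<omega>. yw \<delta> (V \<omega>)) + 0"
    unfolding Bochner_Integration.integral_add[OF iV ta(1)] ta(2) ..
  moreover have "expectation (\<lambda>\<omega>. (?b \<omega> * (?D \<omega>)\<^sup>2) / 2) = expectation ?b * (t - s) / 2"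
    unfolding integral_divide_zero tb(2) ..
  moreover have "expectation (\<lambda>\<omega>. C ^ 3 / (6 * \<delta>\<^sup>2) * \<bar>?D \<omega>\<bar> ^ 3) = C ^ 3 / (6 * \<delta>\<^sup>2) * expectation (\<lambda>\<omega>. \<bar>?D \<omega>\<bar> ^ 3)"
    by (rule integral_mult_right_zero)
  moreover have "C ^ 3 / (6 * \<delta>\<^sup>2) * expectation (\<lambda>\<omega>. \<bar>?D \<omega>\<bar> ^ 3) \<le> C ^ 3 / (6 * \<delta>\<^sup>2) * (2 * sqrt (t - s) ^ 3)"
    using increment_moments(5)[OF st] assms(4) by (intro mult_left_mono) auto
  ultimately have "expectation (\<lambda>\<omega>. yw \<delta> (V \<omega> + c \<omega> * ?D \<omega>)) \<le> expectation (\<lambda>\<omega>. yw \<delta> (V \<omega>)) +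
      expectation ?b * (t - s) / 2 + C ^ 3 / (6 * \<delta>\<^sup>2) * (2 * sqrt (t - s) ^ 3)"
    by linarith
  moreover have "C ^ 3 / (6 * \<delta>\<^sup>2) * (2 * sqrt (t - s) ^ 3) = C ^ 3 * sqrt (t - s) ^ 3 / (3 * \<delta>\<^sup>2)"
    by (simp add: field_simps)
  ultimately show "expectation (\<lambda>\<omega>. yw \<delta> (V \<omega> + c \<omega> * ?D \<omega>)) \<le> expectation (\<lambda>\<omega>. yw \<delta> (V \<omega>)) +
      (t - s) / 2 * expectation ?b + C ^ 3 * sqrt (t - s) ^ 3 / (3 * \<delta>\<^sup>2)"
    by (simp add: mult.commute)
qed

section \<open>Comparison of the solution with the reflected walk\<close>

locale squared_bessel = brownian_motion M F W
  for M :: "'a measure" and F :: "real \<Rightarrow> 'a measure" and W :: "real \<Rightarrow> 'a \<Rightarrow> real" +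
  fixes X :: "real \<Rightarrow> 'a \<Rightarrow> real" and J :: "real \<Rightarrow> 'a \<Rightarrow> real" and a :: real
  assumes a_nonneg: "0 \<le> a"
    and X_progressive: "progressively_measurable F X"
    and X_continuous: "AE \<omega> in M. continuous_on {0..} (\<lambda>t. X t \<omega>)"
    and X_nonneg: "AE \<omega> in M. \<forall>t\<ge>0. X t \<omega> \<ge> 0"
    and J_integral: "\<And>t. 0 \<le> t \<Longrightarrow> has_ito_integral M F W (\<lambda>s \<omega>. 2 * sqrt (X s \<omega>)) t (J t)"
    and X_eq: "\<And>t. 0 \<le> t \<Longrightarrow> AE \<omega> in M. X t \<omega> = a\<^sup>2 + t + J t \<omega>"
begin

abbreviation R :: "nat \<Rightarrow> nat \<Rightarrow> 'a \<Rightarrow> real" where "R \<equiv> refl_walk a"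

abbreviation Y :: "nat \<Rightarrow> nat \<Rightarrow> 'a \<Rightarrow> real" where "Y N j \<omega> \<equiv> sqrt (X (real j / real N) \<omega>)"

text \<open>Each bracket is the error of a Riemann sum in the equation of the respective square. The
  difference of the squares is the discrete integral of \<open>2 * (Y - R)\<close> minus this
  quantity.\<close>

definition gap :: "nat \<Rightarrow> nat \<Rightarrow> 'a \<Rightarrow> real" where
  "gap N j \<omega> = ((\<Sum>i<j. 2 * Y N i \<omega> * step N i \<omega>) - J (real j / real N) \<omega>) -
    ((\<Sum>i<j. 2 * R N i \<omega> * step N i \<omega>) - ((R N j \<omega>)\<^sup>2 - a\<^sup>2 - real j / real N))"

lemma X_F: "0 \<le> t \<Longrightarrow> X t \<in> borel_measurable (F t)"
  by (rule progressively_measurable_adapted[OF X_progressive])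

lemma X_M: "0 \<le> t \<Longrightarrow> X t \<in> borel_measurable M"
  by (rule measurable_F_M[OF X_F])

lemma J_M: "0 \<le> t \<Longrightarrow> J t \<in> borel_measurable M"
  using J_integral[of t] by (simp add: has_ito_integral_def)

lemma R_nonneg: "0 \<le> R N j \<omega>"
  unfolding refl_walk_def by (rule reflected_nonneg[OF a_nonneg])

lemma Y_M [measurable]: "Y N j \<in> borel_measurable M"
proof -
  have "X (real j / real N) \<in> borel_measurable M" by (rule X_M) simp
  then show ?thesis by measurable
qed

lemma gap_M [measurable]: "gap N j \<in> borel_measurable M"
proof -
  have [measurable]: "J (real j / real N) \<in> borel_measurable M" by (rule J_M) simp
  note [measurable] = refl_walk_M
  show ?thesis unfolding gap_def[abs_def] by measurable
qed

lemma gap_uniform: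
  assumes "\<epsilon> > 0" "\<eta> > 0"
  shows "\<forall>\<^sub>F N in sequentially. \<forall>j\<le>N. prob {\<omega>\<in>space M. \<bar>gap N j \<omega>\<bar> > \<epsilon>} \<le> \<eta>"
proof -
  have H: "progressively_measurable F (\<lambda>s \<omega>. 2 * sqrt (X s \<omega>))"
    using J_integral[of 0] by (simp add: has_ito_integral_def ito_integrand_def)
  have c: "AE \<omega> in M. continuous_on {0..} (\<lambda>t. 2 * sqrt (X t \<omega>))"
    using X_continuous by eventually_elim (intro continuous_intros)
  have e: "\<epsilon> / 2 > 0" "\<eta> / 2 > 0" using assms by auto
  have "\<forall>\<^sub>F N in sequentially. \<forall>j\<le>N.
      prob {\<omega>\<in>space M. \<bar>(\<Sum>i<j. 2 * Y N i \<omega> * step N i \<omega>) - J (real j / real N) \<omega>\<bar> > \<epsilon> / 2} \<le> \<eta> / 2"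
    by (rule riemann_sums_uniform[OF H c J_integral e])
  then show ?thesis
    using refl_walk_uniform[OF a_nonneg e]
  proof eventually_elim
    case (elim N)
    show ?case
    proof (intro allI impI)
      fix j assume j: "j \<le> N"
      let ?A = "\<lambda>\<omega>. (\<Sum>i<j. 2 * Y N i \<omega> * step N i \<omega>) - J (real j / real N) \<omega>"
      let ?B = "\<lambda>\<omega>. (\<Sum>i<j. 2 * R N i \<omega> * step N i \<omega>) - ((R N j \<omega>)\<^sup>2 - a\<^sup>2 - real j / real N)"
      have [measurable]: "J (real j / real N) \<in> borel_measurable M" by (rule J_M) simp
      note [measurable] = refl_walk_M
      have "prob {\<omega>\<in>space M. \<bar>gap N j \<omega>\<bar> > \<epsilon>} \<le>
        prob ({\<omega>\<in>space M. \<bar>?A \<omega>\<bar> > \<epsilon> / 2} \<union> {\<omega>\<in>space M. \<bar>?B \<omega>\<bar> > \<epsilon> / 2})"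
      proof (rule finite_measure_mono)
        show "{\<omega>\<in>space M. \<bar>gap N j \<omega>\<bar> > \<epsilon>} \<subseteq> {\<omega>\<in>space M. \<bar>?A \<omega>\<bar> > \<epsilon> / 2} \<union> {\<omega>\<in>space M. \<bar>?B \<omega>\<bar> > \<epsilon> / 2}"
        proof
          fix \<omega> assume "\<omega> \<in> {\<omega>\<in>space M. \<bar>gap N j \<omega>\<bar> > \<epsilon>}"
          then have w: "\<omega> \<in> space M" "\<bar>?A \<omega> - ?B \<omega>\<bar> > \<epsilon>" unfolding gap_def by blast+
          from w(2) have "\<bar>?A \<omega>\<bar> > \<epsilon> / 2 \<or> \<bar>?B \<omega>\<bar> > \<epsilon> / 2" by linarith
          then show "\<omega> \<in> {\<omega>\<in>space M. \<bar>?A \<omega>\<bar> > \<epsilon> / 2} \<union> {\<omega>\<in>space M. \<bar>?B \<omega>\<bar> > \<epsilon> / 2}"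
            using w(1) by blast
        qed
      qed measurable
      also have "\<dots> \<le> prob {\<omega>\<in>space M. \<bar>?A \<omega>\<bar> > \<epsilon> / 2} + prob {\<omega>\<in>space M. \<bar>?B \<omega>\<bar> > \<epsilon> / 2}"
        by (rule measure_Un_le) measurable
      also have "\<dots> \<le> \<eta> / 2 + \<eta> / 2" using elim j by (intro add_mono) blast+
      finally show "prob {\<omega>\<in>space M. \<bar>gap N j \<omega>\<bar> > \<epsilon>} \<le> \<eta>" by simp
    qed
  qed
qed

text \<open>Quantifying over all earlier grid times makes this a stopping rule: while it holds, no
  earlier coefficient has been cut. The absolute value covers the null set where the solution is
  negative, since \<open>sqrt\<close> is negative there; the coefficients are thus bounded
  everywhere.\<close>

definition below :: "real \<Rightarrow> nat \<Rightarrow> nat \<Rightarrow> 'a \<Rightarrow> bool" where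
  "below C N j \<omega> \<longleftrightarrow> (\<forall>l\<in>{..j}. \<bar>Y N l \<omega>\<bar> \<le> C \<and> R N l \<omega> \<le> C)"

definition diff_coef :: "real \<Rightarrow> nat \<Rightarrow> nat \<Rightarrow> 'a \<Rightarrow> real" where
  "diff_coef C N j \<omega> = (if below C N j \<omega> then 2 * (Y N j \<omega> - R N j \<omega>) else 0)"

definition diff_mart :: "real \<Rightarrow> nat \<Rightarrow> nat \<Rightarrow> 'a \<Rightarrow> real" where
  "diff_mart C N j \<omega> = (\<Sum>i<j. diff_coef C N i \<omega> * step N i \<omega>)"

lemma grid_F:
  assumes "l \<le> j"
  shows "Y N l \<in> borel_measurable (F (real j / real N))" "R N l \<in> borel_measurable (F (real j / real N))"
proof -
  have le: "real l / real N \<le> real j / real N" using assms by (intro divide_right_mono) auto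
  have "X (real l / real N) \<in> borel_measurable (F (real j / real N))"
    by (rule measurable_F_mono[OF X_F le]) simp
  then show "Y N l \<in> borel_measurable (F (real j / real N))" by measurable
  show "R N l \<in> borel_measurable (F (real j / real N))"
    by (rule measurable_F_mono[OF refl_walk_F le])
qed

lemma diff_coef_F: "diff_coef C N j \<in> borel_measurable (F (real j / real N))"
proof -
  let ?F = "F (real j / real N)"
  have b: "{\<omega> \<in> space ?F. below C N j \<omega>} \<in> sets ?F"
    unfolding below_def
  proof (rule sets.sets_Collect_finite_All)
    fix l assume "l \<in> {..j}"
    then have "l \<le> j" by simp
    have [measurable]: "Y N l \<in> borel_measurable ?F" "R N l \<in> borel_measurable ?F"
      by (rule grid_F[OF \<open>l \<le> j\<close>])+
    show "{\<omega> \<in> space ?F. \<bar>Y N l \<omega>\<bar> \<le> C \<and> R N l \<omega> \<le> C} \<in> sets ?F" by measurable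
  qed simp
  have m: "(\<lambda>\<omega>. 2 * (Y N j \<omega> - R N j \<omega>)) \<in> borel_measurable ?F"
    by (intro borel_measurable_times borel_measurable_diff borel_measurable_const grid_F order_refl)
  show ?thesis unfolding diff_coef_def[abs_def]
    by (rule measurable_If[OF m borel_measurable_const b])
qed

lemma diff_coef_bound:
  assumes "0 \<le> C"
  shows "\<bar>diff_coef C N j \<omega>\<bar> \<le> 4 * C"
proof (cases "below C N j \<omega>")
  case True
  then have "\<bar>Y N j \<omega>\<bar> \<le> C" "R N j \<omega> \<le> C" unfolding below_def by blast+
  moreover have "\<bar>2 * (y - r)\<bar> \<le> 4 * C" if "\<bar>y\<bar> \<le> C" "0 \<le> r" "r \<le> C" for y r
    using that by (auto simp: abs_le_iff)
  ultimately have "\<bar>2 * (Y N j \<omega> - R N j \<omega>)\<bar> \<le> 4 * C" using R_nonneg by blast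
  then show ?thesis using True by (simp add: diff_coef_def)
qed (use assms in \<open>simp add: diff_coef_def\<close>)

lemma diff_mart_eq:
  assumes "below C N j \<omega>" "X (real j / real N) \<omega> = a\<^sup>2 + real j / real N + J (real j / real N) \<omega>"
  shows "diff_mart C N j \<omega> = X (real j / real N) \<omega> - (R N j \<omega>)\<^sup>2 + gap N j \<omega>"
proof -
  have b: "below C N i \<omega>" if "i < j" for i
    using assms(1) that unfolding below_def by (auto dest: order_less_imp_le order_trans)
  have "diff_mart C N j \<omega> = (\<Sum>i<j. 2 * Y N i \<omega> * step N i \<omega> - 2 * R N i \<omega> * step N i \<omega>)"
    unfolding diff_mart_def
  proof (intro sum.cong refl)
    fix i assume "i \<in> {..<j}"
    then have "diff_coef C N i \<omega> = 2 * (Y N i \<omega> - R N i \<omega>)" using b[of i] by (simp add: diff_coef_def)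
    then show "diff_coef C N i \<omega> * step N i \<omega> = 2 * Y N i \<omega> * step N i \<omega> - 2 * R N i \<omega> * step N i \<omega>"
      by (simp only: right_diff_distrib left_diff_distrib mult.assoc)
  qed
  then have "diff_mart C N j \<omega> = (\<Sum>i<j. 2 * Y N i \<omega> * step N i \<omega>) - (\<Sum>i<j. 2 * R N i \<omega> * step N i \<omega>)"
    by (simp only: sum_subtractf)
  then show ?thesis using assms(2) unfolding gap_def by linarith
qed

lemma diff_mart_L2:
  assumes "0 \<le> C" "N > 0"
  shows "diff_mart C N j \<in> borel_measurable (F (real j / real N))"
    and "integrable M (\<lambda>\<omega>. (diff_mart C N j \<omega>)\<^sup>2)"
  unfolding diff_mart_def[abs_def] step_def
  by (rule discrete_integral_L2[where s = "\<lambda>i. real i / real N", OF _ grid_step(2)[OF assms(2)] diff_coef_F diff_coef_bound[OF assms(1)]]; simp)+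

text \<open>Hoelder continuity of the square root with exponent 1/2, from
  \<open>\<bar>y - r\<bar> \<le> y + r\<close>.\<close>

lemma square_diff_le:
  fixes y r :: real
  assumes "0 \<le> y" "0 \<le> r"
  shows "(y - r)\<^sup>2 \<le> \<bar>y\<^sup>2 - r\<^sup>2\<bar>"
proof -
  have "(y - r)\<^sup>2 = \<bar>y - r\<bar> * \<bar>y - r\<bar>" by (simp add: power2_eq_square)
  also have "\<dots> \<le> \<bar>y - r\<bar> * (y + r)" using assms by (intro mult_left_mono) auto
  also have "\<dots> = \<bar>(y - r) * (y + r)\<bar>" using assms by (simp add: abs_mult)
  also have "(y - r) * (y + r) = y\<^sup>2 - r\<^sup>2" by (simp add: power2_eq_square algebra_simps)
  finally show ?thesis .
qed

text \<open>The cancellation behind uniqueness: \<open>(Y - R)\<^sup>2 \<le> \<bar>Y\<^sup>2 - R\<^sup>2\<bar>\<close> is compensated by the second derivative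
  of the potential.\<close>

lemma diff_coef_potential:
  assumes "\<delta> > 0" "0 \<le> C" "X (real j / real N) \<omega> = a\<^sup>2 + real j / real N + J (real j / real N) \<omega>"
    and "0 \<le> X (real j / real N) \<omega>" and that: "\<omega> \<in> space M"
  shows "1 / sqrt ((diff_mart C N j \<omega>)\<^sup>2 + \<delta>\<^sup>2) * (diff_coef C N j \<omega>)\<^sup>2 \<le>
    9 / 2 + 16 * C\<^sup>2 / \<delta> * indicator {\<omega>\<in>space M. \<bar>gap N j \<omega>\<bar> > \<delta> / 8} \<omega>"
proof -
  let ?m = "diff_mart C N j \<omega>" and ?c = "diff_coef C N j \<omega>"
  let ?w = "sqrt (?m\<^sup>2 + \<delta>\<^sup>2)"
  have w: "0 < ?w" using yw_pos[OF assms(1)] by simp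
  have wm: "\<bar>?m\<bar> \<le> ?w" "\<delta> \<le> ?w" using assms(1) by (auto intro!: real_le_rsqrt)
  show ?thesis
  proof (cases "\<bar>gap N j \<omega>\<bar> > \<delta> / 8")
    \<comment> \<open>Where the gap is large only the crude bounds \<open>4 * C\<close> and
      \<open>1 / \<delta>\<close> are available; such events will have small probability.\<close>
    case True
    have "?c\<^sup>2 \<le> (4 * C)\<^sup>2" using power_mono[OF diff_coef_bound[OF assms(2)] abs_ge_zero, of N j \<omega> 2] by simp
    then have "1 / ?w * ?c\<^sup>2 \<le> 1 / \<delta> * (4 * C)\<^sup>2"
      using yw2_le[OF assms(1)] assms(1) by (intro mult_mono) auto
    then show ?thesis using True that by (simp add: power_mult_distrib)
  next
    case gap: False
    show ?thesis
    proof (cases "below C N j \<omega>")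
      case True
      have "?c\<^sup>2 = 4 * (Y N j \<omega> - R N j \<omega>)\<^sup>2" unfolding diff_coef_def if_P[OF True] power_mult_distrib by simp
      also have "\<dots> \<le> 4 * \<bar>(Y N j \<omega>)\<^sup>2 - (R N j \<omega>)\<^sup>2\<bar>"
        using square_diff_le[OF _ R_nonneg, of "Y N j \<omega>" N j \<omega>] assms(4) by simp
      also have "(Y N j \<omega>)\<^sup>2 = X (real j / real N) \<omega>" using assms(4) by simp
      also have "4 * \<bar>X (real j / real N) \<omega> - (R N j \<omega>)\<^sup>2\<bar> \<le> 4 * \<bar>?m\<bar> + \<delta> / 2"
      proof -
        have "\<bar>X (real j / real N) \<omega> - (R N j \<omega>)\<^sup>2\<bar> = \<bar>?m - gap N j \<omega>\<bar>"
          unfolding diff_mart_eq[OF True assms(3)] by simp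
        also have "\<dots> \<le> \<bar>?m\<bar> + \<bar>gap N j \<omega>\<bar>" by (rule abs_triangle_ineq4)
        finally have "\<bar>X (real j / real N) \<omega> - (R N j \<omega>)\<^sup>2\<bar> \<le> \<bar>?m\<bar> + \<bar>gap N j \<omega>\<bar>" .
        moreover have "4 * u \<le> 4 * v + \<delta> / 2" if "u \<le> v + w" "\<not> \<delta> / 8 < w" for u v w :: real
          using that by linarith
        ultimately show ?thesis using gap by blast
      qed
      \<comment> \<open>Both \<open>\<bar>?m\<bar>\<close> and \<open>\<delta>\<close> are at most
        \<open>?w\<close>, and \<open>4 + 1 / 2 = 9 / 2\<close>.\<close>
      also have "\<dots> \<le> 9 / 2 * ?w" using wm by linarith
      finally have "?c\<^sup>2 \<le> 9 / 2 * ?w" .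
      then have "?c\<^sup>2 / ?w \<le> 9 / 2" using w by (subst pos_divide_le_eq)
      then show ?thesis using gap by simp
    next
      case False
      then show ?thesis using gap by (simp add: diff_coef_def)
    qed
  qed
qed

lemma grid_AE:
  "AE \<omega> in M. X (real j / real N) \<omega> = a\<^sup>2 + real j / real N + J (real j / real N) \<omega> \<and> 0 \<le> X (real j / real N) \<omega>"
proof -
  have t: "0 \<le> real j / real N" by simp
  show ?thesis using X_eq[OF t] X_nonneg by eventually_elim (use t in blast)
qed

text \<open>Summing the one-step estimates over \<open>N\<close> steps of length
  \<open>1 / N\<close> leaves \<open>9 / 4\<close>, a bound independent of \<open>\<delta>\<close>.
  The two other terms become small for fixed \<open>\<delta>\<close> and \<open>C\<close>, through
  \<open>\<theta>\<close> and through \<open>N\<close>.\<close>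

lemma expectation_potential:
  assumes "\<delta> > 0" "0 \<le> C" "N > 0" "\<And>j. j \<le> N \<Longrightarrow> prob {\<omega>\<in>space M. \<bar>gap N j \<omega>\<bar> > \<delta> / 8} \<le> \<theta>"
  shows "integrable M (\<lambda>\<omega>. yw \<delta> (diff_mart C N N \<omega>))"
    and "expectation (\<lambda>\<omega>. yw \<delta> (diff_mart C N N \<omega>)) \<le> 9 / 4 + 8 * C\<^sup>2 / \<delta> * \<theta> + (4 * C) ^ 3 / (3 * \<delta>\<^sup>2) * (1 / sqrt (real N))"
proof -
  \<comment> \<open>The growth allowed in one step: half a time step times the bound on the
    second-order term, plus the Taylor remainder with coefficient bound
    \<open>4 * C\<close>.\<close>
  define A where "A = (1 / real N) / 2 * (9 / 2 + 16 * C\<^sup>2 / \<delta> * \<theta>) + (4 * C) ^ 3 * sqrt (1 / real N) ^ 3 / (3 * \<delta>\<^sup>2)"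
  have ind: "integrable M (\<lambda>\<omega>. yw \<delta> (diff_mart C N j \<omega>)) \<and> expectation (\<lambda>\<omega>. yw \<delta> (diff_mart C N j \<omega>)) \<le> real j * A" if "j \<le> N" for j
    using that
  proof (induction j)
    case 0
    have "yw \<delta> 0 = 0" using assms(1) by (simp add: yw_def)
    then show ?case by (simp add: diff_mart_def)
  next
    case (Suc j)
    then have j: "j \<le> N" and iV: "integrable M (\<lambda>\<omega>. yw \<delta> (diff_mart C N j \<omega>))"
      and EV: "expectation (\<lambda>\<omega>. yw \<delta> (diff_mart C N j \<omega>)) \<le> real j * A" by auto
    note m = diff_mart_L2[OF assms(2,3), of j]
    have C4: "0 \<le> 4 * C" using assms(2) by simp
    note st = expectation_yw_step[OF grid_step(1,2)[OF assms(3)] assms(1) C4 m diff_coef_F diff_coef_bound[OF assms(2)] iV,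
        unfolded grid_step(3)[OF assms(3)]]
    have eq: "diff_mart C N (Suc j) \<omega> = diff_mart C N j \<omega> + diff_coef C N j \<omega> * (W (real (Suc j) / real N) \<omega> - W (real j / real N) \<omega>)" for \<omega>
      by (simp add: diff_mart_def step_def)
    let ?b = "\<lambda>\<omega>. 1 / sqrt ((diff_mart C N j \<omega>)\<^sup>2 + \<delta>\<^sup>2) * (diff_coef C N j \<omega>)\<^sup>2"
    let ?G = "{\<omega>\<in>space M. \<bar>gap N j \<omega>\<bar> > \<delta> / 8}"
    have [measurable]: "diff_mart C N j \<in> borel_measurable M" "diff_coef C N j \<in> borel_measurable M"
      by (rule measurable_F_M[OF m(1)], rule measurable_F_M[OF diff_coef_F])
    have Gm: "?G \<in> events" by measurable
    have le: "AE \<omega> in M. ?b \<omega> \<le> 9 / 2 + 16 * C\<^sup>2 / \<delta> * indicator ?G \<omega>"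
      using grid_AE[of j N] AE_space
    proof eventually_elim
      case (elim \<omega>)
      then show ?case using diff_coef_potential[OF assms(1,2)] by blast
    qed
    have iG: "integrable M (indicator ?G :: 'a \<Rightarrow> real)"
      by (rule integrable_real_indicator[OF Gm]) (simp add: emeasure_eq_measure)
    have iI: "integrable M (\<lambda>\<omega>. 9 / 2 + 16 * C\<^sup>2 / \<delta> * indicator ?G \<omega> :: real)"
      by (intro Bochner_Integration.integrable_add integrable_mult_right iG) simp
    have ib: "integrable M ?b"
    proof (rule Bochner_Integration.integrable_bound[OF iI])
      show "AE \<omega> in M. norm (?b \<omega>) \<le> norm (9 / 2 + 16 * C\<^sup>2 / \<delta> * indicator ?G \<omega> :: real)"
        using le
      proof eventually_elim
        case (elim \<omega>)
        have "0 \<le> ?b \<omega>" by simp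
        then show ?case using elim by (simp only: real_norm_def)
      qed
    qed measurable
    have "expectation ?b \<le> expectation (\<lambda>\<omega>. 9 / 2 + 16 * C\<^sup>2 / \<delta> * indicator ?G \<omega>)"
      by (rule integral_mono_AE[OF ib iI le])
    also have "\<dots> = 9 / 2 + 16 * C\<^sup>2 / \<delta> * prob ?G"
    proof -
      have "expectation (\<lambda>\<omega>. 9 / 2 + 16 * C\<^sup>2 / \<delta> * indicator ?G \<omega>) =
          expectation (\<lambda>\<omega>. 9 / 2) + expectation (\<lambda>\<omega>. 16 * C\<^sup>2 / \<delta> * indicator ?G \<omega>)"
        by (intro Bochner_Integration.integral_add integrable_mult_right iG) simp
      moreover have "expectation (indicator ?G) = prob ?G" using Gm by simp
      ultimately show ?thesis unfolding integral_mult_right_zero by (simp add: prob_space)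
    qed
    also have "\<dots> \<le> 9 / 2 + 16 * C\<^sup>2 / \<delta> * \<theta>"
      using assms(4)[OF j] assms(1) by (intro add_left_mono mult_left_mono) auto
    finally have "(1 / real N) / 2 * expectation ?b \<le> (1 / real N) / 2 * (9 / 2 + 16 * C\<^sup>2 / \<delta> * \<theta>)"
      by (intro mult_left_mono) auto
    then have "expectation (\<lambda>\<omega>. yw \<delta> (diff_mart C N (Suc j) \<omega>)) \<le> real j * A + A"
      unfolding eq using st(2) EV unfolding A_def by linarith
    moreover have "integrable M (\<lambda>\<omega>. yw \<delta> (diff_mart C N (Suc j) \<omega>))" unfolding eq by (rule st(1))
    ultimately show ?case by (simp add: algebra_simps)
  qed
  then show "integrable M (\<lambda>\<omega>. yw \<delta> (diff_mart C N N \<omega>))" by blast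
  have "real N * sqrt (1 / real N) ^ 3 = 1 / sqrt (real N)"
    using assms(3) by (simp add: power3_eq_cube real_sqrt_divide field_simps)
  then have "real N * (u * sqrt (1 / real N) ^ 3 / v) = u / v * (1 / sqrt (real N))" for u v :: real
    by (metis mult.left_commute times_divide_eq_left times_divide_eq_right)
  moreover have "real N * ((1 / real N) / 2 * (9 / 2 + u)) = 9 / 4 + u / 2" for u :: real
    using assms(3) by (simp add: field_simps)
  ultimately have "real N * A = 9 / 4 + (16 * C\<^sup>2 / \<delta> * \<theta>) / 2 + (4 * C) ^ 3 / (3 * \<delta>\<^sup>2) * (1 / sqrt (real N))"
    unfolding A_def distrib_left[of "real N"] by (simp only:)
  moreover have "(16 * C\<^sup>2 / \<delta> * \<theta>) / 2 = 8 * C\<^sup>2 / \<delta> * \<theta>" by simp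
  ultimately have "real N * A = 9 / 4 + 8 * C\<^sup>2 / \<delta> * \<theta> + (4 * C) ^ 3 / (3 * \<delta>\<^sup>2) * (1 / sqrt (real N))"
    by (simp only:)
  then show "expectation (\<lambda>\<omega>. yw \<delta> (diff_mart C N N \<omega>)) \<le> 9 / 4 + 8 * C\<^sup>2 / \<delta> * \<theta> + (4 * C) ^ 3 / (3 * \<delta>\<^sup>2) * (1 / sqrt (real N))"
    using ind[OF order_refl] by linarith
qed

section \<open>Localization and passage to the limit\<close>

definition exceeds :: "nat \<Rightarrow> 'a set" where
  "exceeds k = {\<omega>\<in>space M. \<exists>q\<in>\<rat> \<inter> {0..1}. real k < \<bar>W q \<omega>\<bar> + \<bar>sqrt (X q \<omega>)\<bar>}"

text \<open>Rational times keep the union countable and still include every grid time.\<close>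

lemma exceeds_events: "exceeds k \<in> events"
proof -
  have "exceeds k = (\<Union>q\<in>\<rat> \<inter> {0..1}. {\<omega>\<in>space M. real k < \<bar>W q \<omega>\<bar> + \<bar>sqrt (X q \<omega>)\<bar>})"
    by (auto simp: exceeds_def)
  also have "\<dots> \<in> events"
  proof (rule sets.countable_UN'')
    show "countable (\<rat> \<inter> {0..1::real})" using countable_rat by blast
    fix q :: real assume "q \<in> \<rat> \<inter> {0..1}"
    then have [measurable]: "W q \<in> borel_measurable M" "X q \<in> borel_measurable M"
      by (auto intro: W_measurable_M X_M)
    show "{\<omega>\<in>space M. real k < \<bar>W q \<omega>\<bar> + \<bar>sqrt (X q \<omega>)\<bar>} \<in> events" by measurable
  qed
  finally show ?thesis .
qed

lemma exceeds_tendsto: "(\<lambda>k. prob (exceeds k)) \<longlonglongrightarrow> 0"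
proof (rule prob_tendsto_0[OF exceeds_events])
  show "AE \<omega> in M. \<forall>\<^sub>F k in sequentially. \<omega> \<notin> exceeds k"
    using continuous_paths X_continuous
  proof eventually_elim
    case (elim \<omega>)
    have "continuous_on {0..1} (\<lambda>t. \<bar>W t \<omega>\<bar> + \<bar>sqrt (X t \<omega>)\<bar>)"
      by (intro continuous_intros continuous_on_subset[OF elim(1)] continuous_on_subset[OF elim(2)]) auto
    then have "bounded ((\<lambda>t. \<bar>W t \<omega>\<bar> + \<bar>sqrt (X t \<omega>)\<bar>) ` {0..1})"
      by (intro compact_imp_bounded compact_continuous_image) auto
    then obtain B where "\<forall>y\<in>(\<lambda>t. \<bar>W t \<omega>\<bar> + \<bar>sqrt (X t \<omega>)\<bar>) ` {0..1}. norm y \<le> B"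
      unfolding bounded_iff by blast
    then have B: "\<bar>W t \<omega>\<bar> + \<bar>sqrt (X t \<omega>)\<bar> \<le> B" if "t \<in> {0..1}" for t
      using that by fastforce
    have "\<forall>\<^sub>F k in sequentially. B \<le> real k"
      using filterlim_real_sequentially unfolding filterlim_at_top by blast
    then show ?case
    proof eventually_elim
      case (elim k)
      then show ?case using B unfolding exceeds_def by (fastforce simp: not_less)
    qed
  qed
qed

lemma below_if_not_exceeds:
  assumes "\<omega> \<in> space M - exceeds k" "N > 0"
  shows "below (a + 4 * real k) N N \<omega>"
  unfolding below_def
proof (intro ballI)
  have bd: "\<bar>W (real l / real N) \<omega>\<bar> \<le> real k" "\<bar>Y N l \<omega>\<bar> \<le> real k" if "l \<le> N" for l
  proof -
    have "real l / real N \<in> \<rat> \<inter> {0..1}" using that assms(2) by auto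
    then have "\<bar>W (real l / real N) \<omega>\<bar> + \<bar>Y N l \<omega>\<bar> \<le> real k" using assms(1) unfolding exceeds_def by (auto simp: not_less)
    then show "\<bar>W (real l / real N) \<omega>\<bar> \<le> real k" "\<bar>Y N l \<omega>\<bar> \<le> real k" by linarith+
  qed
  have S: "\<bar>\<Sum>i<l. step N i \<omega>\<bar> \<le> 2 * real k" if "l \<le> N" for l
    unfolding sum_step using bd(1)[OF that] bd(1)[of 0] by simp
  fix l assume "l \<in> {..N}"
  then have l: "l \<le> N" by simp
  obtain j where j: "j \<le> l" "walk_min (\<lambda>i. step N i \<omega>) l = (\<Sum>i<j. step N i \<omega>)" using walk_min_attained by blast
  \<comment> \<open>Partial sums of steps are differences of two values of \<open>W\<close>, hence
    at most \<open>2 * real k\<close>; the formula for \<open>reflected\<close> uses two of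
    them.\<close>
  have "R N l \<omega> \<le> 2 * real k + max a (2 * real k)"
    unfolding refl_walk_def reflected_def j(2) using S[OF l] S[of j] j l by (intro add_mono max.mono) auto
  also have "\<dots> \<le> a + 4 * real k" using a_nonneg by (simp add: max_def)
  finally show "\<bar>Y N l \<omega>\<bar> \<le> a + 4 * real k \<and> R N l \<omega> \<le> a + 4 * real k"
    using bd(2)[OF l] a_nonneg by simp
qed

text \<open>The parameters are chosen in a fixed order: the localization level, then
  \<open>\<delta>\<close> to make the potential large at distance \<open>r\<close>, then the
  tolerated gap probability \<open>\<theta>\<close>, and finally \<open>N\<close>.\<close>

lemma solution_tendsto_reflected:
  assumes "\<rho> > 0"
  shows "(\<lambda>N. prob {\<omega>\<in>space M. \<bar>sqrt (X 1 \<omega>) - R N N \<omega>\<bar> > \<rho>}) \<longlonglongrightarrow> 0"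
proof (rule tendstoI)
  fix \<eta> :: real assume \<eta>: "\<eta> > 0"
  have "\<forall>\<^sub>F k in sequentially. prob (exceeds k) < \<eta> / 4"
    using exceeds_tendsto \<eta> by (intro order_tendstoD) auto
  then obtain k where k: "prob (exceeds k) < \<eta> / 4" by (auto simp: eventually_sequentially)
  define C where "C = a + 4 * real k"
  have C: "0 \<le> C" using a_nonneg by (simp add: C_def)
  \<comment> \<open>A distance above \<open>\<rho>\<close> between the roots forces one of at least
    \<open>\<rho>\<^sup>2\<close> between the squares; half of it is allotted to the gap, half to
    the martingale part.\<close>
  define r where "r = \<rho>\<^sup>2 / 2"
  have r: "r > 0" using assms by (simp add: r_def)
  \<comment> \<open>The potential will have expectation at most \<open>3\<close>, so Markov's
    inequality at the level \<open>r * (L - 1) = 12 / \<eta>\<close> gives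
    \<open>\<eta> / 4\<close>.\<close>
  define L where "L = 1 + 12 / (r * \<eta>)"
  have L: "1 \<le> L" using r \<eta> by (simp add: L_def)
  define \<delta> where "\<delta> = r * exp (- L)"
  have \<delta>: "\<delta> > 0" using r by (simp add: \<delta>_def)
  have "r / \<delta> = exp L" using r by (simp add: \<delta>_def exp_minus field_simps)
  then have ln: "ln (r / \<delta>) = L" by simp
  \<comment> \<open>This makes \<open>8 * C\<^sup>2 / \<delta> * \<theta>\<close> at most
    \<open>1 / 4\<close>; the summand \<open>1\<close> covers \<open>C = 0\<close>.\<close>
  define \<theta> where "\<theta> = \<delta> / (32 * (C\<^sup>2 + 1))"
  have C1: "C\<^sup>2 + 1 > 0" by (simp add: add_nonneg_pos)
  have \<theta>: "\<theta> > 0" using \<delta> C1 by (simp add: \<theta>_def)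
  have \<theta>': "8 * C\<^sup>2 / \<delta> * \<theta> \<le> 1 / 4"
    using \<delta> C1 by (simp add: \<theta>_def field_simps)
  have "(\<lambda>N. (4 * C) ^ 3 / (3 * \<delta>\<^sup>2) * (1 / sqrt (real N))) \<longlonglongrightarrow> (4 * C) ^ 3 / (3 * \<delta>\<^sup>2) * 0"
    by (intro tendsto_mult tendsto_const tendsto_divide_0[OF tendsto_const] filterlim_at_top_imp_at_infinity
        filterlim_compose[OF sqrt_at_top filterlim_real_sequentially])
  then have e1: "\<forall>\<^sub>F N in sequentially. (4 * C) ^ 3 / (3 * \<delta>\<^sup>2) * (1 / sqrt (real N)) < 1 / 2"
    by (intro order_tendstoD) auto
  have e2: "\<forall>\<^sub>F N in sequentially. \<forall>j\<le>N. prob {\<omega>\<in>space M. \<bar>gap N j \<omega>\<bar> > \<delta> / 8} \<le> \<theta>"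
    using \<delta> \<theta> by (intro gap_uniform) auto
  have e3: "\<forall>\<^sub>F N in sequentially. \<forall>j\<le>N. prob {\<omega>\<in>space M. \<bar>gap N j \<omega>\<bar> > r} \<le> \<eta> / 4"
    using r \<eta> by (intro gap_uniform) auto
  show "\<forall>\<^sub>F N in sequentially. dist (prob {\<omega>\<in>space M. \<bar>sqrt (X 1 \<omega>) - R N N \<omega>\<bar> > \<rho>}) 0 < \<eta>"
    using e1 e2 e3 eventually_gt_at_top[of 0]
  proof eventually_elim
    case (elim N)
    have gN: "prob {\<omega>\<in>space M. \<bar>gap N j \<omega>\<bar> > \<delta> / 8} \<le> \<theta>" if "j \<le> N" for j using elim(2) that by blast
    note pot = expectation_potential[OF \<delta> C elim(4) gN]
    let ?m = "diff_mart C N N"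
    have Mm [measurable]: "?m \<in> borel_measurable M" by (rule measurable_F_M[OF diff_mart_L2(1)[OF C elim(4)]])
    \<comment> \<open>The three terms are bounded by \<open>9 / 4\<close>, \<open>1 / 4\<close> and
      \<open>1 / 2\<close>.\<close>
    have E: "expectation (\<lambda>\<omega>. yw \<delta> (?m \<omega>)) \<le> 3" using pot(2) \<theta>' elim(1) by linarith
    let ?V = "{\<omega>\<in>space M. r * (L - 1) \<le> yw \<delta> (?m \<omega>)}"
    note [measurable] = yw_measurable[OF \<delta>] refl_walk_M
    have "prob ?V \<le> expectation (\<lambda>\<omega>. yw \<delta> (?m \<omega>)) / (r * (L - 1))"
      using pot(1) yw_nonneg[OF \<delta>] r \<eta> by (intro integral_Markov_inequality_measure[where A = "{}"]) (auto simp: L_def)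
    also have "\<dots> \<le> 3 / (r * (L - 1))" using E r L by (intro divide_right_mono) auto
    also have "\<dots> = \<eta> / 4" using r \<eta> by (simp add: L_def)
    finally have V: "prob ?V \<le> \<eta> / 4" .
    let ?G = "{\<omega>\<in>space M. \<bar>gap N N \<omega>\<bar> > r}"
    have G: "prob ?G \<le> \<eta> / 4" using elim(3) by blast
    have X1: "X 1 \<in> borel_measurable M" by (rule X_M) simp
    have "prob {\<omega>\<in>space M. \<bar>sqrt (X 1 \<omega>) - R N N \<omega>\<bar> > \<rho>} \<le> prob (exceeds k \<union> (?G \<union> ?V))"
    proof (rule finite_measure_mono_AE)
      show "exceeds k \<union> (?G \<union> ?V) \<in> events" by (intro sets.Un exceeds_events) measurable
      show "AE \<omega> in M. \<omega> \<in> {\<omega>\<in>space M. \<bar>sqrt (X 1 \<omega>) - R N N \<omega>\<bar> > \<rho>} \<longrightarrow> \<omega> \<in> exceeds k \<union> (?G \<union> ?V)"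
        using grid_AE[of N N]
      proof (eventually_elim, intro impI)
        fix \<omega> assume X: "X (real N / real N) \<omega> = a\<^sup>2 + real N / real N + J (real N / real N) \<omega> \<and> 0 \<le> X (real N / real N) \<omega>"
          and "\<omega> \<in> {\<omega>\<in>space M. \<bar>sqrt (X 1 \<omega>) - R N N \<omega>\<bar> > \<rho>}"
        then have w: "\<omega> \<in> space M" "\<bar>sqrt (X 1 \<omega>) - R N N \<omega>\<bar> > \<rho>" by auto
        have N1: "real N / real N = 1" using elim(4) by simp
        show "\<omega> \<in> exceeds k \<union> (?G \<union> ?V)"
        proof (rule ccontr)
          assume n: "\<omega> \<notin> exceeds k \<union> (?G \<union> ?V)"
          have b: "below C N N \<omega>" unfolding C_def using n w(1) elim(4) by (intro below_if_not_exceeds) auto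
          have g: "\<bar>gap N N \<omega>\<bar> \<le> r" using n w(1) by auto
          have X0: "0 \<le> X 1 \<omega>" using X N1 by simp
          have eq: "?m \<omega> = X 1 \<omega> - (R N N \<omega>)\<^sup>2 + gap N N \<omega>"
            using diff_mart_eq[OF b] X unfolding N1 by blast
          have "\<rho>\<^sup>2 \<le> (sqrt (X 1 \<omega>) - R N N \<omega>)\<^sup>2"
            using power_mono[of \<rho> "\<bar>sqrt (X 1 \<omega>) - R N N \<omega>\<bar>" 2] w(2) assms by simp
          also have "\<dots> \<le> \<bar>(sqrt (X 1 \<omega>))\<^sup>2 - (R N N \<omega>)\<^sup>2\<bar>"
            using X0 by (intro square_diff_le R_nonneg) simp
          also have "(sqrt (X 1 \<omega>))\<^sup>2 = X 1 \<omega>" using X0 by simp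
          finally have "2 * r \<le> \<bar>X 1 \<omega> - (R N N \<omega>)\<^sup>2\<bar>" by (simp add: r_def)
          moreover have "\<bar>X 1 \<omega> - (R N N \<omega>)\<^sup>2\<bar> \<le> \<bar>?m \<omega>\<bar> + \<bar>gap N N \<omega>\<bar>"
            using abs_triangle_ineq4[of "?m \<omega>" "gap N N \<omega>"] unfolding eq by simp
          ultimately have "r \<le> \<bar>?m \<omega>\<bar>" using g by linarith
          then have "r * (L - 1) \<le> yw \<delta> (?m \<omega>)" using yw_ge[OF \<delta> r, of "?m \<omega>"] L unfolding ln by blast
          then show False using n w(1) by blast
        qed
      qed
    qed
    also have "\<dots> \<le> prob (exceeds k) + prob (?G \<union> ?V)" by (intro measure_Un_le exceeds_events sets.Un) measurable
    also have "prob (?G \<union> ?V) \<le> prob ?G + prob ?V" by (intro measure_Un_le) measurable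
    finally have "prob {\<omega>\<in>space M. \<bar>sqrt (X 1 \<omega>) - R N N \<omega>\<bar> > \<rho>} < \<eta>" using k G V \<eta> by linarith
    then show ?case by simp
  qed
qed

end

subsection \<open>The lower bound\<close>

lemma ennreal_powr_root_ge:
  assumes "p \<ge> 1" "0 \<le> t" "0 \<le> c" "ennreal (t powr p * c) \<le> x"
  shows "ennreal (t * c powr (1 / p)) \<le> ennreal_powr x (1 / p)"
proof (cases "x = \<infinity>")
  case False
  then have "t powr p * c \<le> enn2real x"
    using assms(3,4) by (cases x) (auto simp: ennreal_le_iff2)
  then have "(t powr p * c) powr (1 / p) \<le> enn2real x powr (1 / p)"
    using assms by (intro powr_mono2) auto
  moreover have "(t powr p * c) powr (1 / p) = t * c powr (1 / p)"
    using assms by (simp add: powr_mult powr_powr)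
  ultimately show ?thesis using False by (simp add: ennreal_powr_def ennreal_leI)
qed (simp add: ennreal_powr_def)

text \<open>Markov's inequality read backwards: one lower bound in probability yields a lower bound
  for the error in every \<open>p\<close>-norm, including approximations with infinite
  moment.\<close>

lemma (in prob_space) Lp_error_ge:
  assumes "p \<ge> 1" "t > 0" "Y \<in> borel_measurable M" "Z \<in> borel_measurable M"
    and "c \<le> prob {\<omega>\<in>space M. t \<le> \<bar>Y \<omega> - Z \<omega>\<bar>}" "0 \<le> c"
  shows "ennreal (t * c powr (1 / p)) \<le> Lp_error M p Y Z"
  unfolding Lp_error_def
proof (rule ennreal_powr_root_ge)
  let ?A = "{\<omega>\<in>space M. t \<le> \<bar>Y \<omega> - Z \<omega>\<bar>}"
  note [measurable] = assms(3,4)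
  have A: "?A \<in> events" by measurable
  have "ennreal (t powr p * c) \<le> ennreal (t powr p * prob ?A)"
    using assms by (intro ennreal_leI mult_left_mono) auto
  also have "\<dots> = ennreal (t powr p) * emeasure M ?A"
    by (simp add: ennreal_mult emeasure_eq_measure)
  also have "\<dots> = (\<integral>\<^sup>+ \<omega>. ennreal (t powr p) * indicator ?A \<omega> \<partial>M)"
    using A by (simp add: nn_integral_cmult_indicator)
  also have "\<dots> \<le> (\<integral>\<^sup>+ \<omega>. ennreal (\<bar>Y \<omega> - Z \<omega>\<bar> powr p) \<partial>M)"
    using assms(1,2) by (intro nn_integral_mono) (auto simp: indicator_def intro!: ennreal_leI powr_mono2)
  finally show "ennreal (t powr p * c) \<le> (\<integral>\<^sup>+ \<omega>. ennreal (\<bar>Y \<omega> - Z \<omega>\<bar> powr p) \<partial>M)" .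
qed (use assms in auto)

text \<open>The difference of squares has the factor \<open>sqrt x + sqrt (max 0 z)\<close>, which
  is at least \<open>1 / 2\<close>. Replacing a negative approximation by 0 only brings it closer to
  \<open>x\<close>.\<close>

lemma sqrt_diff_le:
  fixes x z d :: real
  assumes "0 \<le> x" "1 / 2 \<le> sqrt x" "d \<le> \<bar>sqrt x - sqrt (max 0 z)\<bar>"
  shows "d / 2 \<le> \<bar>x - z\<bar>"
proof -
  let ?y = "sqrt x" and ?w = "sqrt (max 0 z)"
  have "d / 2 \<le> \<bar>?y - ?w\<bar> * (1 / 2)" using assms(3) by simp
  also have "\<dots> \<le> \<bar>?y - ?w\<bar> * (?y + ?w)"
    using assms(2) by (intro mult_left_mono) (auto intro: add_increasing2)
  also have "\<dots> = \<bar>(?y - ?w) * (?y + ?w)\<bar>" using assms(1) by (simp add: abs_mult)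
  also have "(?y - ?w) * (?y + ?w) = x - max 0 z"
    using assms(1) by (simp add: algebra_simps)
  also have "\<bar>x - max 0 z\<bar> \<le> \<bar>x - z\<bar>" using assms(1) by (simp add: max_def)
  finally show ?thesis .
qed

section \<open>Transfer to the solution and to the minimal error\<close>

context squared_bessel begin

text \<open>The time \<open>k / n\<close> is coarse point number \<open>3 * k\<close>, so the data
  seen by \<open>\<Phi>\<close> are determined by the coarse values. The root of its positive part
  is then an admissible approximation of the reflected walk, and \<open>law_steps\<close> transports
  the bound for the Gaussian vector to the Brownian path.\<close>

lemma reflected_grid_lower_bound:
  assumes \<Phi>: "\<Phi> \<in> borel_measurable (\<Pi>\<^sub>M k\<in>{1..n}. (borel :: real measure))" and nl: "n > 0" "l > 0"
    and lb: "\<And>\<psi>. \<psi> \<in> borel_measurable (gauss_steps (3 * n * (l + l)) (1 / sqrt (real (3 * n * (l + l))))) \<Longrightarrow>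
      (\<And>x x'. (\<forall>j\<le>3 * n. (\<Sum>i<j * (l + l). x i) = (\<Sum>i<j * (l + l). x' i)) \<Longrightarrow> \<psi> x = \<psi> x') \<Longrightarrow>
      c \<le> measure (gauss_steps (3 * n * (l + l)) (1 / sqrt (real (3 * n * (l + l)))))
      {x \<in> space (gauss_steps (3 * n * (l + l)) (1 / sqrt (real (3 * n * (l + l))))).
        d \<le> \<bar>reflected a x (3 * n * (l + l)) - \<psi> x\<bar> \<and> 1 \<le> reflected a x (3 * n * (l + l))}"
  defines "N \<equiv> 3 * n * (l + l)"
  defines "Z \<equiv> \<lambda>\<omega>. sqrt (max 0 (\<Phi> (\<lambda>k\<in>{1..n}. W (real k / real n) \<omega>)))"
  shows "Z \<in> borel_measurable M" and "c \<le> prob {\<omega>\<in>space M. d \<le> \<bar>R N N \<omega> - Z \<omega>\<bar> \<and> 1 \<le> R N N \<omega>}"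
proof -
  let ?L = "l + l"
  let ?P = "gauss_steps N (1 / sqrt (real N))"
  have N: "N > 0" using nl by (simp add: N_def)
  have kN: "3 * k * ?L \<le> N" if "k \<le> n" for k
    unfolding N_def using that by (intro mult_le_mono) auto
  define \<psi> where "\<psi> x = sqrt (max 0 (\<Phi> (\<lambda>k\<in>{1..n}. \<Sum>i<3 * k * ?L. x i)))" for x
  have \<psi>m: "\<psi> \<in> borel_measurable ?P"
  proof -
    have "(\<lambda>x. \<lambda>k\<in>{1..n}. \<Sum>i<3 * k * ?L. x i) \<in> measurable ?P (\<Pi>\<^sub>M k\<in>{1..n}. borel)"
      by (intro measurable_restrict measurable_walk(1) kN) auto
    from measurable_compose[OF this \<Phi>]
    have [measurable]: "(\<lambda>x. \<Phi> (\<lambda>k\<in>{1..n}. \<Sum>i<3 * k * ?L. x i)) \<in> borel_measurable ?P" .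
    show ?thesis unfolding \<psi>_def[abs_def] by measurable
  qed
  have \<psi>: "\<psi> x = \<psi> x'" if "\<forall>j\<le>3 * n. (\<Sum>i<j * ?L. x i) = (\<Sum>i<j * ?L. x' i)" for x x'
  proof -
    have "(\<lambda>k\<in>{1..n}. \<Sum>i<3 * k * ?L. x i) = (\<lambda>k\<in>{1..n}. \<Sum>i<3 * k * ?L. x' i)"
      using that by (intro restrict_ext) auto
    then show ?thesis unfolding \<psi>_def by (simp only:)
  qed
  have Wm: "(\<lambda>\<omega>. \<lambda>k\<in>{1..n}. W (real k / real n) \<omega>) \<in> measurable M (\<Pi>\<^sub>M k\<in>{1..n}. borel)"
    by (intro measurable_restrict W_measurable_M) auto
  have [measurable]: "(\<lambda>\<omega>. \<Phi> (\<lambda>k\<in>{1..n}. W (real k / real n) \<omega>)) \<in> borel_measurable M"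
    by (rule measurable_compose[OF Wm \<Phi>])
  show Zm [measurable]: "Z \<in> borel_measurable M" unfolding Z_def by measurable
  let ?Q = "{x \<in> space ?P. d \<le> \<bar>reflected a x N - \<psi> x\<bar> \<and> 1 \<le> reflected a x N}"
  let ?S = "\<lambda>\<omega>. \<lambda>i\<in>{..<N}. step N i \<omega>"
  have Sm: "?S \<in> measurable M ?P"
    by (simp add: measurable_cong_sets[OF refl sets_gauss_steps] measurable_restrict)
  have Qm: "?Q \<in> sets ?P"
    by (intro sets.sets_Collect_conj borel_measurable_le borel_measurable_const borel_measurable_abs
        borel_measurable_diff measurable_walk(3) \<psi>m order_refl)
  have "c \<le> measure ?P ?Q" unfolding N_def by (rule lb[OF \<psi>m[unfolded N_def] \<psi>])
  also have "\<dots> = prob (?S -` ?Q \<inter> space M)"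
    using measure_distr[OF Sm Qm] unfolding law_steps[OF N] .
  also have "\<dots> \<le> prob {\<omega>\<in>space M. d \<le> \<bar>R N N \<omega> - Z \<omega>\<bar> \<and> 1 \<le> R N N \<omega>}"
  proof (rule finite_measure_mono_AE)
    note [measurable] = refl_walk_M
    show "{\<omega>\<in>space M. d \<le> \<bar>R N N \<omega> - Z \<omega>\<bar> \<and> 1 \<le> R N N \<omega>} \<in> events" by measurable
    show "AE \<omega> in M. \<omega> \<in> ?S -` ?Q \<inter> space M \<longrightarrow> \<omega> \<in> {\<omega>\<in>space M. d \<le> \<bar>R N N \<omega> - Z \<omega>\<bar> \<and> 1 \<le> R N N \<omega>}"
      using start_zero
    proof (eventually_elim, intro impI)
      fix \<omega> assume W0: "W 0 \<omega> = 0" and "\<omega> \<in> ?S -` ?Q \<inter> space M"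
      then have w: "\<omega> \<in> space M" "d \<le> \<bar>reflected a (?S \<omega>) N - \<psi> (?S \<omega>)\<bar>" "1 \<le> reflected a (?S \<omega>) N" by blast+
      have r: "reflected a (?S \<omega>) N = R N N \<omega>"
        unfolding refl_walk_def by (rule reflected_cong) simp
      have "(\<lambda>k\<in>{1..n}. \<Sum>i<3 * k * ?L. ?S \<omega> i) = (\<lambda>k\<in>{1..n}. W (real k / real n) \<omega>)"
      proof (rule restrict_ext)
        fix k assume "k \<in> {1..n}"
        then have k: "k \<le> n" by simp
        have "(\<Sum>i<3 * k * ?L. ?S \<omega> i) = (\<Sum>i<3 * k * ?L. step N i \<omega>)"
        proof (intro sum.cong refl)
          fix i assume "i \<in> {..<3 * k * ?L}"
          then have "i < N" using kN[OF k] by (simp only: lessThan_iff)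
          then show "?S \<omega> i = step N i \<omega>" by simp
        qed
        also have "\<dots> = W (real (3 * k * ?L) / real N) \<omega>" unfolding sum_step W0 by simp
        also have "real (3 * k * ?L) / real N = real k / real n" using nl by (simp add: N_def field_simps)
        finally show "(\<Sum>i<3 * k * ?L. ?S \<omega> i) = W (real k / real n) \<omega>" .
      qed
      then have "\<psi> (?S \<omega>) = Z \<omega>" unfolding \<psi>_def Z_def by (simp only:)
      then show "\<omega> \<in> {\<omega>\<in>space M. d \<le> \<bar>R N N \<omega> - Z \<omega>\<bar> \<and> 1 \<le> R N N \<omega>}" using w unfolding r by simp
    qed
  qed
  finally show "c \<le> prob {\<omega>\<in>space M. d \<le> \<bar>R N N \<omega> - Z \<omega>\<bar> \<and> 1 \<le> R N N \<omega>}" .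
qed

lemma approximation_lower_bound:
  obtains c d :: real where "c > 0" "d > 0"
    "\<And>n \<Phi>. n > 0 \<Longrightarrow> \<Phi> \<in> borel_measurable (\<Pi>\<^sub>M k\<in>{1..n}. (borel :: real measure)) \<Longrightarrow>
      c \<le> prob {\<omega>\<in>space M. d / sqrt n \<le> \<bar>X 1 \<omega> - \<Phi> (\<lambda>k\<in>{1..n}. W (real k / real n) \<omega>)\<bar>}"
proof -
  obtain c \<kappa> where c: "c > 0" and \<kappa>: "\<kappa> > 0" and lb: "\<forall>n l \<psi>. n > 0 \<longrightarrow> l > 0 \<longrightarrow>
    \<psi> \<in> borel_measurable (gauss_steps (3 * n * (l + l)) (1 / sqrt (real (3 * n * (l + l))))) \<longrightarrow>
    (\<forall>x x'. (\<forall>j\<le>3 * n. (\<Sum>i<j * (l + l). x i) = (\<Sum>i<j * (l + l). x' i)) \<longrightarrow> \<psi> x = \<psi> x') \<longrightarrow>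
    c \<le> measure (gauss_steps (3 * n * (l + l)) (1 / sqrt (real (3 * n * (l + l)))))
      {x \<in> space (gauss_steps (3 * n * (l + l)) (1 / sqrt (real (3 * n * (l + l))))).
        \<kappa> / sqrt n \<le> \<bar>reflected a x (3 * n * (l + l)) - \<psi> x\<bar> \<and> 1 \<le> reflected a x (3 * n * (l + l))}"
    using walk_lower_bound[OF a_nonneg] by blast
  have "c / 2 \<le> prob {\<omega>\<in>space M. \<kappa> / 4 / sqrt n \<le> \<bar>X 1 \<omega> - \<Phi> (\<lambda>k\<in>{1..n}. W (real k / real n) \<omega>)\<bar>}"
    if n: "n > 0" and \<Phi>: "\<Phi> \<in> borel_measurable (\<Pi>\<^sub>M k\<in>{1..n}. (borel :: real measure))" for n \<Phi>
  proof -
    let ?\<Phi> = "\<lambda>\<omega>. \<Phi> (\<lambda>k\<in>{1..n}. W (real k / real n) \<omega>)"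
    let ?Z = "\<lambda>\<omega>. sqrt (max 0 (?\<Phi> \<omega>))"
    define d where "d = \<kappa> / sqrt n"
    have d: "d > 0" using \<kappa> n by (simp add: d_def)
    \<comment> \<open>An error of \<open>d / 2\<close> leaves half of the gap between
      \<open>R\<close> and \<open>?Z\<close>, and an error of \<open>1 / 2\<close> keeps the root of
      the solution above \<open>1 / 2\<close>.\<close>
    define \<rho> where "\<rho> = min (d / 2) (1 / 2)"
    have \<rho>: "\<rho> > 0" "\<rho> \<le> d / 2" "\<rho> \<le> 1 / 2" using d by (auto simp: \<rho>_def)
    let ?N = "\<lambda>l. 3 * n * (l + l)"
    have "filterlim ?N at_top sequentially"
      using n by (intro filterlim_subseq strict_monoI) simp
    then have "(\<lambda>l. prob {\<omega>\<in>space M. \<bar>sqrt (X 1 \<omega>) - R (?N l) (?N l) \<omega>\<bar> > \<rho>}) \<longlonglongrightarrow> 0"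
      by (rule filterlim_compose[OF solution_tendsto_reflected[OF \<rho>(1)]])
    then have "\<forall>\<^sub>F l in sequentially. prob {\<omega>\<in>space M. \<bar>sqrt (X 1 \<omega>) - R (?N l) (?N l) \<omega>\<bar> > \<rho>} < c / 2"
      by (rule order_tendstoD) (use c in simp)
    then have "\<forall>\<^sub>F l in sequentially. l > 0 \<and> prob {\<omega>\<in>space M. \<bar>sqrt (X 1 \<omega>) - R (?N l) (?N l) \<omega>\<bar> > \<rho>} < c / 2"
      using eventually_gt_at_top[of 0] by eventually_elim blast
    \<comment> \<open>The fineness may depend on \<open>n\<close>, because \<open>c\<close> and
      \<open>\<kappa>\<close> do not depend on \<open>l\<close>.\<close>
    then obtain l where l: "l > 0" "prob {\<omega>\<in>space M. \<bar>sqrt (X 1 \<omega>) - R (?N l) (?N l) \<omega>\<bar> > \<rho>} < c / 2"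
      unfolding eventually_sequentially by blast
    note grid = reflected_grid_lower_bound[OF \<Phi> n l(1), where c = c and d = d]
    have Zm [measurable]: "?Z \<in> borel_measurable M"
      by (rule grid(1)) (use lb n l(1) d_def in blast)
    have Q: "c \<le> prob {\<omega>\<in>space M. d \<le> \<bar>R (?N l) (?N l) \<omega> - ?Z \<omega>\<bar> \<and> 1 \<le> R (?N l) (?N l) \<omega>}"
      by (rule grid(2)) (use lb n l(1) d_def in blast)
    have Wm: "(\<lambda>\<omega>. \<lambda>k\<in>{1..n}. W (real k / real n) \<omega>) \<in> measurable M (\<Pi>\<^sub>M k\<in>{1..n}. borel)"
      by (intro measurable_restrict W_measurable_M) auto
    have [measurable]: "?\<Phi> \<in> borel_measurable M" by (rule measurable_compose[OF Wm \<Phi>])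
    have [measurable]: "X 1 \<in> borel_measurable M" by (rule X_M) simp
    note [measurable] = refl_walk_M
    let ?D = "{\<omega>\<in>space M. \<kappa> / 4 / sqrt n \<le> \<bar>X 1 \<omega> - ?\<Phi> \<omega>\<bar>}"
    let ?E = "{\<omega>\<in>space M. \<bar>sqrt (X 1 \<omega>) - R (?N l) (?N l) \<omega>\<bar> > \<rho>}"
    have "prob {\<omega>\<in>space M. d \<le> \<bar>R (?N l) (?N l) \<omega> - ?Z \<omega>\<bar> \<and> 1 \<le> R (?N l) (?N l) \<omega>} \<le> prob (?D \<union> ?E)"
    proof (rule finite_measure_mono_AE)
      show "?D \<union> ?E \<in> events" by measurable
      show "AE \<omega> in M. \<omega> \<in> {\<omega>\<in>space M. d \<le> \<bar>R (?N l) (?N l) \<omega> - ?Z \<omega>\<bar> \<and> 1 \<le> R (?N l) (?N l) \<omega>} \<longrightarrow> \<omega> \<in> ?D \<union> ?E"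
        using X_nonneg
      proof (eventually_elim, intro impI)
        fix \<omega> assume X: "\<forall>t\<ge>0. 0 \<le> X t \<omega>"
          and "\<omega> \<in> {\<omega>\<in>space M. d \<le> \<bar>R (?N l) (?N l) \<omega> - ?Z \<omega>\<bar> \<and> 1 \<le> R (?N l) (?N l) \<omega>}"
        then have w: "\<omega> \<in> space M" "d \<le> \<bar>R (?N l) (?N l) \<omega> - ?Z \<omega>\<bar>" "1 \<le> R (?N l) (?N l) \<omega>" by blast+
        show "\<omega> \<in> ?D \<union> ?E"
        proof (cases "\<omega> \<in> ?E")
          case False
          then have e: "\<bar>sqrt (X 1 \<omega>) - R (?N l) (?N l) \<omega>\<bar> \<le> \<rho>" using w(1) by simp
          have X1: "0 \<le> X 1 \<omega>" using X by simp
          have gen: "1 / 2 \<le> y \<and> d / 2 \<le> \<bar>y - z\<bar>" if "\<bar>y - r\<bar> \<le> \<rho>" "d \<le> \<bar>r - z\<bar>" "1 \<le> r" for y r z :: real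
            using that \<rho>(2,3) by (auto simp: abs_real_def split: if_splits)
          \<comment> \<open>The first halving pays for replacing the walk by the solution, the
            second for squaring.\<close>
          have "d / 2 / 2 \<le> \<bar>X 1 \<omega> - ?\<Phi> \<omega>\<bar>"
            using gen[OF e w(2,3)] by (intro sqrt_diff_le[OF X1]) blast+
          moreover have "d / 2 / 2 = \<kappa> / 4 / sqrt n" by (simp add: d_def)
          ultimately show ?thesis using w(1) by simp
        qed simp
      qed
    qed
    also have "\<dots> \<le> prob ?D + prob ?E" by (rule measure_Un_le) measurable
    finally show ?thesis using Q l(2) by linarith
  qed
  then show thesis using that[of "c / 2" "\<kappa> / 4"] c \<kappa> by simp
qed

lemma eq_min_error_lower_bound:
  assumes "p \<ge> 1"
  shows "eq_min_error M W (X 1) p \<succcurlyeq> (\<lambda>n. ennreal (real n powr (- 1 / 2)))"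
proof -
  obtain c d :: real where c: "c > 0" and d: "d > 0" and lb:
    "\<And>n \<Phi>. n > 0 \<Longrightarrow> \<Phi> \<in> borel_measurable (\<Pi>\<^sub>M k\<in>{1..n}. (borel :: real measure)) \<Longrightarrow>
      c \<le> prob {\<omega>\<in>space M. d / sqrt n \<le> \<bar>X 1 \<omega> - \<Phi> (\<lambda>k\<in>{1..n}. W (real k / real n) \<omega>)\<bar>}"
    by (rule approximation_lower_bound) blast
  define e where "e = d * c powr (1 / p)"
  have e: "e > 0" using c d by (simp add: e_def)
  have "ennreal (real n powr (- 1 / 2)) \<le> ennreal (1 / e) * eq_min_error M W (X 1) p n" if n: "n \<ge> 1" for n
  proof -
    have "ennreal (e / sqrt n) \<le> eq_min_error M W (X 1) p n"
      unfolding eq_min_error_def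
    proof (rule INF_greatest)
      fix \<Phi> :: "(nat \<Rightarrow> real) \<Rightarrow> real"
      assume \<Phi>: "\<Phi> \<in> borel_measurable (\<Pi>\<^sub>M k\<in>{1..n}. (borel :: real measure))"
      have Wm: "(\<lambda>\<omega>. \<lambda>k\<in>{1..n}. W (real k / real n) \<omega>) \<in> measurable M (\<Pi>\<^sub>M k\<in>{1..n}. borel)"
        by (intro measurable_restrict W_measurable_M) auto
      have "ennreal (d / sqrt n * c powr (1 / p)) \<le> Lp_error M p (X 1) (\<lambda>\<omega>. \<Phi> (\<lambda>k\<in>{1..n}. W (real k / real n) \<omega>))"
        using n c d by (intro Lp_error_ge assms X_M measurable_compose[OF Wm \<Phi>] lb[OF _ \<Phi>]) auto
      then show "ennreal (e / sqrt n) \<le> Lp_error M p (X 1) (\<lambda>\<omega>. \<Phi> (\<lambda>k\<in>{1..n}. W (real k / real n) \<omega>))"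
        by (simp add: e_def)
    qed
    then have "ennreal (1 / e) * ennreal (e / sqrt n) \<le> ennreal (1 / e) * eq_min_error M W (X 1) p n"
      by (rule mult_left_mono) simp
    moreover have "ennreal (1 / e) * ennreal (e / sqrt n) = ennreal (real n powr (- 1 / 2))"
    proof -
      have "1 / e * (e / sqrt n) = real n powr (- 1 / 2)"
        using e n by (simp add: powr_minus powr_half_sqrt inverse_eq_divide)
      then show ?thesis using e by (subst ennreal_mult'[symmetric]) auto
    qed
    ultimately show ?thesis by simp
  qed
  moreover have "1 / e > 0" using e by simp
  ultimately show ?thesis unfolding asymp_dominates_def by blast
qed

end

theorem theorem3:
  fixes M :: "'a measure" and F :: "real \<Rightarrow> 'a measure"
    and W X :: "real \<Rightarrow> 'a \<Rightarrow> real" and x0 p :: real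
  assumes "brownian_motion M F W"
    and "x0 \<ge> 0"
    and "strong_solution M F W (\<lambda>x. 1) (\<lambda>x. 2 * sqrt x) x0 X"
    and "AE \<omega> in M. \<forall>t\<ge>0. X t \<omega> \<ge> 0"
    and "p \<ge> 1"
  shows "eq_min_error M W (X 1) p \<succcurlyeq> (\<lambda>n. ennreal (real n powr (- 1 / 2)))"
proof -
  interpret brownian_motion M F W by fact
  note sol = assms(3)[unfolded strong_solution_def]
  note X = conjunct1[OF sol] conjunct1[OF conjunct2[OF sol]]
  define P where "P t J \<longleftrightarrow> has_ito_integral M F W (\<lambda>s \<omega>. 2 * sqrt (X s \<omega>)) t J \<and>
      (AE \<omega> in M. X t \<omega> = x0 + (LINT s:{0..t}|lborel. 1) + J \<omega>)" for t J
  have ex: "\<forall>t\<ge>0. \<exists>J. P t J"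
    unfolding P_def by (rule conjunct2[OF conjunct2[OF conjunct2[OF conjunct2[OF sol]]]])
  \<comment> \<open>A solution comes with some version of the integral for each single time; the
    choice assembles them into a family, without any regularity in \<open>t\<close>.\<close>
  define J where "J t = (SOME J. P t J)" for t
  have "P t (J t)" if "0 \<le> t" for t
    unfolding J_def by (rule someI_ex[where P = "P t"]) (rule ex[rule_format, OF that])
  then have J: "\<And>t. 0 \<le> t \<Longrightarrow> has_ito_integral M F W (\<lambda>s \<omega>. 2 * sqrt (X s \<omega>)) t (J t)"
    "\<And>t. 0 \<le> t \<Longrightarrow> AE \<omega> in M. X t \<omega> = x0 + (LINT s:{0..t}|lborel. 1) + J t \<omega>"
    unfolding P_def by blast+
  have time: "(LINT s:{0..t}|lborel. 1) = t" if "0 \<le> t" for t :: real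
    using that by (simp add: set_lebesgue_integral_def)
  \<comment> \<open>The root of the starting value is where the reflected walk starts, since it is
    compared with the root of the solution.\<close>
  interpret squared_bessel M F W X J "sqrt x0"
  proof unfold_locales
    show "AE \<omega> in M. X t \<omega> = (sqrt x0)\<^sup>2 + t + J t \<omega>" if "0 \<le> t" for t
      using J(2)[OF that] time[OF that] assms(2) by simp
  qed (use X J assms in auto)
  show ?thesis using assms(5) by (rule eq_min_error_lower_bound)
qed

end
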